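(* Consider the misspecified potential stochastic Nash game and the asynchronous inexact proximal best-response scheme with stochastic learning described in the context, and suppose that the assumptions (B1), (B2), (B3) listed there hold. Suppose further that the proximal parameter $\mu$ satisfies $\mu>\frac{L_x}{2}+\sqrt3\,L_x\tau$, and that for every $i\in\mathcal N$, $N_i(k)=\lfloor\Gamma_i(k)^{2(1+\delta)}\rfloor$ for some $\delta>0$, where $\Gamma_i(0)=1$ and $\Gamma_i(k)=1+\sum_{t=0}^{k-1}\mathbf 1_{[i_t=i]}$ for $k\ge1$. Then the sequences $\{\theta_i(k)\}$ and $\{x_i(k)\}$ generated by the scheme satisfy the following. (a) For any $i\in\mathcal N$, $\sum_{k=1}^\infty\|\theta_i(k)-\theta^*\|^2<\infty$ a.s. and $\sum_{k=1}^\infty\|\theta_i(k)-\theta^*\|<\infty$ a.s. (b) For any $i\in\mathcal N$, $\sum_{k=0}^\infty\|T_i(y^i(k),\theta^* )-x_i(k)\|^2<\infty$ a.s. (c) For almost all $\omega$, every limit point of $\{x(k,\omega)\}$ is a Nash equilibrium. (d) There exists a connected subset $X_c^*\subset X^*$ of the set $X^*$ of Nash equilibria such that $d(x(k),X_c^* )\to0$ as $k\to\infty$ a.s., where $d(x,A)=\inf_{a\in A}\|x-a\|$.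
   Context: **Game.** Players $\mathcal N=\{1,\dots,N\}$; player $i$ has strategy $x_i\in X_i\subset\mathbb R^{n_i}$; $X=\prod_i X_i$, $X_{-i}=\prod_{j\ne i}X_j$, $x_{-i}=(x_j)_{j\ne i}$. Given $x_{-i}$, player $i$ solves $\min_{x_i\in X_i}f_i(x_i,x_{-i};\theta^* )$, where $f_i(x_i,x_{-i};\theta)=\mathbb E_\xi[\psi_i(x_i,x_{-i};\theta;\xi)]$, $\xi$ is an $\mathbb R^d$-valued random vector, $\psi_i$ is scalar-valued, and $\theta^*$ is an unknown parameter that is a solution of $\min_{\theta\in\Theta}g(\theta)$, $g(\theta)=\mathbb E_\eta[g(\theta,\eta)]$, with $\Theta\subset\mathbb R^m$ closed and convex and $\eta$ an $\mathbb R^p$-valued random vector. A Nash equilibrium is $x^*\in X$ with $f_i(x_i^*,x_{-i}^*;\theta^* )\le f_i(x_i,x_{-i}^*;\theta^* )$ for all $x_i\in X_i$ and all $i\in\mathcal N$; $X^*$ is the set of Nash equilibria. $\|\cdot\|$ is the Euclidean norm and $\Pi_\Theta$ is Euclidean projection onto $\Theta$. **(B1)** (a) For every $i$, $X_i$ is a closed, compact and convex set; $f_i(x_i,x_{-i};\theta)$ is convex and continuously differentiable in $x_i$ over an open set containing $X_i$ for every $x_{-i}\in X_{-i}$ and every $\theta\in\Theta$. (b) For every $i$, $\|\nabla_{x_i}f_i(x;\theta^* )-\nabla_{x_i}f_i(x';\theta^* )\|\le L_x\|x-x'\|$ for all $x,x'\in X$; further, there is a constant $L_{\theta^*}$ such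 that for any $x\in X$ and every $i$, $\|\nabla_{x_i}f_i(x;\theta)-\nabla_{x_i}f_i(x;\theta^* )\|\le L_{\theta^*}\|\theta-\theta^*\|$ for all $\theta\in\Theta$. (c) $g(\theta)$ is strongly convex with convexity constant $\mu_g$ and is continuously differentiable in $\theta$ on an open set containing $\Theta$, with $L_g$-Lipschitz continuous gradient. (d) There is a function $P(\cdot;\cdot):X\times\Theta\to\mathbb R$ such that for every $i$ and any $x_{-i}\in X_{-i}$, $P(x_i,x_{-i};\theta^* )-P(x_i',x_{-i};\theta^* )=f_i(x_i,x_{-i};\theta^* )-f_i(x_i',x_{-i};\theta^* )$ for all $x_i,x_i'\in X_i$. **(B2)** (a) For any $i$, all $x_{-i}\in X_{-i}$, any $\theta\in\Theta$ and any $\xi\in\mathbb R^d$, $\psi_i(x_i,x_{-i};\theta;\xi)$ is differentiable in $x_i$ over an open set containing $X_i$, with $\nabla_{x_i}f_i(x_i,x_{-i};\theta)=\mathbb E[\nabla_{x_i}\psi_i(x_i,x_{-i};\theta;\xi)]$. (b) For any $i$ and any $x\in X$, there exists a constant $M_1>0$ such that $\mathbb E[\|\nabla_{x_i}\psi_i(x_i,x_{-i};\theta;\xi)\|^2]\le M_1^2$. (c) For any $\eta\in\mathbb R^p$, $g(\theta,\eta)$ is differentiable in $\theta$ over an open set containing $\Theta$, with $\nabla g(\theta)=\mathbb E_\eta[\nabla g(\theta,\eta)]$. **Proximal best response.** For $\mu>0$, $T_i(x,\theta)=\arg\min_{y_i\in X_i}\big[f_i(y_i,x_{-i};\theta)+\frac\mu2\|y_i-x_i\|^2\big]$.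 **Scheme.** Start with $x_i(0)\in X_i$, $\theta_i(0)\in\Theta$ for $i\in\mathcal N$; fix $0<p_i<1$ with $\sum_ip_i=1$. At iteration $k\ge0$ a player $i_k$ is picked randomly, with $\mathbb P(i_k=i)=p_i$. Player $i$ has access to the possibly delayed vector $y^i(k)=(x_1(k-d_{i1}(k)),\dots,x_N(k-d_{iN}(k)))$ with (random) delays $d_{ij}(k)$, where $d_{ii}(k)=0$. If $i_k=i$, then player $i$ updates $x_i(k+1)\in X_i$ and $\theta_i(k+1)\in\Theta$ by $$x_i(k+1)=T_i(y^i(k),\theta_i(k))+\varepsilon_i(k+1),\qquad \theta_i(k+1)=\Pi_\Theta\Big[\theta_i(k)-\frac{\beta_i}{N_i(k)}\sum_{p=1}^{N_i(k)}\nabla g(\theta_i(k),\eta_{i,p}(k))\Big],\qquad \beta_i=\frac1{L_g},$$ while $x_j(k+1)=x_j(k)$, $\theta_j(k+1)=\theta_j(k)$ for $j\ne i_k$. Here $\varepsilon_i(k+1)$ denotes the inexactness with which $T_i(y^i(k),\theta_i(k))$ is computed (by a stochastic approximation scheme using a vector $\xi_i(k)$ of finitely many samples of $\xi$), $\nabla g(\theta_i(k),\eta_{i,p}(k))$, $p=1,\dots,N_i(k)$, denote the sampled gradients, and $\eta_i(k)=(\eta_{i,1}(k),\dots,\eta_{i,N_i(k)}(k))$. Write $x(k)=(x_1(k),\dots,x_N(k))$. **$\sigma$-fields.** $\mathcal F_k'$ is the $\sigma$-field of the entire information used by the scheme up to and including the updates of $x_i(k),\theta_i(k)$, $i\in\mathcal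 N$, namely $\mathcal F_k'=\sigma\{x(0),i_l,\xi_{i_l}(l),\eta_{i_l}(l),d_{i_l,j}(l):0\le l\le k-1,\ j\in\mathcal N\}$; and $\mathcal F_k=\sigma\{\mathcal F_k',d_{ij}(k),\ i,j\in\mathcal N\}$. **(B3)** (a) $\{i_k\}$ is an i.i.d. sequence, and $i_k$ is independent of $\mathcal F_k$ for all $k\ge1$. (b) For any $i$, $\sum_{k=1}^\infty\mathbb E[\|\varepsilon_i(k+1)\|^2\mid\mathcal F_k]<\infty$ and $\sum_{k=1}^\infty\mathbb E[\|\varepsilon_i(k+1)\|\mid\mathcal F_k]<\infty$ a.s. (c) There is a positive integer $\tau$ such that $d_{ij}(k)\in\{0,\dots,\tau\}$ for any $i,j\in\mathcal N$ and any $k\ge0$. (d) With $e_{i,p}(k)=\nabla g(\theta_i(k),\eta_{i,p}(k))-\nabla g(\theta_i(k))$, there is a constant $M_2>0$ such that $\mathbb E[\|e_{i,p}(k)\|^2\mid\mathcal F_k]\le M_2^2$ for any $k\ge0$ and $p=1,\dots,N_i(k)$.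
   Formalization: In (d) the connected set X_c^* may depend on the sample path (one fixed set fails, e.g. potential -x_1x_2 on [-1,1]^2 from (1/2,-1/2)); the samples of ξ and η are taken i.i.d. with their laws and independent of the past. *)

theory Defs
  imports "HOL-Probability.Probability"
begin

text \<open>
  Since the dimensions \<open>n_i\<close> may differ from player to player, strategy profiles live in one space
  \<open>real^'c\<close>, whose set of coordinates is partitioned among the players by a map \<open>own :: 'c \<Rightarrow> 'n\<close>;
  player \<open>i\<close> owns \<open>n_i = card {c. own c = i}\<close> coordinates. A vector of the \<open>n_i\<close>-dimensional space
  of player \<open>i\<close> is represented by a vector of \<open>real^'c\<close> that vanishes off the coordinates of \<open>i\<close>;
  this embedding preserves the Euclidean norm.
\<close>

definition block :: "('c::finite \<Rightarrow> 'n) \<Rightarrow> 'n \<Rightarrow> real^'c \<Rightarrow> real^'c" where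
  "block own i x = (\<chi> c. if own c = i then x $ c else 0)"

text \<open>The profile \<open>(y_i, x_{-i})\<close>.\<close>

definition with_block :: "('c::finite \<Rightarrow> 'n) \<Rightarrow> 'n \<Rightarrow> real^'c \<Rightarrow> real^'c \<Rightarrow> real^'c" where
  "with_block own i y x = (\<chi> c. if own c = i then y $ c else x $ c)"

definition grad :: "('a::real_inner \<Rightarrow> real) \<Rightarrow> 'a \<Rightarrow> 'a" where
  "grad F x = (THE D. GDERIV F x :> D)"

text \<open>
  The gradient with respect to \<open>x_i\<close>. The function \<open>\<lambda>y. F (y_i, x_{-i})\<close> does not depend on the
  coordinates of \<open>y\<close> owned by other players, so that its full gradient vanishes there. For the same
  reason, differentiability of this function on an open subset of \<open>real^'c\<close> containing \<open>X_i\<close> is the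
  same as differentiability on an open subset of the space of player \<open>i\<close> containing \<open>X_i\<close>.
\<close>

definition pgrad :: "('c::finite \<Rightarrow> 'n) \<Rightarrow> 'n \<Rightarrow> (real^'c \<Rightarrow> real) \<Rightarrow> real^'c \<Rightarrow> real^'c" where
  "pgrad own i F x = grad (\<lambda>y. F (with_block own i y x)) x"

definition C1_on :: "'a::real_inner set \<Rightarrow> ('a \<Rightarrow> real) \<Rightarrow> bool" where
  "C1_on U F \<longleftrightarrow> (\<forall>y\<in>U. F differentiable (at y)) \<and> continuous_on U (grad F)"

definition strongly_convex_on :: "real \<Rightarrow> 'a::real_normed_vector set \<Rightarrow> ('a \<Rightarrow> real) \<Rightarrow> bool" where
  "strongly_convex_on m S F \<longleftrightarrow> convex S \<and>
     (\<forall>x\<in>S. \<forall>y\<in>S. \<forall>t\<in>{0..1}.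
        F ((1 - t) *\<^sub>R x + t *\<^sub>R y)
          \<le> (1 - t) * F x + t * F y - m / 2 * t * (1 - t) * (norm (x - y))\<^sup>2)"


section \<open>The misspecified stochastic game\<close>

text \<open>The random vectors \<open>\<xi>\<close> and \<open>\<eta>\<close> enter the game only through their laws.\<close>

record ('n, 'c, 'm, 'd, 'p) game =
  owner :: "'c::finite \<Rightarrow> 'n"
  strat :: "'n \<Rightarrow> (real^'c) set"
  psi :: "'n \<Rightarrow> real^'c \<Rightarrow> real^'m::finite \<Rightarrow> real^'d::finite \<Rightarrow> real"
  xi_law :: "(real^'d) measure"
  Theta :: "(real^'m) set"
  theta_star :: "real^'m"
  gsample :: "real^'m \<Rightarrow> real^'p::finite \<Rightarrow> real"
  eta_law :: "(real^'p) measure"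

definition profiles :: "('n, 'c::finite, 'm::finite, 'd::finite, 'p::finite) game \<Rightarrow> (real^'c) set" where
  "profiles gm = {x. \<forall>i. block (owner gm) i x \<in> strat gm i}"

definition cost ::
  "('n, 'c::finite, 'm::finite, 'd::finite, 'p::finite) game \<Rightarrow> 'n \<Rightarrow> real^'c \<Rightarrow> real^'m \<Rightarrow> real" where
  "cost gm i x \<theta> = (\<integral>s. psi gm i x \<theta> s \<partial>xi_law gm)"

definition gmean ::
  "('n, 'c::finite, 'm::finite, 'd::finite, 'p::finite) game \<Rightarrow> real^'m \<Rightarrow> real" where
  "gmean gm \<theta> = (\<integral>e. gsample gm \<theta> e \<partial>eta_law gm)"

text \<open>
  Besides the data of the game, this records that the expectations defining \<open>f_i\<close> and \<open>g\<close> exist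
  wherever these functions are used, and that the sampled gradient is a random vector also when it
  is evaluated at a random \<open>\<theta> \<in> \<Theta>\<close>.
\<close>

definition wf_game :: "('n, 'c::finite, 'm::finite, 'd::finite, 'p::finite) game \<Rightarrow> bool" where
  "wf_game gm \<longleftrightarrow>
     (\<forall>i. \<forall>y\<in>strat gm i. block (owner gm) i y = y) \<and>
     prob_space (xi_law gm) \<and> sets (xi_law gm) = sets borel \<and>
     prob_space (eta_law gm) \<and> sets (eta_law gm) = sets borel \<and>
     closed (Theta gm) \<and> convex (Theta gm) \<and>
     theta_star gm \<in> Theta gm \<and> (\<forall>\<theta>\<in>Theta gm. gmean gm (theta_star gm) \<le> gmean gm \<theta>) \<and>
     (\<forall>i. \<forall>x\<in>profiles gm. \<forall>\<theta>\<in>Theta gm. \<exists>U. open U \<and> strat gm i \<subseteq> U \<and>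
        (\<forall>y\<in>U. integrable (xi_law gm) (psi gm i (with_block (owner gm) i y x) \<theta>))) \<and>
     (\<exists>U. open U \<and> Theta gm \<subseteq> U \<and> (\<forall>\<theta>\<in>U. integrable (eta_law gm) (gsample gm \<theta>))) \<and>
     (\<lambda>(\<theta>, e). grad (\<lambda>t. gsample gm t e) \<theta>)
        \<in> borel_measurable (restrict_space borel (Theta gm) \<Otimes>\<^sub>M borel)"

definition nash ::
  "('n, 'c::finite, 'm::finite, 'd::finite, 'p::finite) game \<Rightarrow> (real^'c) set" where
  "nash gm = {x \<in> profiles gm. \<forall>i. \<forall>y\<in>strat gm i.
     cost gm i x (theta_star gm) \<le> cost gm i (with_block (owner gm) i y x) (theta_star gm)}"

text \<open>
  In the assumptions below, quantification over \<open>x_{-i} \<in> X_{-i}\<close> is written as quantification over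
  profiles \<open>x\<close>, of which only \<open>x_{-i}\<close> is then used.
\<close>

definition assm_B1 ::
  "('n, 'c::finite, 'm::finite, 'd::finite, 'p::finite) game \<Rightarrow> real \<Rightarrow> real \<Rightarrow> real \<Rightarrow> bool" where
  "assm_B1 gm Lx \<mu>g Lg \<longleftrightarrow>
     (\<forall>i. closed (strat gm i) \<and> compact (strat gm i) \<and> convex (strat gm i)) \<and>
     (\<forall>i. \<forall>x\<in>profiles gm. \<forall>\<theta>\<in>Theta gm. \<exists>U. open U \<and> strat gm i \<subseteq> U \<and>
        convex_on U (\<lambda>y. cost gm i (with_block (owner gm) i y x) \<theta>) \<and>
        C1_on U (\<lambda>y. cost gm i (with_block (owner gm) i y x) \<theta>)) \<and>
     (\<forall>i. Lx-lipschitz_on (profiles gm)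
        (pgrad (owner gm) i (\<lambda>x. cost gm i x (theta_star gm)))) \<and>
     (\<exists>L\<theta>. \<forall>i. \<forall>x\<in>profiles gm. \<forall>\<theta>\<in>Theta gm.
        norm (pgrad (owner gm) i (\<lambda>x. cost gm i x \<theta>) x
              - pgrad (owner gm) i (\<lambda>x. cost gm i x (theta_star gm)) x)
          \<le> L\<theta> * norm (\<theta> - theta_star gm)) \<and>
     \<mu>g > 0 \<and> strongly_convex_on \<mu>g (Theta gm) (gmean gm) \<and>
     (\<exists>U. open U \<and> Theta gm \<subseteq> U \<and> C1_on U (gmean gm)) \<and>
     Lg > 0 \<and> Lg-lipschitz_on (Theta gm) (grad (gmean gm)) \<and>
     (\<exists>P :: real^'c \<Rightarrow> real^'m \<Rightarrow> real. \<forall>i. \<forall>x\<in>profiles gm. \<forall>y\<in>strat gm i. \<forall>y'\<in>strat gm i.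
        P (with_block (owner gm) i y x) (theta_star gm)
          - P (with_block (owner gm) i y' x) (theta_star gm)
        = cost gm i (with_block (owner gm) i y x) (theta_star gm)
          - cost gm i (with_block (owner gm) i y' x) (theta_star gm))"

definition assm_B2 :: "('n, 'c::finite, 'm::finite, 'd::finite, 'p::finite) game \<Rightarrow> bool" where
  "assm_B2 gm \<longleftrightarrow>
     (\<forall>i. \<forall>x\<in>profiles gm. \<forall>\<theta>\<in>Theta gm. \<forall>s. \<exists>U. open U \<and> strat gm i \<subseteq> U \<and>
        (\<forall>y\<in>U. (\<lambda>y. psi gm i (with_block (owner gm) i y x) \<theta> s) differentiable (at y))) \<and>
     (\<forall>i. \<forall>x\<in>profiles gm. \<forall>\<theta>\<in>Theta gm.
        integrable (xi_law gm) (\<lambda>s. pgrad (owner gm) i (\<lambda>x. psi gm i x \<theta> s) x) \<and>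
        pgrad (owner gm) i (\<lambda>x. cost gm i x \<theta>) x
          = (\<integral>s. pgrad (owner gm) i (\<lambda>x. psi gm i x \<theta> s) x \<partial>xi_law gm)) \<and>
     (\<forall>i. \<forall>x\<in>profiles gm. \<forall>\<theta>\<in>Theta gm. \<exists>M1>0.
        (\<integral>\<^sup>+s. ennreal ((norm (pgrad (owner gm) i (\<lambda>x. psi gm i x \<theta> s) x))\<^sup>2) \<partial>xi_law gm)
          \<le> ennreal (M1\<^sup>2)) \<and>
     (\<forall>e. \<exists>U. open U \<and> Theta gm \<subseteq> U \<and> (\<forall>\<theta>\<in>U. (\<lambda>t. gsample gm t e) differentiable (at \<theta>))) \<and>
     (\<forall>\<theta>\<in>Theta gm.
        integrable (eta_law gm) (\<lambda>e. grad (\<lambda>t. gsample gm t e) \<theta>) \<and>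
        grad (gmean gm) \<theta> = (\<integral>e. grad (\<lambda>t. gsample gm t e) \<theta> \<partial>eta_law gm))"

definition prox_response ::
  "('n, 'c::finite, 'm::finite, 'd::finite, 'p::finite) game \<Rightarrow> real \<Rightarrow> 'n
     \<Rightarrow> real^'c \<Rightarrow> real^'m \<Rightarrow> real^'c" where
  "prox_response gm \<mu> i x \<theta> =
     arg_min (\<lambda>y. cost gm i (with_block (owner gm) i y x) \<theta>
                + \<mu> / 2 * (norm (y - block (owner gm) i x))\<^sup>2)
             (\<lambda>y. y \<in> strat gm i)"


section \<open>The asynchronous scheme\<close>

text \<open>
  \<open>xi_samp sc i k q\<close> and \<open>eta_samp sc i k q\<close> are the \<open>q\<close>-th samples, \<open>q = 1, 2, \<dots>\<close>, that player \<open>i\<close> has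
  at its disposal at time \<open>k\<close>; only the first \<open>xi_num sc i k\<close> and \<open>eta_num sc i k\<close> ones are used.
  The latter number is \<open>N_i(k)\<close>.
\<close>

record ('w, 'n, 'c, 'm, 'd, 'p) scheme =
  sel :: "nat \<Rightarrow> 'w \<Rightarrow> 'n"
  xs :: "nat \<Rightarrow> 'w \<Rightarrow> real^'c::finite"
  ths :: "'n \<Rightarrow> nat \<Rightarrow> 'w \<Rightarrow> real^'m::finite"
  eps :: "'n \<Rightarrow> nat \<Rightarrow> 'w \<Rightarrow> real^'c"
  delay :: "'n \<Rightarrow> 'n \<Rightarrow> nat \<Rightarrow> 'w \<Rightarrow> nat"
  xi_num :: "'n \<Rightarrow> nat \<Rightarrow> 'w \<Rightarrow> nat"
  xi_samp :: "'n \<Rightarrow> nat \<Rightarrow> nat \<Rightarrow> 'w \<Rightarrow> real^'d::finite"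
  eta_num :: "'n \<Rightarrow> nat \<Rightarrow> 'w \<Rightarrow> nat"
  eta_samp :: "'n \<Rightarrow> nat \<Rightarrow> nat \<Rightarrow> 'w \<Rightarrow> real^'p::finite"

text \<open>
  The components of the finite vectors \<open>\<xi>_i(k)\<close> and \<open>\<eta>_i(k)\<close>, padded with zeros.
\<close>

definition xi_vec ::
  "('w, 'n, 'c::finite, 'm::finite, 'd::finite, 'p::finite) scheme
     \<Rightarrow> 'n \<Rightarrow> nat \<Rightarrow> nat \<Rightarrow> 'w \<Rightarrow> real^'d" where
  "xi_vec sc i k q \<omega> = (if q \<in> {1..xi_num sc i k \<omega>} then xi_samp sc i k q \<omega> else 0)"

definition eta_vec ::
  "('w, 'n, 'c::finite, 'm::finite, 'd::finite, 'p::finite) scheme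
     \<Rightarrow> 'n \<Rightarrow> nat \<Rightarrow> nat \<Rightarrow> 'w \<Rightarrow> real^'p" where
  "eta_vec sc i k q \<omega> = (if q \<in> {1..eta_num sc i k \<omega>} then eta_samp sc i k q \<omega> else 0)"

text \<open>The events determined by a random variable.\<close>

definition events_of :: "'w measure \<Rightarrow> 'a measure \<Rightarrow> ('w \<Rightarrow> 'a) \<Rightarrow> 'w set set" where
  "events_of M N Z = sets (vimage_algebra (space M) Z N)"

text \<open>\<open>Fpre M sc k\<close> is \<open>F'_k\<close> and \<open>Fk M sc k\<close> is \<open>F_k\<close>.\<close>

definition Fpre ::
  "'w measure \<Rightarrow> ('w, 'n, 'c::finite, 'm::finite, 'd::finite, 'p::finite) scheme
     \<Rightarrow> nat \<Rightarrow> 'w measure" where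
  "Fpre M sc k = sigma (space M)
     (events_of M borel (xs sc 0) \<union>
      (\<Union>l<k. events_of M (count_space UNIV) (sel sc l) \<union>
             (\<Union>q. events_of M borel (\<lambda>\<omega>. xi_vec sc (sel sc l \<omega>) l q \<omega>)) \<union>
             (\<Union>q. events_of M borel (\<lambda>\<omega>. eta_vec sc (sel sc l \<omega>) l q \<omega>)) \<union>
             (\<Union>j. events_of M (count_space UNIV) (\<lambda>\<omega>. delay sc (sel sc l \<omega>) j l \<omega>))))"

definition Fk ::
  "'w measure \<Rightarrow> ('w, 'n, 'c::finite, 'm::finite, 'd::finite, 'p::finite) scheme
     \<Rightarrow> nat \<Rightarrow> 'w measure" where
  "Fk M sc k = sigma (space M)
     (sets (Fpre M sc k) \<union> (\<Union>i j. events_of M (count_space UNIV) (delay sc i j k)))"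

text \<open>
  \<open>F_k\<close> is not increasing in \<open>k\<close>: the delays \<open>d_{ij}(k)\<close> with \<open>i \<noteq> i_k\<close> are contained in \<open>F_k\<close> but not
  in \<open>F'_{k+1}\<close>. The past up to time \<open>k\<close> is therefore generated by all of \<open>F_0, \<dots>, F_k\<close>.
\<close>

definition past ::
  "'w measure \<Rightarrow> ('w, 'n, 'c::finite, 'm::finite, 'd::finite, 'p::finite) scheme
     \<Rightarrow> nat \<Rightarrow> 'w measure" where
  "past M sc k = sigma (space M) (\<Union>l\<le>k. sets (Fk M sc l))"

text \<open>
  \<open>Z 1, Z 2, \<dots>\<close> are independent samples from \<open>D\<close>, drawn independently of the \<open>\<sigma>\<close>-field \<open>G\<close>.
\<close>

definition fresh_samples ::
  "'w measure \<Rightarrow> 'w measure \<Rightarrow> 'a::topological_space measure \<Rightarrow> (nat \<Rightarrow> 'w \<Rightarrow> 'a) \<Rightarrow> bool" where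
  "fresh_samples M G D Z \<longleftrightarrow>
     prob_space.indep_vars M (\<lambda>_. borel) Z {1..} \<and>
     (\<forall>q\<ge>1. distr M borel (Z q) = D) \<and>
     prob_space.indep_set M (sets G)
       (sigma_sets (space M) (\<Union>q\<in>{1..}. events_of M borel (Z q)))"

text \<open>
  The delayed profile \<open>y^i(k)\<close>. The truncated subtraction amounts to \<open>x_j(l) = x_j(0)\<close> for \<open>l < 0\<close>.
\<close>

definition delayed ::
  "('n, 'c::finite, 'm::finite, 'd::finite, 'p::finite) game
     \<Rightarrow> ('w, 'n, 'c, 'm, 'd, 'p) scheme \<Rightarrow> 'n \<Rightarrow> nat \<Rightarrow> 'w \<Rightarrow> real^'c" where
  "delayed gm sc i k \<omega> = (\<chi> c. xs sc (k - delay sc i (owner gm c) k \<omega>) \<omega> $ c)"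

definition sampled_grad ::
  "('n, 'c::finite, 'm::finite, 'd::finite, 'p::finite) game
     \<Rightarrow> ('w, 'n, 'c, 'm, 'd, 'p) scheme \<Rightarrow> 'n \<Rightarrow> nat \<Rightarrow> nat \<Rightarrow> 'w \<Rightarrow> real^'m" where
  "sampled_grad gm sc i k q \<omega> = grad (\<lambda>t. gsample gm t (eta_samp sc i k q \<omega>)) (ths sc i k \<omega>)"

text \<open>
  \<open>\<Gamma>_i(k)\<close>: one plus the number of updates of player \<open>i\<close> before time \<open>k\<close>.
\<close>

definition update_count ::
  "('w, 'n, 'c::finite, 'm::finite, 'd::finite, 'p::finite) scheme \<Rightarrow> 'n \<Rightarrow> nat \<Rightarrow> 'w \<Rightarrow> nat" where
  "update_count sc i k \<omega> = 1 + (\<Sum>t<k. of_bool (sel sc t \<omega> = i))"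

text \<open>
  Measurability of \<open>x(k)\<close> and \<open>\<theta>_i(k)\<close> with respect to \<open>F'_k\<close> expresses that \<open>F'_k\<close> is the entire
  information used up to these updates; for \<open>k = 0\<close> it includes the case of a deterministic \<open>\<theta>_i(0)\<close>.
  That \<open>\<epsilon>_i(k+1)\<close> is an error of a computation from the information at time \<open>k\<close> and the
  samples \<open>\<xi>_i(k)\<close> is expressed by its measurability with respect to \<open>\<sigma>(F_k, \<xi>_i(k))\<close>.
\<close>

definition async_scheme ::
  "'w measure \<Rightarrow> ('n::finite, 'c::finite, 'm::finite, 'd::finite, 'p::finite) game \<Rightarrow> real \<Rightarrow> real
     \<Rightarrow> ('n \<Rightarrow> real) \<Rightarrow> ('w, 'n, 'c, 'm, 'd, 'p) scheme \<Rightarrow> bool" where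
  "async_scheme M gm \<mu> Lg prb sc \<longleftrightarrow>
     (\<forall>i. 0 < prb i \<and> prb i < 1) \<and> (\<Sum>i\<in>UNIV. prb i) = 1 \<and>
     (\<forall>k. sel sc k \<in> M \<rightarrow>\<^sub>M count_space UNIV) \<and>
     (\<forall>k i. measure M {\<omega> \<in> space M. sel sc k \<omega> = i} = prb i) \<and>
     xs sc 0 \<in> borel_measurable M \<and>
     (\<forall>i j k. delay sc i j k \<in> M \<rightarrow>\<^sub>M count_space UNIV) \<and>
     (\<forall>i k. xi_num sc i k \<in> Fk M sc k \<rightarrow>\<^sub>M count_space UNIV) \<and>
     (\<forall>i k. eta_num sc i k \<in> Fk M sc k \<rightarrow>\<^sub>M count_space UNIV) \<and>
     (\<forall>i k. fresh_samples M (past M sc k) (xi_law gm) (xi_samp sc i k)) \<and>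
     (\<forall>i k. fresh_samples M (past M sc k) (eta_law gm) (eta_samp sc i k)) \<and>
     (\<forall>k. xs sc k \<in> borel_measurable (Fpre M sc k)) \<and>
     (\<forall>i k. ths sc i k \<in> borel_measurable (Fpre M sc k)) \<and>
     (\<forall>i k. eps sc i (Suc k) \<in> borel_measurable
        (sigma (space M) (sets (Fk M sc k) \<union> (\<Union>q. events_of M borel (xi_vec sc i k q))))) \<and>
     (\<forall>\<omega>\<in>space M. \<forall>k.
        (\<forall>i. delay sc i i k \<omega> = 0) \<and>
        xs sc k \<omega> \<in> profiles gm \<and>
        (\<forall>i. ths sc i k \<omega> \<in> Theta gm) \<and>
        (\<forall>i. block (owner gm) i (eps sc i (Suc k) \<omega>) = eps sc i (Suc k) \<omega>) \<and>
        (\<forall>i. if sel sc k \<omega> = i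
             then block (owner gm) i (xs sc (Suc k) \<omega>)
                    = prox_response gm \<mu> i (delayed gm sc i k \<omega>) (ths sc i k \<omega>) + eps sc i (Suc k) \<omega> \<and>
                  ths sc i (Suc k) \<omega>
                    = closest_point (Theta gm)
                        (ths sc i k \<omega> - ((1 / Lg) / real (eta_num sc i k \<omega>)) *\<^sub>R
                           (\<Sum>q = 1..eta_num sc i k \<omega>. sampled_grad gm sc i k q \<omega>))
             else block (owner gm) i (xs sc (Suc k) \<omega>) = block (owner gm) i (xs sc k \<omega>) \<and>
                  ths sc i (Suc k) \<omega> = ths sc i k \<omega>))"

definition assm_B3 ::
  "'w measure \<Rightarrow> ('n, 'c::finite, 'm::finite, 'd::finite, 'p::finite) game
     \<Rightarrow> ('w, 'n, 'c, 'm, 'd, 'p) scheme \<Rightarrow> nat \<Rightarrow> bool" where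
  "assm_B3 M gm sc \<tau> \<longleftrightarrow>
     prob_space.indep_vars M (\<lambda>_. count_space UNIV) (sel sc) UNIV \<and>
     (\<forall>k l. distr M (count_space UNIV) (sel sc k) = distr M (count_space UNIV) (sel sc l)) \<and>
     (\<forall>k\<ge>1. prob_space.indep_set M
        (events_of M (count_space UNIV) (sel sc k)) (sets (Fk M sc k))) \<and>
     (\<forall>i. AE \<omega> in M. (\<Sum>k. nn_cond_exp M (Fk M sc (k + 1))
        (\<lambda>\<omega>. ennreal ((norm (eps sc i (k + 2) \<omega>))\<^sup>2)) \<omega>) < \<infinity>) \<and>
     (\<forall>i. AE \<omega> in M. (\<Sum>k. nn_cond_exp M (Fk M sc (k + 1))
        (\<lambda>\<omega>. ennreal (norm (eps sc i (k + 2) \<omega>))) \<omega>) < \<infinity>) \<and>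
     \<tau> > 0 \<and> (\<forall>i j k. \<forall>\<omega>\<in>space M. delay sc i j k \<omega> \<le> \<tau>) \<and>
     (\<exists>M2>0. \<forall>i k. AE \<omega> in M. \<forall>q\<in>{1..eta_num sc i k \<omega>}.
        nn_cond_exp M (Fk M sc k)
          (\<lambda>\<omega>. ennreal ((norm (sampled_grad gm sc i k q \<omega> - grad (gmean gm) (ths sc i k \<omega>)))\<^sup>2)) \<omega>
        \<le> ennreal (M2\<^sup>2))"

end

theory Submission
  imports Defs
begin

text \<open>
  Everything rests on three almost sure summability statements, after which the argument is
  deterministic along each path.

  \<^item> The learning error. Whenever player \<open>i\<close> is selected, its projected gradient step shrinks the distance
    to \<open>\<theta>\<^sup>*\<close> by a fixed factor, up to the average of the sampling noise
    (\<open>projected_gradient_contraction\<close>, \<open>ths_selected_step\<close>). The terms of that average are fresh and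
    centred, so that its expected norm is at most of order \<open>E[\<Gamma>_i(k) powr -(1 + \<delta>)]\<close>
    (\<open>fresh_average_bound\<close>, \<open>batch_size\<close>). The errors at the times when \<open>i\<close> is
    selected are therefore summable.

  \<^item> Passing from the selected times to all times. If \<open>W k\<close> is known before the independent selection at
    time \<open>k\<close>, then \<open>W k\<close>, kept only if \<open>i\<close> is selected, has conditional expectation \<open>p\<^sub>i W k\<close>. By a
    stopping argument, convergence of the series over the selected times implies convergence of the full
    series (\<open>summable_of_summable_thinned\<close>). This applies to the learning errors and, at the end, to
    the residuals of claim (b). The same identity bounds the expected sum of the
    \<open>\<Gamma>_i(k) powr -(1 + \<delta>)\<close>, because the terms at selected times form a convergent \<open>p\<close>-series
    (\<open>update_count_series_finite\<close>).

  \<^item> The inexactness. Its conditional expectations given \<open>F_k\<close> are summable. The fields \<open>F_k\<close> are not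
    increasing, but the fresh samples make the conditional expectation the same given the whole past
    (\<open>cond_exp_given_larger_field\<close>), which is a filtration and admits the stopping argument of
    \<open>summable_of_summable_cond_exp\<close>.

  Along a path the potential decreases at each step by \<open>(\<mu> - L\<^sub>x / 2) D\<^sup>2\<close>, where \<open>D\<close> is the
  residual of the selected player, up to summable errors and up to the price \<open>L\<^sub>x norm (x - y) D\<close> of using
  an outdated profile (\<open>delayed_prox_decrease\<close>). The distance to the outdated profile is at most the
  sum of the last \<open>\<tau>\<close> step lengths, and each step length is at most a residual plus a summable error; summation
  thus costs \<open>L\<^sub>x \<tau>\<close> times the sum of the squared residuals (\<open>delayed_descent_summable\<close>), which the
  assumption on \<open>\<mu>\<close> leaves affordable. As the potential is bounded, squared residuals at selected
  times and squared steps are summable, and thinning extends the former to all players and times.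

  The steps now tend to zero, so that delayed and current profiles have the same limit points; these are fixed
  points of the proximal responses, hence Nash equilibria by convexity (\<open>prox_fixed_imp_nash\<close>,
  \<open>cluster_points_nash\<close>).
  A bounded sequence with vanishing steps approaches its set of cluster points, and this set is connected
  (\<open>connected_cluster_set\<close>).
\<close>

section \<open>Gradients on convex sets\<close>

lemma GDERIV_unique:
  fixes F :: "'a::real_inner \<Rightarrow> real"
  assumes "GDERIV F x :> D" "GDERIV F x :> E"
  shows "D = E"
proof -
  have "(\<lambda>h. inner h D) = (\<lambda>h. inner h E)"
    using assms has_derivative_unique unfolding gderiv_def by blast
  then have "inner (D - E) D = inner (D - E) E" by meson
  then have "inner (D - E) (D - E) = 0" by (simp add: inner_diff_right)
  then show ?thesis by simp
qed

lemma grad_eqI: "GDERIV F x :> D \<Longrightarrow> grad F x = D"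
  unfolding grad_def using GDERIV_unique by blast

lemma differentiable_imp_GDERIV_grad:
  fixes F :: "'a::euclidean_space \<Rightarrow> real"
  assumes "F differentiable (at x)"
  shows "GDERIV F x :> grad F x"
proof -
  obtain F' where F': "(F has_derivative F') (at x)"
    using assms unfolding differentiable_def by blast
  then have "linear F'" by (rule has_derivative_linear)
  then have "F' = (\<lambda>h. inner h (adjoint F' 1))"
    using adjoint_works[of F' _ 1] by (auto simp: fun_eq_iff)
  with F' have "GDERIV F x :> adjoint F' 1"
    unfolding gderiv_def by simp
  then show ?thesis using grad_eqI by metis
qed

text \<open>Translating along directions on which \<open>F\<close> does not depend leaves the gradient unchanged. It allows
  a partial gradient at a profile to be read off at the strategy of the player alone.\<close>

lemma grad_invariant:
  assumes "\<And>y. F (y + v) = F y"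
  shows "grad F (x + v) = grad F x"
proof -
  have "GDERIV F (x + v) :> D \<longleftrightarrow> GDERIV F x :> D" for D
  proof -
    have "((\<lambda>y. F (y + v)) has_derivative (\<lambda>h. inner h D)) (at x)
        \<longleftrightarrow> (F has_derivative (\<lambda>h. inner h D)) (at (x + v))"
    proof
      assume a: "((\<lambda>y. F (y + v)) has_derivative (\<lambda>h. inner h D)) (at x)"
      have "((\<lambda>y. y - v) has_derivative (\<lambda>h. h)) (at (x + v))"
        by (rule derivative_eq_intros refl | simp)+
      then have "((\<lambda>y. F (y - v)) has_derivative (\<lambda>h. inner h D)) (at (x + v))"
        using a assms has_derivative_compose[of "\<lambda>y. y - v" "\<lambda>h. h" "x + v" UNIV F "\<lambda>h. inner h D"]
        by simp
      moreover have "F (y - v) = F y" for y using assms[of "y - v"] by simp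
      ultimately show "(F has_derivative (\<lambda>h. inner h D)) (at (x + v))" by simp
    next
      assume a: "(F has_derivative (\<lambda>h. inner h D)) (at (x + v))"
      have "((\<lambda>y. y + v) has_derivative (\<lambda>h. h)) (at x)"
        by (rule derivative_eq_intros refl | simp)+
      then show "((\<lambda>y. F (y + v)) has_derivative (\<lambda>h. inner h D)) (at x)"
        using a has_derivative_compose[of "\<lambda>y. y + v" "\<lambda>h. h" x UNIV F "\<lambda>h. inner h D"]
        by simp
    qed
    then show ?thesis using assms unfolding gderiv_def by simp
  qed
  then have "gderiv F (x + v) = gderiv F x" by blast
  then show ?thesis unfolding grad_def by simp
qed

lemma GDERIV_line:
  fixes F :: "'a::real_inner \<Rightarrow> real"
  assumes "GDERIV F (y + t *\<^sub>R d) :> D"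
  shows "((\<lambda>t. F (y + t *\<^sub>R d)) has_real_derivative inner D d) (at t)"
proof -
  have "((\<lambda>t. y + t *\<^sub>R d) has_derivative (\<lambda>h. h *\<^sub>R d)) (at t)"
    by (rule derivative_eq_intros refl | simp)+
  then have "((\<lambda>t. F (y + t *\<^sub>R d)) has_derivative (\<lambda>h. inner (h *\<^sub>R d) D)) (at t)"
    using assms has_derivative_compose[of "\<lambda>t. y + t *\<^sub>R d" "\<lambda>h. h *\<^sub>R d" t UNIV F "\<lambda>h. inner h D"]
    unfolding gderiv_def by simp
  moreover have "(\<lambda>h. inner (h *\<^sub>R d) D) = (*) (inner D d)"
    by (simp add: fun_eq_iff inner_commute)
  ultimately show ?thesis unfolding has_field_derivative_def by simp
qed

lemma GDERIV_difference_quotient: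
  fixes F :: "'a::real_inner \<Rightarrow> real"
  assumes "GDERIV F y :> D"
  shows "((\<lambda>t. (F (y + t *\<^sub>R d) - F y) / t) \<longlongrightarrow> inner D d) (at_right 0)"
  using GDERIV_line[of F y 0 d D] assms
  by (auto simp: DERIV_def intro: tendsto_within_subset)

lemma strongly_convex_gradient_ineq:
  fixes F :: "'a::real_inner \<Rightarrow> real"
  assumes sc: "strongly_convex_on m S F" and y: "y \<in> S" and z: "z \<in> S"
    and D: "GDERIV F y :> D"
  shows "F y + inner D (z - y) + m / 2 * (norm (z - y))\<^sup>2 \<le> F z"
proof -
  let ?d = "z - y"
  have lim: "((\<lambda>t. (F (y + t *\<^sub>R ?d) - F y) / t + m / 2 * (1 - t) * (norm ?d)\<^sup>2)
      \<longlongrightarrow> inner D ?d + m / 2 * (1 - 0) * (norm ?d)\<^sup>2) (at_right 0)"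
    by (intro tendsto_intros GDERIV_difference_quotient D)
  have "eventually (\<lambda>t::real. t \<in> {0<..<1}) (at_right 0)"
    by (rule eventually_at_right_real) simp
  then have "eventually (\<lambda>t. (F (y + t *\<^sub>R ?d) - F y) / t + m / 2 * (1 - t) * (norm ?d)\<^sup>2
      \<le> F z - F y) (at_right 0)"
  proof eventually_elim
    case (elim t)
    then have "t \<in> {0..1}" and t: "t > 0" by auto
    then have "F ((1 - t) *\<^sub>R y + t *\<^sub>R z)
          \<le> (1 - t) * F y + t * F z - m / 2 * t * (1 - t) * (norm (y - z))\<^sup>2"
      using sc y z unfolding strongly_convex_on_def by blast
    moreover have "(1 - t) *\<^sub>R y + t *\<^sub>R z = y + t *\<^sub>R ?d" by (simp add: algebra_simps)
    ultimately have "F (y + t *\<^sub>R ?d) - F y + t * (m / 2 * (1 - t) * (norm ?d)\<^sup>2) \<le> t * (F z - F y)"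
      by (simp add: algebra_simps norm_minus_commute)
    then show ?case using t by (simp add: field_simps)
  qed
  then have "inner D ?d + m / 2 * (1 - 0) * (norm ?d)\<^sup>2 \<le> F z - F y"
    by (rule tendsto_upperbound[OF lim]) simp
  then show ?thesis by simp
qed

lemma minimizer_variational_ineq:
  fixes F :: "'a::real_inner \<Rightarrow> real"
  assumes S: "convex S" and y: "y \<in> S" and z: "z \<in> S"
    and min: "\<And>z. z \<in> S \<Longrightarrow> F y \<le> F z" and D: "GDERIV F y :> D"
  shows "0 \<le> inner D (z - y)"
proof -
  have "eventually (\<lambda>t::real. t \<in> {0<..<1}) (at_right 0)"
    by (rule eventually_at_right_real) simp
  then have "eventually (\<lambda>t. 0 \<le> (F (y + t *\<^sub>R (z - y)) - F y) / t) (at_right 0)"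
  proof eventually_elim
    case (elim t)
    then have "(1 - t) *\<^sub>R y + t *\<^sub>R z \<in> S"
      using convexD_alt[OF S y z, of t] by auto
    moreover have "(1 - t) *\<^sub>R y + t *\<^sub>R z = y + t *\<^sub>R (z - y)" by (simp add: algebra_simps)
    ultimately show ?case using min elim by simp
  qed
  then show ?thesis
    by (rule tendsto_lowerbound[OF GDERIV_difference_quotient[OF D]]) simp
qed

text \<open>The descent lemma. Only the values of the gradient on \<open>S\<close> enter, because the segment
  from \<open>y\<close> to \<open>z\<close> stays in \<open>S\<close>.\<close>

lemma descent_lemma:
  fixes F :: "'a::real_inner \<Rightarrow> real"
  assumes S: "convex S" and y: "y \<in> S" and z: "z \<in> S"
    and D: "\<And>u. u \<in> S \<Longrightarrow> GDERIV F u :> D u"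
    and L: "\<And>u v. u \<in> S \<Longrightarrow> v \<in> S \<Longrightarrow> norm (D u - D v) \<le> L * norm (u - v)"
  shows "F z \<le> F y + inner (D y) (z - y) + L / 2 * (norm (z - y))\<^sup>2"
proof -
  let ?d = "z - y"
  define \<phi> where "\<phi> t = F (y + t *\<^sub>R ?d) - t * inner (D y) ?d - L / 2 * t\<^sup>2 * (norm ?d)\<^sup>2" for t
  have "\<phi> 1 \<le> \<phi> 0"
  proof (rule DERIV_nonpos_imp_nonincreasing[of 0 1 \<phi>])
    fix t :: real assume t: "0 \<le> t" "t \<le> 1"
    have "(1 - t) *\<^sub>R y + t *\<^sub>R z \<in> S"
      using convexD_alt[OF S y z, of t] t by auto
    moreover have "(1 - t) *\<^sub>R y + t *\<^sub>R z = y + t *\<^sub>R ?d" by (simp add: algebra_simps)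
    ultimately have in_S: "y + t *\<^sub>R ?d \<in> S" by simp
    have deriv: "(\<phi> has_real_derivative
        inner (D (y + t *\<^sub>R ?d)) ?d - inner (D y) ?d - L * t * (norm ?d)\<^sup>2) (at t)"
      unfolding \<phi>_def by (rule derivative_eq_intros GDERIV_line D in_S refl | simp)+
    have "inner (D (y + t *\<^sub>R ?d)) ?d - inner (D y) ?d \<le> norm (D (y + t *\<^sub>R ?d) - D y) * norm ?d"
      by (metis inner_diff_left norm_cauchy_schwarz)
    also have "\<dots> \<le> (L * norm (y + t *\<^sub>R ?d - y)) * norm ?d"
      by (intro mult_right_mono L in_S y) simp
    also have "\<dots> = L * t * (norm ?d)\<^sup>2" using t by (simp add: power2_eq_square)
    finally show "\<exists>e. (\<phi> has_real_derivative e) (at t) \<and> e \<le> 0"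
      using deriv by (intro exI[of _ "inner (D (y + t *\<^sub>R ?d)) ?d - inner (D y) ?d - L * t * (norm ?d)\<^sup>2"]) auto
  qed simp
  then show ?thesis unfolding \<phi>_def by simp
qed

text \<open>Co-coercivity of the gradient is not at hand, since the gradient is Lipschitz only on \<open>S\<close>. Instead
  the descent lemma from \<open>x\<close> to the projected point \<open>p\<close>, strong convexity between \<open>x\<close> and \<open>a\<close>, and the
  variational characterization of the projection are added up; the terms with \<open>D x\<close> cancel.\<close>

lemma projected_gradient_contraction:
  fixes F :: "'a::euclidean_space \<Rightarrow> real"
  assumes S: "closed S" and sc: "strongly_convex_on m S F"
    and L0: "L > 0" and D: "\<And>u. u \<in> S \<Longrightarrow> GDERIV F u :> D u"
    and L: "\<And>u v. u \<in> S \<Longrightarrow> v \<in> S \<Longrightarrow> norm (D u - D v) \<le> L * norm (u - v)"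
    and x: "x \<in> S" and a: "a \<in> S" and min: "\<And>u. u \<in> S \<Longrightarrow> F a \<le> F u"
  shows "(norm (closest_point S (x - (1 / L) *\<^sub>R D x) - a))\<^sup>2 \<le> (1 - m / L) * (norm (x - a))\<^sup>2"
proof -
  define p where "p = closest_point S (x - (1 / L) *\<^sub>R D x)"
  have cS: "convex S" using sc unfolding strongly_convex_on_def by blast
  have p: "p \<in> S" unfolding p_def using S x closest_point_in_set by blast
  have "F p \<le> F x + inner (D x) (p - x) + L / 2 * (norm (p - x))\<^sup>2"
    by (rule descent_lemma[OF cS x p D L])
  moreover have "F x + inner (D x) (a - x) + m / 2 * (norm (a - x))\<^sup>2 \<le> F a"
    by (rule strongly_convex_gradient_ineq[OF sc x a D[OF x]])
  moreover have "F a \<le> F p" using min p .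
  moreover have "inner (x - (1 / L) *\<^sub>R D x - p) (a - p) \<le> 0"
    unfolding p_def using closest_point_dot[OF cS S a] .
  then have "L * (inner (x - p) (a - p) - inner (D x) (a - p) / L) \<le> 0"
    using L0 by (simp add: inner_diff_left mult_le_0_iff)
  then have "L * inner (x - p) (a - p) \<le> inner (D x) (a - p)"
    using L0 by (simp add: right_diff_distrib)
  moreover have "inner (D x) (a - p) = inner (D x) (a - x) - inner (D x) (p - x)"
    by (simp add: inner_diff_right)
  ultimately have "L * inner (x - p) (a - p) + m / 2 * (norm (a - x))\<^sup>2 \<le> L / 2 * (norm (p - x))\<^sup>2"
    by linarith
  moreover have ip: "inner (x - p) (a - p)
      = ((norm (p - x))\<^sup>2 + (norm (p - a))\<^sup>2 - (norm (a - x))\<^sup>2) / 2"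
    unfolding power2_norm_eq_inner by (simp add: algebra_simps inner_commute)
  ultimately have "L * (((norm (p - x))\<^sup>2 + (norm (p - a))\<^sup>2 - (norm (a - x))\<^sup>2) / 2)
      + m / 2 * (norm (a - x))\<^sup>2 \<le> L / 2 * (norm (p - x))\<^sup>2"
    by (simp only: ip)
  then have "L * (norm (p - a))\<^sup>2 \<le> (L - m) * (norm (x - a))\<^sup>2"
    by (simp add: norm_minus_commute field_simps)
  then show ?thesis unfolding p_def[symmetric] using L0 by (simp add: field_simps)
qed

section \<open>Replacing the strategy of one player\<close>

lemma block_with_block_same [simp]: "block own i (with_block own i y x) = block own i y"
  by (simp add: block_def with_block_def vec_eq_iff)

lemma block_with_block_other: "j \<noteq> i \<Longrightarrow> block own j (with_block own i y x) = block own j x"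
  by (simp add: block_def with_block_def vec_eq_iff)

lemma with_block_with_block [simp]:
  "with_block own i y (with_block own i z x) = with_block own i y x"
  by (simp add: with_block_def vec_eq_iff)

lemma with_block_block [simp]:
  "with_block own i x x = x" "with_block own i (block own i y) x = with_block own i y x"
  by (simp_all add: block_def with_block_def vec_eq_iff)

lemma block_diff: "block own i (x - y) = block own i x - block own i y"
  by (simp add: block_def vec_eq_iff)

lemma norm_vec_le_componentwise:
  fixes x y :: "real^'c::finite"
  assumes "\<And>c. \<bar>x $ c\<bar> \<le> \<bar>y $ c\<bar>"
  shows "norm x \<le> norm y"
  unfolding norm_vec_def using assms by (intro L2_set_mono) auto

lemma norm_block_le: "norm (block own i x) \<le> norm x"
  by (rule norm_vec_le_componentwise) (simp add: block_def)

lemma continuous_on_block: "continuous_on S (block own i)"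
proof -
  have "linear (block own i)"
    by (rule linearI) (auto simp: block_def vec_eq_iff)
  then show ?thesis
    by (simp add: linear_continuous_on linear_conv_bounded_linear)
qed

lemma sum_block:
  fixes own :: "'c::finite \<Rightarrow> 'n::finite"
  shows "(\<Sum>i\<in>UNIV. block own i x) = x"
  by (simp add: block_def vec_eq_iff sum.delta)

locale misspecified_game =
  fixes gm :: "('n::finite, 'c::finite, 'm::finite, 'd::finite, 'p::finite) game"
    and Lx \<mu>g Lg \<mu> :: real
  assumes wf: "wf_game gm" and B1: "assm_B1 gm Lx \<mu>g Lg" and mu_pos: "\<mu> > 0"
begin

abbreviation "X \<equiv> profiles gm"
abbreviation "\<theta>' \<equiv> theta_star gm"
abbreviation "own \<equiv> owner gm"
abbreviation "T \<equiv> prox_response gm \<mu>"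

definition cost_grad :: "'n \<Rightarrow> real^'c \<Rightarrow> real^'m \<Rightarrow> real^'c" where
  "cost_grad i x \<theta> = pgrad own i (\<lambda>x. cost gm i x \<theta>) x"

lemma strat_block: "y \<in> strat gm i \<Longrightarrow> block own i y = y"
  using wf unfolding wf_game_def by blast

lemma strat_convex: "convex (strat gm i)" and strat_compact: "compact (strat gm i)"
  using B1 unfolding assm_B1_def by blast+

lemma theta_star_mem: "\<theta>' \<in> Theta gm"
  using wf unfolding wf_game_def by blast

lemma profile_block: "x \<in> X \<Longrightarrow> block own i x \<in> strat gm i"
  unfolding profiles_def by blast

lemma with_block_mem:
  assumes "x \<in> X" "y \<in> strat gm i"
  shows "with_block own i y x \<in> X"
  unfolding profiles_def
proof safe
  fix j show "block own j (with_block own i y x) \<in> strat gm j"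
    using assms profile_block strat_block by (cases "j = i") (auto simp: block_with_block_other)
qed

lemma with_block_diff:
  assumes "y \<in> strat gm i" "z \<in> strat gm i"
  shows "with_block own i y x - with_block own i z x = y - z"
proof -
  have "with_block own i y x - with_block own i z x = block own i y - block own i z"
    by (simp add: with_block_def block_def vec_eq_iff)
  then show ?thesis using assms strat_block by simp
qed

lemma compact_profiles: "compact X"
proof -
  have "X = (\<Inter>i. block own i -` strat gm i)" unfolding profiles_def by auto
  moreover have "closed (block own i -` strat gm i)" for i
    by (intro closed_vimage compact_imp_closed strat_compact continuous_on_block)
  ultimately have "closed X" by auto
  moreover have "bounded X"
  proof -
    have "\<exists>B. \<forall>y\<in>strat gm i. norm y \<le> B" for i
      using strat_compact[of i, THEN compact_imp_bounded] unfolding bounded_iff .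
    then obtain B where B: "\<And>i y. y \<in> strat gm i \<Longrightarrow> norm y \<le> B i" by metis
    have "norm x \<le> (\<Sum>i\<in>UNIV. B i)" if "x \<in> X" for x
    proof -
      have "norm x = norm (\<Sum>i\<in>UNIV. block own i x)" by (simp add: sum_block)
      also have "\<dots> \<le> (\<Sum>i\<in>UNIV. B i)"
        by (rule sum_norm_le) (use B profile_block that in blast)
      finally show ?thesis .
    qed
    then show ?thesis unfolding bounded_iff by blast
  qed
  ultimately show ?thesis by (simp add: compact_eq_bounded_closed)
qed

section \<open>The costs and the proximal best response\<close>

lemma Lx_nonneg: "0 \<le> Lx"
  using B1 lipschitz_on_nonneg unfolding assm_B1_def by blast

lemma cost_grad_lipschitz:
  assumes "x \<in> X" "y \<in> X"
  shows "norm (cost_grad i x \<theta>' - cost_grad i y \<theta>') \<le> Lx * norm (x - y)"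
  using B1 assms lipschitz_onD[of Lx X "pgrad own i (\<lambda>x. cost gm i x \<theta>')" x y]
  unfolding assm_B1_def cost_grad_def dist_norm by blast

lemma cost_grad_misspecification:
  obtains L\<theta> where "L\<theta> \<ge> 0" "\<And>i x \<theta>. x \<in> X \<Longrightarrow> \<theta> \<in> Theta gm \<Longrightarrow>
    norm (cost_grad i x \<theta> - cost_grad i x \<theta>') \<le> L\<theta> * norm (\<theta> - \<theta>')"
proof -
  obtain L where L: "\<forall>i. \<forall>x\<in>X. \<forall>\<theta>\<in>Theta gm. norm (cost_grad i x \<theta> - cost_grad i x \<theta>') \<le> L * norm (\<theta> - \<theta>')"
    using B1 unfolding assm_B1_def cost_grad_def by blast
  show ?thesis
  proof (rule that[of "\<bar>L\<bar>"])
    fix i x \<theta> assume "x \<in> X" "\<theta> \<in> Theta gm"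
    then have "norm (cost_grad i x \<theta> - cost_grad i x \<theta>') \<le> L * norm (\<theta> - \<theta>')" using L by blast
    also have "\<dots> \<le> \<bar>L\<bar> * norm (\<theta> - \<theta>')" by (intro mult_right_mono) auto
    finally show "norm (cost_grad i x \<theta> - cost_grad i x \<theta>') \<le> \<bar>L\<bar> * norm (\<theta> - \<theta>')" .
  qed simp
qed

text \<open>The partial gradient is defined at the whole profile, whereas the function of the own strategy is
  differentiated at a point that vanishes off the block; the two points differ by a vector on which this
  function does not depend.\<close>

lemma cost_GDERIV:
  assumes x: "x \<in> X" and \<theta>: "\<theta> \<in> Theta gm" and y: "y \<in> strat gm i"
  shows "GDERIV (\<lambda>y. cost gm i (with_block own i y x) \<theta>) y :> cost_grad i (with_block own i y x) \<theta>"
proof -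
  let ?h = "\<lambda>y. cost gm i (with_block own i y x) \<theta>"
  obtain U where U: "strat gm i \<subseteq> U" "C1_on U ?h"
    using B1 x \<theta> unfolding assm_B1_def by meson
  then have "GDERIV ?h y :> grad ?h y"
    using y differentiable_imp_GDERIV_grad unfolding C1_on_def by blast
  moreover have "cost_grad i (with_block own i y x) \<theta> = grad ?h y"
  proof -
    have "with_block own i y x = y + (with_block own i y x - y)" by simp
    moreover have "with_block own i (u + (with_block own i y x - y)) x = with_block own i u x" for u
      by (simp add: with_block_def vec_eq_iff)
    ultimately show ?thesis
      unfolding cost_grad_def pgrad_def
      using grad_invariant[of ?h "with_block own i y x - y" y] by simp
  qed
  ultimately show ?thesis by simp
qed

lemma cost_strongly_convex_0:
  assumes x: "x \<in> X" and \<theta>: "\<theta> \<in> Theta gm"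
  shows "strongly_convex_on 0 (strat gm i) (\<lambda>y. cost gm i (with_block own i y x) \<theta>)"
proof -
  let ?h = "\<lambda>y. cost gm i (with_block own i y x) \<theta>"
  obtain U where U: "strat gm i \<subseteq> U" "convex_on U ?h"
    using B1 x \<theta> unfolding assm_B1_def by meson
  then have "?h ((1 - t) *\<^sub>R y + t *\<^sub>R z) \<le> (1 - t) * ?h y + t * ?h z"
    if "y \<in> strat gm i" "z \<in> strat gm i" "t \<in> {0..1}" for y z t
    using convex_onD[of U ?h t y z] that by auto
  then show ?thesis unfolding strongly_convex_on_def using strat_convex by simp
qed

lemma cost_gradient_ineq:
  assumes "x \<in> X" "\<theta> \<in> Theta gm" "y \<in> strat gm i" "z \<in> strat gm i"
  shows "cost gm i (with_block own i y x) \<theta> + inner (cost_grad i (with_block own i y x) \<theta>) (z - y)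
    \<le> cost gm i (with_block own i z x) \<theta>"
  using strongly_convex_gradient_ineq[OF cost_strongly_convex_0 _ _ cost_GDERIV, of x \<theta> y i z] assms
  by simp

lemma cost_grad_monotone:
  assumes "x \<in> X" "\<theta> \<in> Theta gm" "y \<in> strat gm i" "z \<in> strat gm i"
  shows "inner (cost_grad i (with_block own i y x) \<theta>) (z - y) \<le> inner (cost_grad i (with_block own i z x) \<theta>) (z - y)"
proof -
  have "inner (cost_grad i (with_block own i z x) \<theta>) (y - z) = - inner (cost_grad i (with_block own i z x) \<theta>) (z - y)"
    by (simp add: inner_diff_right)
  then show ?thesis
    using cost_gradient_ineq[of x \<theta> y i z] cost_gradient_ineq[of x \<theta> z i y] assms by linarith
qed

lemma cost_descent:
  assumes x: "x \<in> X" and z: "z \<in> strat gm i"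
  shows "cost gm i (with_block own i z x) \<theta>' \<le> cost gm i x \<theta>' + inner (cost_grad i x \<theta>') (z - block own i x)
    + Lx / 2 * (norm (z - block own i x))\<^sup>2"
proof -
  have "norm (cost_grad i (with_block own i u x) \<theta>' - cost_grad i (with_block own i v x) \<theta>') \<le> Lx * norm (u - v)"
    if "u \<in> strat gm i" "v \<in> strat gm i" for u v
    using cost_grad_lipschitz[of "with_block own i u x" "with_block own i v x"] x that with_block_mem
    by (simp add: with_block_diff)
  then show ?thesis
    using descent_lemma[where L = Lx, OF strat_convex profile_block[OF x] z
        cost_GDERIV[where i = i, OF x theta_star_mem]]
    by simp
qed

text \<open>The proximal objective is continuous on the compact set \<open>X_i\<close>, so that the minimum that
  defines \<open>T_i\<close> is attained.\<close>

lemma prox_is_arg_min: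
  assumes x: "x \<in> X" and \<theta>: "\<theta> \<in> Theta gm"
  shows "is_arg_min (\<lambda>y. cost gm i (with_block own i y x) \<theta> + \<mu> / 2 * (norm (y - block own i x))\<^sup>2)
    (\<lambda>y. y \<in> strat gm i) (T i x \<theta>)"
proof -
  let ?F = "\<lambda>y. cost gm i (with_block own i y x) \<theta> + \<mu> / 2 * (norm (y - block own i x))\<^sup>2"
  have "continuous_on (strat gm i) (\<lambda>y. cost gm i (with_block own i y x) \<theta>)"
  proof (rule differentiable_imp_continuous_on)
    show "(\<lambda>y. cost gm i (with_block own i y x) \<theta>) differentiable_on strat gm i"
      using cost_GDERIV[OF x \<theta>] unfolding differentiable_on_def gderiv_def
      by (meson differentiableI differentiable_at_withinI)
  qed
  then have "continuous_on (strat gm i) ?F" by (intro continuous_intros)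
  then obtain y where "y \<in> strat gm i" "\<forall>z\<in>strat gm i. ?F y \<le> ?F z"
    using continuous_attains_inf[OF strat_compact] profile_block[OF x] by blast
  then have "is_arg_min ?F (\<lambda>y. y \<in> strat gm i) y" by (auto simp: is_arg_min_def not_less)
  then show ?thesis unfolding prox_response_def arg_min_def by (rule someI)
qed

lemma prox_mem: "x \<in> X \<Longrightarrow> \<theta> \<in> Theta gm \<Longrightarrow> T i x \<theta> \<in> strat gm i"
  using prox_is_arg_min unfolding is_arg_min_def by blast

lemma prox_variational_ineq:
  assumes x: "x \<in> X" and \<theta>: "\<theta> \<in> Theta gm" and z: "z \<in> strat gm i"
  shows "0 \<le> inner (cost_grad i (with_block own i (T i x \<theta>) x) \<theta> + \<mu> *\<^sub>R (T i x \<theta> - block own i x)) (z - T i x \<theta>)"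
proof (rule minimizer_variational_ineq[OF strat_convex prox_mem[OF x \<theta>] z])
  let ?F = "\<lambda>y. cost gm i (with_block own i y x) \<theta> + \<mu> / 2 * (norm (y - block own i x))\<^sup>2"
  show "?F (T i x \<theta>) \<le> ?F u" if "u \<in> strat gm i" for u
    using prox_is_arg_min[OF x \<theta>] that unfolding is_arg_min_def by (meson not_less)
  have "GDERIV (\<lambda>y. \<mu> / 2 * (norm (y - a))\<^sup>2) y :> \<mu> *\<^sub>R (y - a)" for y a :: "real^'c"
    unfolding gderiv_def power2_norm_eq_inner
    by (rule derivative_eq_intros refl)+ (simp add: inner_commute fun_eq_iff)
  then show "GDERIV ?F (T i x \<theta>) :> cost_grad i (with_block own i (T i x \<theta>) x) \<theta> + \<mu> *\<^sub>R (T i x \<theta> - block own i x)"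
    by (intro GDERIV_add cost_GDERIV x \<theta> prox_mem)
qed

text \<open>Adding the variational inequalities of two proximal problems and using the monotonicity of
  the first partial gradient shows that their solutions differ no more than their data.\<close>

lemma prox_perturbation:
  assumes x: "x \<in> X" "x' \<in> X" and \<theta>: "\<theta> \<in> Theta gm" "\<theta>1 \<in> Theta gm"
  shows "\<mu> * norm (T i x \<theta> - T i x' \<theta>1)
    \<le> norm (cost_grad i (with_block own i (T i x' \<theta>1) x) \<theta> - cost_grad i (with_block own i (T i x' \<theta>1) x') \<theta>1)
      + \<mu> * norm (x - x')"
proof -
  define t t' where "t = T i x \<theta>" and "t' = T i x' \<theta>1"
  have mem: "t \<in> strat gm i" "t' \<in> strat gm i" unfolding t_def t'_def using prox_mem x \<theta> by auto
  define g1 g2 g3 where "g1 = cost_grad i (with_block own i t x) \<theta>" and "g2 = cost_grad i (with_block own i t' x) \<theta>"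
    and "g3 = cost_grad i (with_block own i t' x') \<theta>1"
  define b where "b = block own i (x - x')"
  have "0 \<le> inner (g1 + \<mu> *\<^sub>R (t - block own i x)) (t' - t)"
    unfolding t_def g1_def using prox_variational_ineq[OF x(1) \<theta>(1), of t'] mem t_def by simp
  moreover have "0 \<le> inner (g3 + \<mu> *\<^sub>R (t' - block own i x')) (t - t')"
    unfolding t'_def g3_def using prox_variational_ineq[OF x(2) \<theta>(2), of t] mem t'_def by simp
  moreover have "inner g1 (t' - t) \<le> inner g2 (t' - t)"
    unfolding g1_def g2_def by (rule cost_grad_monotone[OF x(1) \<theta>(1) mem])
  ultimately have "\<mu> * inner (t - t') (t - t') \<le> inner (g2 - g3 - \<mu> *\<^sub>R b) (t' - t)"
    unfolding b_def block_diff by (simp add: inner_simps algebra_simps)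
  also have "\<dots> \<le> norm (g2 - g3 - \<mu> *\<^sub>R b) * norm (t - t')"
    using norm_cauchy_schwarz[of "g2 - g3 - \<mu> *\<^sub>R b" "t' - t"] by (simp add: norm_minus_commute)
  also have "\<dots> \<le> (norm (g2 - g3) + \<mu> * norm (x - x')) * norm (t - t')"
  proof (intro mult_right_mono)
    have "norm (g2 - g3 - \<mu> *\<^sub>R b) \<le> norm (g2 - g3) + norm (\<mu> *\<^sub>R b)" by (rule norm_triangle_ineq4)
    moreover have "norm (\<mu> *\<^sub>R b) \<le> \<mu> * norm (x - x')"
      using mu_pos norm_block_le[of own i "x - x'"] unfolding b_def by simp
    ultimately show "norm (g2 - g3 - \<mu> *\<^sub>R b) \<le> norm (g2 - g3) + \<mu> * norm (x - x')" by simp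
  qed simp
  finally have "\<mu> * norm (t - t') * norm (t - t')
      \<le> (norm (g2 - g3) + \<mu> * norm (x - x')) * norm (t - t')"
    by (simp add: power2_norm_eq_inner[symmetric] power2_eq_square mult.assoc)
  moreover have "0 \<le> norm (g2 - g3) + \<mu> * norm (x - x')" using mu_pos by simp
  ultimately have "\<mu> * norm (t - t') \<le> norm (g2 - g3) + \<mu> * norm (x - x')"
    by (cases "norm (t - t') = 0") (auto simp: mult_le_cancel_right)
  then show ?thesis unfolding t_def t'_def g2_def g3_def .
qed

lemma prox_lipschitz:
  assumes "x \<in> X" "x' \<in> X"
  shows "norm (T i x \<theta>' - T i x' \<theta>') \<le> (Lx + \<mu>) / \<mu> * norm (x - x')"
proof -
  let ?t = "T i x' \<theta>'"
  have t: "?t \<in> strat gm i" using prox_mem assms theta_star_mem by blast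
  have "norm (cost_grad i (with_block own i ?t x) \<theta>' - cost_grad i (with_block own i ?t x') \<theta>')
      \<le> Lx * norm (with_block own i ?t x - with_block own i ?t x')"
    using cost_grad_lipschitz with_block_mem assms t by blast
  also have "\<dots> \<le> Lx * norm (x - x')"
    by (intro mult_left_mono Lx_nonneg norm_vec_le_componentwise) (simp add: with_block_def)
  finally have "\<mu> * norm (T i x \<theta>' - T i x' \<theta>') \<le> (Lx + \<mu>) * norm (x - x')"
    using prox_perturbation[OF assms theta_star_mem theta_star_mem, of i] by (simp add: distrib_right)
  then show ?thesis using mu_pos by (simp add: field_simps)
qed

lemma prox_misspecification:
  obtains K where "K \<ge> 0" "\<And>i x \<theta>. x \<in> X \<Longrightarrow> \<theta> \<in> Theta gm \<Longrightarrow>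
    norm (T i x \<theta> - T i x \<theta>') \<le> K * norm (\<theta> - \<theta>')"
proof -
  obtain L where L: "L \<ge> 0" "\<And>i x \<theta>. x \<in> X \<Longrightarrow> \<theta> \<in> Theta gm \<Longrightarrow>
    norm (cost_grad i x \<theta> - cost_grad i x \<theta>') \<le> L * norm (\<theta> - \<theta>')" using cost_grad_misspecification by blast
  show ?thesis
  proof (rule that[of "L / \<mu>"])
    show "0 \<le> L / \<mu>" using L mu_pos by simp
    fix i x \<theta> assume a: "x \<in> X" "\<theta> \<in> Theta gm"
    have "with_block own i (T i x \<theta>') x \<in> X"
      using with_block_mem prox_mem a theta_star_mem by blast
    from L(2)[OF this a(2), of i] have "\<mu> * norm (T i x \<theta> - T i x \<theta>') \<le> L * norm (\<theta> - \<theta>')"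
      using prox_perturbation[OF a(1) a(1) a(2) theta_star_mem, of i] by simp
    then show "norm (T i x \<theta> - T i x \<theta>') \<le> L / \<mu> * norm (\<theta> - \<theta>')"
      using mu_pos by (simp add: field_simps)
  qed
qed

lemma prox_fixed_imp_nash:
  assumes x: "x \<in> X" and fixed: "\<And>i. T i x \<theta>' = block own i x"
  shows "x \<in> nash gm"
proof -
  have "cost gm i x \<theta>' \<le> cost gm i (with_block own i y x) \<theta>'" if y: "y \<in> strat gm i" for i y
    using prox_variational_ineq[OF x theta_star_mem y] fixed[of i]
      cost_gradient_ineq[OF x theta_star_mem profile_block[OF x] y] by simp
  then show ?thesis unfolding nash_def using x by simp
qed

text \<open>The optimality of the response to the outdated profile \<open>y\<close> and the monotonicity of the partial
  gradient show that the own strategy of \<open>i\<close> moves against its gradient at \<open>y\<close>, with slope at least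
  \<open>\<mu> \<Delta>\<^sup>2\<close>. Exchanging this gradient for the one at the current profile \<open>x\<close> costs \<open>L\<^sub>x norm (x - y) \<Delta>\<close>, and the
  curvature of the cost takes back \<open>L\<^sub>x / 2 \<Delta>\<^sup>2\<close>.\<close>

lemma delayed_prox_decrease:
  assumes x: "x \<in> X" and y: "y \<in> X" and same: "block own i y = block own i x"
  defines "\<Delta> \<equiv> norm (T i y \<theta>' - block own i x)"
  shows "cost gm i (with_block own i (T i y \<theta>') x) \<theta>'
    \<le> cost gm i x \<theta>' - (\<mu> - Lx / 2) * \<Delta>\<^sup>2 + Lx * norm (x - y) * \<Delta>"
proof -
  define t b where "t = T i y \<theta>'" and "b = block own i x"
  have t: "t \<in> strat gm i" and b: "b \<in> strat gm i"
    unfolding t_def b_def using prox_mem y theta_star_mem profile_block x by auto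
  have "0 \<le> inner (cost_grad i (with_block own i t y) \<theta>' + \<mu> *\<^sub>R (t - b)) (b - t)"
    using prox_variational_ineq[OF y theta_star_mem b] unfolding t_def b_def same .
  then have "inner (cost_grad i (with_block own i t y) \<theta>') (t - b) \<le> - \<mu> * inner (t - b) (t - b)"
    by (simp add: inner_simps algebra_simps)
  moreover have "inner (cost_grad i y \<theta>') (t - b) \<le> inner (cost_grad i (with_block own i t y) \<theta>') (t - b)"
    using cost_grad_monotone[OF y theta_star_mem b t] unfolding b_def same[symmetric] by simp
  moreover have "inner (cost_grad i x \<theta>' - cost_grad i y \<theta>') (t - b) \<le> Lx * norm (x - y) * \<Delta>"
  proof -
    have "inner (cost_grad i x \<theta>' - cost_grad i y \<theta>') (t - b) \<le> norm (cost_grad i x \<theta>' - cost_grad i y \<theta>') * norm (t - b)"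
      by (rule norm_cauchy_schwarz)
    also have "\<dots> \<le> (Lx * norm (x - y)) * norm (t - b)"
      by (intro mult_right_mono cost_grad_lipschitz x y) simp
    finally show ?thesis unfolding \<Delta>_def t_def b_def .
  qed
  ultimately have "inner (cost_grad i x \<theta>') (t - b) \<le> - \<mu> * \<Delta>\<^sup>2 + Lx * norm (x - y) * \<Delta>"
    unfolding \<Delta>_def power2_norm_eq_inner t_def b_def by (simp add: inner_diff_left)
  moreover have "cost gm i (with_block own i t x) \<theta>'
      \<le> cost gm i x \<theta>' + inner (cost_grad i x \<theta>') (t - b) + Lx / 2 * \<Delta>\<^sup>2"
    using cost_descent[OF x t] unfolding \<Delta>_def t_def b_def .
  ultimately show ?thesis unfolding t_def by (simp add: algebra_simps)
qed

text \<open>By convexity a difference of costs is bounded by the gradient at either end, and the gradient is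
  bounded on the compact set of profiles.\<close>

lemma cost_lipschitz:
  obtains C where "C \<ge> 0" "\<And>i x y z. x \<in> X \<Longrightarrow> y \<in> strat gm i \<Longrightarrow> z \<in> strat gm i \<Longrightarrow>
    \<bar>cost gm i (with_block own i y x) \<theta>' - cost gm i (with_block own i z x) \<theta>'\<bar> \<le> C * norm (y - z)"
proof -
  have "\<exists>B. \<forall>x\<in>X. norm (cost_grad i x \<theta>') \<le> B" for i
  proof -
    have "Lx-lipschitz_on X (\<lambda>x. cost_grad i x \<theta>')"
      by (rule lipschitz_onI) (auto simp: dist_norm cost_grad_lipschitz Lx_nonneg)
    then have "continuous_on X (\<lambda>x. cost_grad i x \<theta>')" by (rule lipschitz_on_continuous_on)
    then have "bounded ((\<lambda>x. cost_grad i x \<theta>') ` X)"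
      by (intro compact_imp_bounded compact_continuous_image compact_profiles)
    then show ?thesis unfolding bounded_iff by blast
  qed
  then obtain B where B: "\<And>i x. x \<in> X \<Longrightarrow> norm (cost_grad i x \<theta>') \<le> B i" by metis
  define C where "C = (\<Sum>i\<in>UNIV. \<bar>B i\<bar>)"
  have C: "norm (cost_grad i x \<theta>') \<le> C" if "x \<in> X" for i x
  proof -
    have "norm (cost_grad i x \<theta>') \<le> \<bar>B i\<bar>" using B[OF that, of i] by simp
    also have "\<dots> \<le> C" unfolding C_def by (rule member_le_sum) auto
    finally show ?thesis .
  qed
  have half: "cost gm i (with_block own i y x) \<theta>' - cost gm i (with_block own i z x) \<theta>' \<le> C * norm (y - z)"
    if "x \<in> X" "y \<in> strat gm i" "z \<in> strat gm i" for i x y z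
  proof -
    let ?g = "cost_grad i (with_block own i y x) \<theta>'"
    have "- inner ?g (z - y) = inner ?g (y - z)" by (simp add: inner_diff_right)
    also have "\<dots> \<le> norm ?g * norm (y - z)" by (rule norm_cauchy_schwarz)
    also have "\<dots> \<le> C * norm (y - z)"
      by (intro mult_right_mono C with_block_mem that) simp
    finally show ?thesis
      using cost_gradient_ineq[OF that(1) theta_star_mem that(2) that(3)] by linarith
  qed
  show ?thesis
  proof (rule that[of C])
    show "C \<ge> 0" unfolding C_def by (simp add: sum_nonneg)
    fix i x y z assume "x \<in> X" "y \<in> strat gm i" "z \<in> strat gm i"
    then show "\<bar>cost gm i (with_block own i y x) \<theta>' - cost gm i (with_block own i z x) \<theta>'\<bar> \<le> C * norm (y - z)"
      using half[of x y i z] half[of x z i y] by (simp add: norm_minus_commute abs_le_iff)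
  qed
qed

text \<open>Along any path that changes one block at a time the potential changes like the costs, which
  are Lipschitz; moving from a fixed profile to an arbitrary one takes only as many such changes as
  there are players, so that the potential is bounded.\<close>

lemma potential:
  obtains P B where
    "\<And>i x z. x \<in> X \<Longrightarrow> z \<in> strat gm i \<Longrightarrow>
      P (with_block own i z x) - P x = cost gm i (with_block own i z x) \<theta>' - cost gm i x \<theta>'"
    "\<And>x. x \<in> X \<Longrightarrow> B \<le> P x"
proof (cases "X = {}")
  case True then show ?thesis using that by blast
next
  case False
  then obtain a where a: "a \<in> X" by blast
  obtain Q :: "real^'c \<Rightarrow> real^'m \<Rightarrow> real" where Q: "\<forall>i. \<forall>x\<in>X. \<forall>y\<in>strat gm i. \<forall>y'\<in>strat gm i.
        Q (with_block own i y x) \<theta>' - Q (with_block own i y' x) \<theta>'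
        = cost gm i (with_block own i y x) \<theta>' - cost gm i (with_block own i y' x) \<theta>'"
    using B1 unfolding assm_B1_def by blast
  define P where "P x = Q x \<theta>'" for x
  have P: "P (with_block own i z x) - P x = cost gm i (with_block own i z x) \<theta>' - cost gm i x \<theta>'"
    if "x \<in> X" "z \<in> strat gm i" for i x z
    using Q[rule_format, OF that profile_block[OF that(1)]] unfolding P_def by simp
  obtain C where C: "C \<ge> 0" "\<And>i x y z. x \<in> X \<Longrightarrow> y \<in> strat gm i \<Longrightarrow> z \<in> strat gm i \<Longrightarrow>
    \<bar>cost gm i (with_block own i y x) \<theta>' - cost gm i (with_block own i z x) \<theta>'\<bar> \<le> C * norm (y - z)"
    using cost_lipschitz by blast
  obtain R where R: "\<And>x. x \<in> X \<Longrightarrow> norm x \<le> R"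
    using compact_profiles[THEN compact_imp_bounded] unfolding bounded_iff by blast
  define mix where "mix S x = (\<chi> c. if own c \<in> S then x $ c else a $ c)" for S x
  have mix_mem: "mix S x \<in> X" if "x \<in> X" for S x
  proof -
    have "block own i (mix S x) = (if i \<in> S then block own i x else block own i a)" for i
      by (auto simp: mix_def block_def vec_eq_iff)
    then show ?thesis using that a unfolding profiles_def by auto
  qed
  have bound: "P a - real (card S) * (C * (2 * R)) \<le> P (mix S x)" if x: "x \<in> X" and "finite S" for S x
    using \<open>finite S\<close>
  proof (induction S rule: finite_induct)
    case empty
    then show ?case by (simp add: mix_def)
  next
    case (insert i S)
    have eq: "mix (insert i S) x = with_block own i (block own i x) (mix S x)"
      by (auto simp: mix_def with_block_def block_def vec_eq_iff)
    have "P (mix (insert i S) x) - P (mix S x)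
        = cost gm i (with_block own i (block own i x) (mix S x)) \<theta>' - cost gm i (mix S x) \<theta>'"
      unfolding eq by (rule P[OF mix_mem[OF x] profile_block[OF x]])
    moreover have "\<bar>cost gm i (with_block own i (block own i x) (mix S x)) \<theta>' - cost gm i (mix S x) \<theta>'\<bar>
        \<le> C * norm (block own i x - block own i (mix S x))"
      using C(2)[OF mix_mem[OF x, of S] profile_block[OF x] profile_block[OF mix_mem[OF x, of S]], of i]
      by simp
    moreover have "norm (block own i x - block own i (mix S x)) \<le> 2 * R"
    proof -
      have "norm (block own i x - block own i (mix S x)) \<le> norm (x - mix S x)"
        unfolding block_diff[symmetric] by (rule norm_block_le)
      also have "\<dots> \<le> norm x + norm (mix S x)" by (rule norm_triangle_ineq4)
      also have "\<dots> \<le> R + R" by (intro add_mono R x mix_mem)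
      finally show ?thesis by simp
    qed
    then have "C * norm (block own i x - block own i (mix S x)) \<le> C * (2 * R)"
      using C(1) by (rule mult_left_mono)
    ultimately show ?case using insert by (simp add: distrib_right)
  qed
  show ?thesis
  proof (rule that[of P "P a - real (card (UNIV :: 'n set)) * (C * (2 * R))"])
    fix x assume x: "x \<in> X"
    have "mix UNIV x = x" by (simp add: mix_def vec_eq_iff)
    then show "P a - real (card (UNIV :: 'n set)) * (C * (2 * R)) \<le> P x"
      using bound[OF x, of UNIV] by simp
  qed (rule P)
qed

end

section \<open>Cluster points of slowly moving sequences\<close>

definition cluster_set :: "(nat \<Rightarrow> 'a::metric_space) \<Rightarrow> 'a set" where
  "cluster_set x = (\<Inter>n. closure (x ` {n..}))"

lemma mem_cluster_set_iff:
  "z \<in> cluster_set x \<longleftrightarrow> (\<forall>n. \<forall>e>0. \<exists>k\<ge>n. dist (x k) z < e)"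
  unfolding cluster_set_def by (auto simp: closure_approachable)

lemma subsequence_limit_in_cluster_set:
  assumes r: "strict_mono r" and lim: "(\<lambda>k. x (r k)) \<longlonglongrightarrow> z"
  shows "z \<in> cluster_set x"
  unfolding mem_cluster_set_iff
proof (intro allI impI)
  fix n :: nat and e :: real assume "e > 0"
  then obtain m where "\<forall>k\<ge>m. dist (x (r k)) z < e" using lim unfolding lim_sequentially by blast
  then have "dist (x (r (max m n))) z < e" by simp
  moreover have "n \<le> r (max m n)" using seq_suble[OF r, of "max m n"] by simp
  ultimately show "\<exists>k\<ge>n. dist (x k) z < e" by blast
qed

lemma cluster_set_nonempty:
  fixes x :: "nat \<Rightarrow> 'a::heine_borel"
  assumes K: "compact K" "\<And>k. x k \<in> K"
  shows "cluster_set x \<noteq> {}"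
proof -
  have "compact (closure (x ` {n..}))" for n
    using K by (intro compact_closure[THEN iffD2] bounded_subset[OF compact_imp_bounded[OF K(1)]]) auto
  moreover have "closure (x ` {n..}) \<subseteq> closure (x ` {m..})" if "m \<le> n" for m n
    using that by (intro closure_mono image_mono) auto
  ultimately have "\<Inter> (range (\<lambda>n. closure (x ` {n..}))) \<noteq> {}"
    by (intro compact_nest) auto
  then show ?thesis unfolding cluster_set_def by simp
qed

text \<open>Otherwise the compact sets that remain of the tails outside a neighbourhood of the cluster set would
  have a common point.\<close>

lemma infdist_cluster_set_tendsto_0:
  fixes x :: "nat \<Rightarrow> 'a::heine_borel"
  assumes K: "compact K" "\<And>k. x k \<in> K"
  shows "(\<lambda>k. infdist (x k) (cluster_set x)) \<longlonglongrightarrow> 0"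
proof (rule LIMSEQ_I)
  fix e :: real assume e: "e > 0"
  define V where "V = {y. infdist y (cluster_set x) < e}"
  have V: "open V"
    unfolding V_def by (intro open_Collect_less continuous_intros)
  let ?F = "\<lambda>n. closure (x ` {n..}) - V"
  have compact: "compact (?F n)" for n
    using K V by (intro compact_diff compact_closure[THEN iffD2]
        bounded_subset[OF compact_imp_bounded[OF K(1)]]) auto
  have "\<exists>n. ?F n = {}"
  proof (rule ccontr)
    assume "\<nexists>n. ?F n = {}"
    moreover have "?F n \<subseteq> ?F m" if "m \<le> n" for m n
      using that by (intro Diff_mono closure_mono image_mono) auto
    ultimately have "\<Inter> (range ?F) \<noteq> {}"
      using compact by (intro compact_nest) auto
    then obtain z where "z \<in> cluster_set x" "z \<notin> V" unfolding cluster_set_def by auto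
    then show False using e unfolding V_def by simp
  qed
  then obtain n where "?F n = {}" by blast
  moreover have "x k \<in> closure (x ` {n..})" if "k \<ge> n" for k
    using that by (intro closure_subset[THEN subsetD]) auto
  ultimately have "\<forall>k\<ge>n. x k \<in> V" by blast
  then show "\<exists>n. \<forall>k\<ge>n. norm (infdist (x k) (cluster_set x) - 0) < e"
    unfolding V_def by (intro exI[of _ n]) (simp add: infdist_nonneg)
qed

text \<open>Joining successive points by segments yields connected sets. Because the steps tend to zero,
  these sets have the same cluster points as the sequence itself, and a decreasing intersection of
  compact connected sets is connected.\<close>

lemma connected_cluster_set:
  fixes x :: "nat \<Rightarrow> 'a::euclidean_space"
  assumes b: "bounded (range x)" and step: "(\<lambda>k. norm (x (Suc k) - x k)) \<longlonglongrightarrow> 0"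
  shows "connected (cluster_set x)"
proof -
  define U where "U n = (\<Union>k\<in>{n..}. closed_segment (x k) (x (Suc k)))" for n
  have U_mono: "U n \<subseteq> U m" if "m \<le> n" for m n using that unfolding U_def by force
  have conn: "connected (\<Union>k\<in>{n..<n + m}. closed_segment (x k) (x (Suc k)))
      \<and> (m > 0 \<longrightarrow> x (n + m) \<in> (\<Union>k\<in>{n..<n + m}. closed_segment (x k) (x (Suc k))))" for n m
  proof (induction m)
    case (Suc m)
    have eq: "(\<Union>k\<in>{n..<n + Suc m}. closed_segment (x k) (x (Suc k)))
        = (\<Union>k\<in>{n..<n + m}. closed_segment (x k) (x (Suc k))) \<union> closed_segment (x (n + m)) (x (Suc (n + m)))"
    proof -
      have "{n..<n + Suc m} = insert (n + m) {n..<n + m}" by auto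
      then show ?thesis by (simp add: Un_commute)
    qed
    show ?case
    proof (cases "m = 0")
      case False
      then have "x (n + m) \<in> (\<Union>k\<in>{n..<n + m}. closed_segment (x k) (x (Suc k)))
          \<inter> closed_segment (x (n + m)) (x (Suc (n + m)))" using Suc by simp
      then show ?thesis
        unfolding eq using Suc by (intro conjI connected_Un connected_segment) auto
    qed simp
  qed simp
  have "connected (U n)" for n
  proof -
    have "U n = (\<Union>m. \<Union>k\<in>{n..<n + Suc m}. closed_segment (x k) (x (Suc k)))"
    proof (intro equalityI subsetI)
      fix z assume "z \<in> U n"
      then obtain k where "k \<ge> n" "z \<in> closed_segment (x k) (x (Suc k))" unfolding U_def by auto
      then have "z \<in> (\<Union>k\<in>{n..<n + Suc k}. closed_segment (x k) (x (Suc k)))" by auto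
      then show "z \<in> (\<Union>m. \<Union>k\<in>{n..<n + Suc m}. closed_segment (x k) (x (Suc k)))" by blast
    qed (auto simp: U_def)
    moreover have "connected (\<Union> (range (\<lambda>m. \<Union>k\<in>{n..<n + Suc m}. closed_segment (x k) (x (Suc k)))))"
    proof (rule connected_Union)
      have "x n \<in> (\<Union>k\<in>{n..<n + Suc m}. closed_segment (x k) (x (Suc k)))" for m
        by (rule UN_I[of n]) auto
      then show "\<Inter> (range (\<lambda>m. \<Union>k\<in>{n..<n + Suc m}. closed_segment (x k) (x (Suc k)))) \<noteq> {}"
        by blast
    qed (use conn in blast)
    ultimately show ?thesis by simp
  qed
  then have cc: "connected (closure (U n))" for n by (rule connected_imp_connected_closure)
  obtain R where R: "\<And>k. norm (x k) \<le> R" using b unfolding bounded_iff by auto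
  have "U n \<subseteq> cball 0 R" for n
    unfolding U_def using R by (intro UN_least closed_segment_subset convex_cball) auto
  then have comp: "compact (closure (U n))" for n
    by (meson bounded_cball bounded_subset compact_closure)
  have "cluster_set x = (\<Inter>n. closure (U n))"
  proof (intro equalityI INT_greatest)
    fix n
    have "x ` {n..} \<subseteq> U n" unfolding U_def by force
    then show "cluster_set x \<subseteq> closure (U n)" unfolding cluster_set_def using closure_mono by blast
  next
    show "(\<Inter>n. closure (U n)) \<subseteq> cluster_set x"
    proof
      fix z assume z: "z \<in> (\<Inter>n. closure (U n))"
      show "z \<in> cluster_set x" unfolding mem_cluster_set_iff
      proof (intro allI impI)
        fix n and e :: real assume e: "e > 0"
        obtain m where m: "\<forall>k\<ge>m. norm (x (Suc k) - x k) < e / 2"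
          using step[THEN LIMSEQ_D, of "e / 2"] e by auto
        have "z \<in> closure (U (max m n))" using z by blast
        then obtain y where y: "y \<in> U (max m n)" "dist y z < e / 2"
          using e unfolding closure_approachable by (meson half_gt_zero)
        then obtain k where k: "k \<ge> max m n" "y \<in> closed_segment (x k) (x (Suc k))"
          unfolding U_def by auto
        have "dist (x k) y \<le> norm (x (Suc k) - x k)"
          using segment_bound(1)[OF k(2)] by (simp add: dist_norm norm_minus_commute)
        also have "\<dots> < e / 2" using m k by simp
        finally have "dist (x k) z < e" using y(2) dist_triangle_half_r[of y "x k" e z]
          by (simp add: dist_commute)
        then show "\<exists>k\<ge>n. dist (x k) z < e" using k by auto
      qed
    qed
  qed
  also have "connected \<dots>"
    by (rule connected_nest[OF comp cc closure_mono[OF U_mono]])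
  finally show ?thesis .
qed

section \<open>Descent with delays\<close>

lemma sum_window_le:
  fixes g :: "nat \<Rightarrow> real"
  assumes "\<And>l. 0 \<le> g l"
  shows "(\<Sum>k<n. \<Sum>l\<in>{k - \<tau>..<k}. g l) \<le> real \<tau> * (\<Sum>l<n. g l)"
proof -
  have "(\<Sum>k<n. \<Sum>l\<in>{k - \<tau>..<k}. g l) = (\<Sum>k<n. \<Sum>l | l < n \<and> k - \<tau> \<le> l \<and> l < k. g l)"
    by (intro sum.cong refl) auto
  also have "\<dots> = (\<Sum>l<n. \<Sum>k | k < n \<and> k - \<tau> \<le> l \<and> l < k. g l)"
    using sum.swap_restrict[of "{..<n}" "{..<n}" "\<lambda>k l. g l" "\<lambda>k l. k - \<tau> \<le> l \<and> l < k"] by simp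
  also have "\<dots> \<le> (\<Sum>l<n. real \<tau> * g l)"
  proof (rule sum_mono)
    fix l
    have "card {k. k < n \<and> k - \<tau> \<le> l \<and> l < k} \<le> card {l<..l + \<tau>}" by (rule card_mono) auto
    then have "real (card {k. k < n \<and> k - \<tau> \<le> l \<and> l < k}) \<le> real \<tau>" by simp
    then show "(\<Sum>k | k < n \<and> k - \<tau> \<le> l \<and> l < k. g l) \<le> real \<tau> * g l"
      using assms[of l] by (simp add: mult_right_mono)
  qed
  finally show ?thesis by (simp add: sum_distrib_left)
qed

text \<open>The delayed term is split by \<open>2 s D \<le> s\<^sup>2 + D\<^sup>2\<close>. For each \<open>k\<close> this charges
  \<open>D\<^sup>2\<close> at most \<open>\<tau>\<close> times, and each step length is charged at most \<open>\<tau>\<close> times over all \<open>k\<close>. As \<open>s\<close> is \<open>D\<close> up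
  to a summable error, the delays cost \<open>L \<tau>\<close> times the sum of the \<open>D\<^sup>2\<close> in total, half of it from each part.\<close>

lemma delayed_descent_summable:
  fixes V D s b r :: "nat \<Rightarrow> real"
  assumes dec: "\<And>k. V (Suc k) \<le> V k - \<alpha> * (D k)\<^sup>2 + L * r k * D k + C * b k"
    and r: "\<And>k. r k \<le> (\<Sum>l\<in>{k - \<tau>..<k}. s l)"
    and s: "\<And>k. 0 \<le> s k" "\<And>k. s k \<le> D k + b k"
    and D: "\<And>k. 0 \<le> D k" "\<And>k. D k \<le> R"
    and b: "\<And>k. 0 \<le> b k" "summable b"
    and L: "0 \<le> L" and \<alpha>: "L * real \<tau> < \<alpha>" and V: "\<And>k. B \<le> V k" and C: "0 \<le> C"
  shows "summable (\<lambda>k. (D k)\<^sup>2)" and "summable (\<lambda>k. (s k)\<^sup>2)"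
proof -
  define S where "S = suminf b"
  have b_sum: "(\<Sum>k<n. b k) \<le> S" for n unfolding S_def using b by (intro sum_le_suminf) auto
  have b_le: "b k \<le> S" for k
    using b_sum[of "Suc k"] sum_nonneg[of "{..<k}" b] b(1) by simp
  have s2: "(s k)\<^sup>2 \<le> (D k)\<^sup>2 + (2 * R + S) * b k" for k
  proof -
    have "(s k)\<^sup>2 \<le> (D k + b k)\<^sup>2" by (intro power_mono s)
    also have "\<dots> = (D k)\<^sup>2 + (2 * D k + b k) * b k" by (simp add: power2_eq_square algebra_simps)
    also have "\<dots> \<le> (D k)\<^sup>2 + (2 * R + S) * b k"
      using D(2)[of k] b_le[of k] b(1)[of k] by (intro add_left_mono mult_right_mono) auto
    finally show ?thesis .
  qed
  have step: "V (Suc k) \<le> V k - (\<alpha> - L * real \<tau> / 2) * (D k)\<^sup>2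
      + L / 2 * (\<Sum>l\<in>{k - \<tau>..<k}. (s l)\<^sup>2) + C * b k" for k
  proof -
    have "r k * D k \<le> (\<Sum>l\<in>{k - \<tau>..<k}. s l) * D k" by (intro mult_right_mono r D)
    also have "\<dots> \<le> (\<Sum>l\<in>{k - \<tau>..<k}. ((s l)\<^sup>2 + (D k)\<^sup>2) / 2)"
      unfolding sum_distrib_right
    proof (rule sum_mono)
      fix l show "s l * D k \<le> ((s l)\<^sup>2 + (D k)\<^sup>2) / 2"
        using zero_le_power2[of "s l - D k"] by (simp add: power2_diff)
    qed
    also have "\<dots> = (\<Sum>l\<in>{k - \<tau>..<k}. (s l)\<^sup>2) / 2 + real (k - (k - \<tau>)) * ((D k)\<^sup>2 / 2)"
      by (simp add: add_divide_distrib sum.distrib sum_divide_distrib)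
    also have "\<dots> \<le> (\<Sum>l\<in>{k - \<tau>..<k}. (s l)\<^sup>2) / 2 + real \<tau> * ((D k)\<^sup>2 / 2)"
      by (intro add_left_mono mult_right_mono) auto
    finally have "L * (r k * D k) \<le> L * ((\<Sum>l\<in>{k - \<tau>..<k}. (s l)\<^sup>2) / 2 + real \<tau> * ((D k)\<^sup>2 / 2))"
      using L by (rule mult_left_mono)
    then show ?thesis using dec[of k] by (simp add: algebra_simps)
  qed
  define A c where "A = L * real \<tau> / 2" and "c = 2 * R + S"
  have A: "0 \<le> A" "L * real \<tau> = 2 * A" and c: "0 \<le> c"
    unfolding A_def c_def using L D[of 0] b_le[of 0] b(1)[of 0] by auto
  have "(\<alpha> - L * real \<tau>) * (\<Sum>k<n. (D k)\<^sup>2) \<le> V 0 - B + (C + A * c) * S" for n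
  proof -
    have "V n \<le> V 0 - (\<alpha> - L * real \<tau> / 2) * (\<Sum>k<n. (D k)\<^sup>2)
      + L / 2 * (\<Sum>k<n. \<Sum>l\<in>{k - \<tau>..<k}. (s l)\<^sup>2) + C * (\<Sum>k<n. b k)"
    proof (induction n)
      case (Suc n) then show ?case using step[of n] by (simp add: algebra_simps)
    qed simp
    moreover have "L / 2 * (\<Sum>k<n. \<Sum>l\<in>{k - \<tau>..<k}. (s l)\<^sup>2) \<le> L / 2 * (real \<tau> * (\<Sum>k<n. (s k)\<^sup>2))"
      using L by (intro mult_left_mono sum_window_le) auto
    then have "L / 2 * (\<Sum>k<n. \<Sum>l\<in>{k - \<tau>..<k}. (s l)\<^sup>2) \<le> A * (\<Sum>k<n. (s k)\<^sup>2)"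
      unfolding A_def by simp
    moreover have "(\<Sum>k<n. (s k)\<^sup>2) \<le> (\<Sum>k<n. (D k)\<^sup>2) + c * (\<Sum>k<n. b k)"
      unfolding sum_distrib_left sum.distrib[symmetric] c_def by (intro sum_mono s2)
    then have "A * (\<Sum>k<n. (s k)\<^sup>2) \<le> A * ((\<Sum>k<n. (D k)\<^sup>2) + c * (\<Sum>k<n. b k))"
      using A(1) by (rule mult_left_mono)
    moreover have "(C + A * c) * (\<Sum>k<n. b k) \<le> (C + A * c) * S"
      using A C c by (intro mult_left_mono b_sum) auto
    ultimately show ?thesis using V[of n] unfolding A(2) by (simp add: algebra_simps)
  qed
  then have "(\<Sum>k<n. (D k)\<^sup>2) \<le> (V 0 - B + (C + A * c) * S) / (\<alpha> - L * real \<tau>)" for n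
    using \<alpha> by (simp add: pos_le_divide_eq mult.commute)
  then show D2: "summable (\<lambda>k. (D k)\<^sup>2)" by (intro summableI_nonneg_bounded) auto
  show "summable (\<lambda>k. (s k)\<^sup>2)"
    by (rule summable_comparison_test'[OF summable_add[OF D2 summable_mult[OF b(2), of "2 * R + S"]], of 0])
      (use s2 in auto)
qed

definition delay_profile :: "('c::finite \<Rightarrow> 'n) \<Rightarrow> (nat \<Rightarrow> real^'c) \<Rightarrow> ('n \<Rightarrow> nat) \<Rightarrow> nat \<Rightarrow> real^'c" where
  "delay_profile own x d k = (\<chi> c. x (k - d (own c)) $ c)"

lemma block_delay_profile: "block own j (delay_profile own x d k) = block own j (x (k - d j))"
  by (simp add: block_def delay_profile_def vec_eq_iff)

text \<open>In each coordinate the difference telescopes over a part of the last \<open>\<tau>\<close> steps, depending on the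
  delay of the owner. Setting the other coordinates to zero does not increase the length of a step.\<close>

lemma norm_delay_profile_le:
  assumes d: "\<And>j. d j \<le> \<tau>"
  shows "norm (x k - delay_profile own x d k) \<le> (\<Sum>l\<in>{k - \<tau>..<k}. norm (x (Suc l) - x l))"
proof -
  define m where "m l = (\<chi> c. if k - d (own c) \<le> l then (x (Suc l) - x l) $ c else 0)" for l
  have "x k - delay_profile own x d k = (\<Sum>l\<in>{k - \<tau>..<k}. m l)"
  proof (subst vec_eq_iff, intro allI)
    fix c
    let ?a = "k - d (own c)"
    have "(\<Sum>l\<in>{k - \<tau>..<k}. m l) $ c
        = (\<Sum>l\<in>{k - \<tau>..<k}. if ?a \<le> l then x (Suc l) $ c - x l $ c else 0)"
      by (auto simp: m_def intro!: sum.cong)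
    also have "\<dots> = (\<Sum>l\<in>{?a..<k}. x (Suc l) $ c - x l $ c)"
      using d[of "own c"] by (intro sum.mono_neutral_cong_right) auto
    also have "\<dots> = x k $ c - x ?a $ c" by (rule sum_Suc_diff') simp
    finally show "(x k - delay_profile own x d k) $ c = (\<Sum>l\<in>{k - \<tau>..<k}. m l) $ c"
      by (simp add: delay_profile_def)
  qed
  also have "norm \<dots> \<le> (\<Sum>l\<in>{k - \<tau>..<k}. norm (x (Suc l) - x l))"
    by (rule sum_norm_le, rule norm_vec_le_componentwise) (simp add: m_def)
  finally show ?thesis .
qed

context misspecified_game
begin

lemma delay_profile_mem: "(\<And>k. x k \<in> X) \<Longrightarrow> delay_profile own x d k \<in> X"
  unfolding profiles_def by (simp add: block_delay_profile)

text \<open>The actual new strategy differs from the exact response at \<open>\<theta>\<^sup>*\<close> by at most \<open>b k\<close>, the inexactness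
  plus a multiple of the learning error, and \<open>b\<close> is summable. The potential then meets the hypotheses of
  \<open>delayed_descent_summable\<close>.\<close>

lemma inexact_delayed_responses_summable:
  fixes x :: "nat \<Rightarrow> real^'c" and i :: "nat \<Rightarrow> 'n" and d :: "nat \<Rightarrow> 'n \<Rightarrow> nat"
    and \<theta> :: "nat \<Rightarrow> real^'m" and e :: "nat \<Rightarrow> real^'c"
  defines "y \<equiv> \<lambda>k. delay_profile own x (d k) k"
  assumes x: "\<And>k. x k \<in> X" and \<theta>: "\<And>k. \<theta> k \<in> Theta gm"
    and d: "\<And>k. d k (i k) = 0" "\<And>k j. d k j \<le> \<tau>"
    and upd: "\<And>k. block own (i k) (x (Suc k)) = T (i k) (y k) (\<theta> k) + e k"
    and keep: "\<And>k j. j \<noteq> i k \<Longrightarrow> block own j (x (Suc k)) = block own j (x k)"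
    and sum_e: "summable (\<lambda>k. norm (e k))" and sum_\<theta>: "summable (\<lambda>k. norm (\<theta> k - \<theta>'))"
    and \<mu>: "Lx / 2 + Lx * real \<tau> < \<mu>"
  shows "summable (\<lambda>k. (norm (T (i k) (y k) \<theta>' - block own (i k) (x k)))\<^sup>2)"
    and "summable (\<lambda>k. (norm (x (Suc k) - x k))\<^sup>2)"
proof -
  obtain K where K: "K \<ge> 0" "\<And>i x \<theta>. x \<in> X \<Longrightarrow> \<theta> \<in> Theta gm \<Longrightarrow>
    norm (T i x \<theta> - T i x \<theta>') \<le> K * norm (\<theta> - \<theta>')" using prox_misspecification by blast
  obtain C where C: "C \<ge> 0" "\<And>i x y z. x \<in> X \<Longrightarrow> y \<in> strat gm i \<Longrightarrow> z \<in> strat gm i \<Longrightarrow>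
    \<bar>cost gm i (with_block own i y x) \<theta>' - cost gm i (with_block own i z x) \<theta>'\<bar> \<le> C * norm (y - z)"
    using cost_lipschitz by blast
  obtain P B where P: "\<And>i x z. x \<in> X \<Longrightarrow> z \<in> strat gm i \<Longrightarrow>
      P (with_block own i z x) - P x = cost gm i (with_block own i z x) \<theta>' - cost gm i x \<theta>'"
    and B: "\<And>x. x \<in> X \<Longrightarrow> B \<le> P x" using potential by blast
  obtain R where R: "\<And>x. x \<in> X \<Longrightarrow> norm x \<le> R"
    using compact_profiles[THEN compact_imp_bounded] unfolding bounded_iff by blast
  have y: "y k \<in> X" for k unfolding y_def using delay_profile_mem x .
  define t where "t k = T (i k) (y k) \<theta>'" for k
  define D where "D k = norm (t k - block own (i k) (x k))" for k
  define b where "b k = norm (e k) + K * norm (\<theta> k - \<theta>')" for k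
  define z where "z k = block own (i k) (x (Suc k))" for k
  have t: "t k \<in> strat gm (i k)" and z: "z k \<in> strat gm (i k)" for k
    unfolding t_def z_def using prox_mem y theta_star_mem profile_block x by auto
  have x_Suc: "x (Suc k) = with_block own (i k) (z k) (x k)" for k
  proof -
    have "x (Suc k) $ c = x k $ c" if "own c \<noteq> i k" for c
      using keep[OF that] by (auto simp: block_def vec_eq_iff dest!: spec[of _ c])
    then show ?thesis by (auto simp: vec_eq_iff with_block_def z_def block_def)
  qed
  have zt: "norm (z k - t k) \<le> b k" for k
  proof -
    have "z k - t k = e k + (T (i k) (y k) (\<theta> k) - T (i k) (y k) \<theta>')"
      unfolding z_def t_def upd by simp
    then have "norm (z k - t k) \<le> norm (e k) + norm (T (i k) (y k) (\<theta> k) - T (i k) (y k) \<theta>')"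
      by (simp add: norm_triangle_ineq)
    then show ?thesis unfolding b_def using K(2)[OF y[of k] \<theta>[of k], of "i k"] by simp
  qed
  have s: "norm (x (Suc k) - x k) \<le> D k + b k" for k
  proof -
    have "x (Suc k) - x k = z k - block own (i k) (x k)"
    proof -
      have "with_block own (i k) (z k) (x k) - with_block own (i k) (block own (i k) (x k)) (x k)
          = z k - block own (i k) (x k)" by (rule with_block_diff[OF z profile_block[OF x]])
      then show ?thesis by (simp add: x_Suc)
    qed
    also have "\<dots> = (z k - t k) + (t k - block own (i k) (x k))" by simp
    finally have "norm (x (Suc k) - x k) \<le> norm (z k - t k) + D k"
      unfolding D_def by (metis norm_triangle_ineq)
    then show ?thesis using zt[of k] by simp
  qed
  have dec: "P (x (Suc k)) \<le> P (x k) - (\<mu> - Lx / 2) * (D k)\<^sup>2 + Lx * norm (x k - y k) * D k + C * b k" for k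
  proof -
    have "P (x (Suc k)) - P (x k) = cost gm (i k) (with_block own (i k) (z k) (x k)) \<theta>' - cost gm (i k) (x k) \<theta>'"
      unfolding x_Suc by (rule P[OF x z])
    moreover have "\<bar>cost gm (i k) (with_block own (i k) (z k) (x k)) \<theta>'
        - cost gm (i k) (with_block own (i k) (t k) (x k)) \<theta>'\<bar> \<le> C * norm (z k - t k)"
      by (rule C(2)[OF x z t])
    moreover have "C * norm (z k - t k) \<le> C * b k" by (intro mult_left_mono zt C)
    moreover have "block own (i k) (y k) = block own (i k) (x k)"
      unfolding y_def block_delay_profile d by simp
    from delayed_prox_decrease[OF x y this]
    have "cost gm (i k) (with_block own (i k) (t k) (x k)) \<theta>'
      \<le> cost gm (i k) (x k) \<theta>' - (\<mu> - Lx / 2) * (D k)\<^sup>2 + Lx * norm (x k - y k) * D k"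
      unfolding D_def t_def .
    ultimately show ?thesis by linarith
  qed
  have D_le: "D k \<le> R + R" for k
  proof -
    have "D k \<le> norm (t k) + norm (block own (i k) (x k))" unfolding D_def by (rule norm_triangle_ineq4)
    also have "\<dots> \<le> R + R"
    proof (rule add_mono)
      have "t k = block own (i k) (with_block own (i k) (t k) (x k))" using strat_block[OF t] by simp
      then show "norm (t k) \<le> R"
        using norm_block_le[of own "i k" "with_block own (i k) (t k) (x k)"] R[OF with_block_mem[OF x t]]
        by (metis order_trans)
      show "norm (block own (i k) (x k)) \<le> R"
        by (rule order_trans[OF norm_block_le R[OF x]])
    qed
    finally show ?thesis .
  qed
  have b_sum: "summable b" unfolding b_def by (intro summable_add summable_mult sum_e sum_\<theta>)
  have "norm (x k - y k) \<le> (\<Sum>l\<in>{k - \<tau>..<k}. norm (x (Suc l) - x l))" for k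
    unfolding y_def using d(2) by (rule norm_delay_profile_le)
  note main = delayed_descent_summable[of "\<lambda>k. P (x k)" "\<mu> - Lx / 2" D Lx "\<lambda>k. norm (x k - y k)" C b
      "\<lambda>k. norm (x (Suc k) - x k)" \<tau>, OF dec this _ s _ D_le _ b_sum Lx_nonneg _ B[OF x] C(1)]
  show "summable (\<lambda>k. (norm (T (i k) (y k) \<theta>' - block own (i k) (x k)))\<^sup>2)"
    using main(1) \<mu> K(1) unfolding D_def b_def t_def by simp
  show "summable (\<lambda>k. (norm (x (Suc k) - x k))\<^sup>2)"
    using main(2) \<mu> K(1) unfolding D_def b_def by simp
qed

text \<open>Vanishing steps and bounded delays make the delayed profiles asymptotically equal to the current
  ones; by continuity of the proximal response its residual vanishes at each cluster point.\<close>

lemma cluster_points_nash: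
  assumes x: "\<And>k. x k \<in> X" and d: "\<And>i j k. d i j k \<le> \<tau>"
    and step: "(\<lambda>k. norm (x (Suc k) - x k)) \<longlonglongrightarrow> 0"
    and res: "\<And>i. (\<lambda>k. norm (T i (delay_profile own x (\<lambda>j. d i j k) k) \<theta>' - block own i (x k))) \<longlonglongrightarrow> 0"
  shows "cluster_set x \<subseteq> nash gm"
proof
  fix z assume z: "z \<in> cluster_set x"
  have "x ` {0..} \<subseteq> X" using x by auto
  then have "closure (x ` {0..}) \<subseteq> X"
    using compact_profiles compact_imp_closed closure_minimal by blast
  then have zX: "z \<in> X" using z unfolding cluster_set_def by blast
  define K where "K = (Lx + \<mu>) / \<mu>"
  have K: "0 < K" unfolding K_def using Lx_nonneg mu_pos by simp
  have window: "(\<lambda>k. \<Sum>l\<in>{k - \<tau>..<k}. norm (x (Suc l) - x l)) \<longlonglongrightarrow> 0"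
  proof -
    have "(\<lambda>k. \<Sum>j\<in>{1..\<tau>}. norm (x (Suc (k - j)) - x (k - j))) \<longlonglongrightarrow> (\<Sum>j\<in>{1..\<tau>}. 0::real)"
    proof (rule tendsto_sum)
      fix j
      show "(\<lambda>k. norm (x (Suc (k - j)) - x (k - j))) \<longlonglongrightarrow> 0"
        using filterlim_compose[OF step, of "\<lambda>k. k - j"] filterlim_minus_const_nat_at_top by blast
    qed
    then have lim: "(\<lambda>k. \<Sum>j\<in>{1..\<tau>}. norm (x (Suc (k - j)) - x (k - j))) \<longlonglongrightarrow> 0" by simp
    have "(\<Sum>l\<in>{k - \<tau>..<k}. norm (x (Suc l) - x l))
        \<le> (\<Sum>j\<in>{1..\<tau>}. norm (x (Suc (k - j)) - x (k - j)))" for k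
    proof -
      have "(\<Sum>l\<in>{k - \<tau>..<k}. norm (x (Suc l) - x l))
          = (\<Sum>j\<in>(\<lambda>l. k - l) ` {k - \<tau>..<k}. norm (x (Suc (k - j)) - x (k - j)))"
        by (subst sum.reindex) (auto simp: inj_on_def)
      also have "\<dots> \<le> (\<Sum>j\<in>{1..\<tau>}. norm (x (Suc (k - j)) - x (k - j)))"
        by (rule sum_mono2) auto
      finally show ?thesis .
    qed
    then have upper: "\<forall>\<^sub>F k in sequentially. (\<Sum>l\<in>{k - \<tau>..<k}. norm (x (Suc l) - x l))
        \<le> (\<Sum>j\<in>{1..\<tau>}. norm (x (Suc (k - j)) - x (k - j)))" by (rule always_eventually[OF allI])
    have lower: "\<forall>\<^sub>F k in sequentially. 0 \<le> (\<Sum>l\<in>{k - \<tau>..<k}. norm (x (Suc l) - x l))"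
      by (rule always_eventually[OF allI]) (simp add: sum_nonneg)
    show ?thesis by (rule tendsto_sandwich[OF lower upper tendsto_const lim])
  qed
  have "T i z \<theta>' = block own i z" for i
  proof -
    define y where "y k = delay_profile own x (\<lambda>j. d i j k) k" for k
    have y: "y k \<in> X" for k unfolding y_def using delay_profile_mem x .
    define \<phi> where "\<phi> k = norm (T i (y k) \<theta>' - block own i (x k))
        + K * (\<Sum>l\<in>{k - \<tau>..<k}. norm (x (Suc l) - x l))" for k
    have bound: "norm (T i z \<theta>' - block own i z) \<le> \<phi> k + (K + 1) * dist (x k) z" for k
    proof -
      have "norm (T i z \<theta>' - block own i z) \<le> norm (T i z \<theta>' - T i (y k) \<theta>')
          + norm (T i (y k) \<theta>' - block own i (x k)) + norm (block own i (x k) - block own i z)"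
        using norm_triangle_ineq[of "T i z \<theta>' - T i (y k) \<theta>'" "T i (y k) \<theta>' - block own i (x k)"]
          norm_triangle_ineq[of "T i z \<theta>' - block own i (x k)" "block own i (x k) - block own i z"]
        by simp
      moreover have "norm (T i z \<theta>' - T i (y k) \<theta>') \<le> K * norm (z - y k)"
        unfolding K_def by (rule prox_lipschitz[OF zX y])
      moreover have "norm (z - y k) \<le> dist (x k) z + norm (x k - y k)"
        using norm_triangle_ineq[of "z - x k" "x k - y k"] by (simp add: dist_norm norm_minus_commute)
      moreover have "norm (x k - y k) \<le> (\<Sum>l\<in>{k - \<tau>..<k}. norm (x (Suc l) - x l))"
        unfolding y_def using d by (rule norm_delay_profile_le)
      ultimately have "norm (T i z \<theta>' - block own i z)
          \<le> K * (dist (x k) z + (\<Sum>l\<in>{k - \<tau>..<k}. norm (x (Suc l) - x l)))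
          + norm (T i (y k) \<theta>' - block own i (x k)) + norm (block own i (x k) - block own i z)"
        using K by (smt (verit) mult_left_mono)
      moreover have "norm (block own i (x k) - block own i z) \<le> dist (x k) z"
        unfolding block_diff[symmetric] dist_norm by (rule norm_block_le)
      ultimately show ?thesis unfolding \<phi>_def by (simp add: algebra_simps)
    qed
    have "\<phi> \<longlonglongrightarrow> 0 + K * 0"
      unfolding \<phi>_def y_def by (intro tendsto_intros res window)
    then have \<phi>: "\<phi> \<longlonglongrightarrow> 0" by simp
    have "norm (T i z \<theta>' - block own i z) \<le> 0"
    proof (rule field_le_epsilon)
      fix \<epsilon> :: real assume \<epsilon>: "\<epsilon> > 0"
      obtain n where n: "\<forall>k\<ge>n. norm (\<phi> k - 0) < \<epsilon> / 2" using LIMSEQ_D[OF \<phi>, of "\<epsilon> / 2"] \<epsilon> by auto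
      obtain k where k: "k \<ge> n" "dist (x k) z < \<epsilon> / (2 * (K + 1))"
      proof -
        have "0 < \<epsilon> / (2 * (K + 1))" using K \<epsilon> by simp
        then show ?thesis using z that unfolding mem_cluster_set_iff by blast
      qed
      have "(K + 1) * dist (x k) z \<le> \<epsilon> / 2" using k(2) K by (simp add: field_simps)
      moreover have "\<phi> k \<le> \<epsilon> / 2" using n k(1) by fastforce
      ultimately show "norm (T i z \<theta>' - block own i z) \<le> 0 + \<epsilon>" using bound[of k] by simp
    qed
    then show ?thesis by simp
  qed
  then show "z \<in> nash gm" using prox_fixed_imp_nash zX by blast
qed

end

section \<open>Almost sure summability from conditional information\<close>

lemma (in prob_space) sigma_finite_subalgebraI: "subalgebra M F \<Longrightarrow> sigma_finite_subalgebra M F"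
  by (intro finite_measure_subalgebra_is_sigma_finite)
     (simp add: finite_measure_subalgebra_def finite_measure_subalgebra_axioms_def finite_measure_axioms)

lemma summable_of_nn_integral_finite:
  fixes Z :: "nat \<Rightarrow> 'a \<Rightarrow> real"
  assumes Z: "\<And>k. Z k \<in> borel_measurable M" "\<And>k \<omega>. 0 \<le> Z k \<omega>"
    and fin: "(\<Sum>k. \<integral>\<^sup>+\<omega>. ennreal (Z k \<omega>) \<partial>M) < \<infinity>"
  shows "AE \<omega> in M. summable (\<lambda>k. Z k \<omega>)"
proof -
  have "(\<integral>\<^sup>+\<omega>. (\<Sum>k. ennreal (Z k \<omega>)) \<partial>M) < \<infinity>"
    using fin Z by (subst nn_integral_suminf) auto
  then have "AE \<omega> in M. (\<Sum>k. ennreal (Z k \<omega>)) \<noteq> \<infinity>"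
    using Z by (intro nn_integral_PInf_AE) auto
  then show ?thesis
    by eventually_elim (use Z in \<open>auto intro: summable_suminf_not_top\<close>)
qed

lemma ennreal_suminf_le_of_partial_sums:
  fixes f :: "nat \<Rightarrow> ennreal"
  assumes "\<And>n. (\<Sum>k<n. f k) \<le> c"
  shows "(\<Sum>k. f k) \<le> c"
  using assms by (simp add: suminf_eq_SUP SUP_least)

text \<open>If the terms \<open>Z k\<close> have an almost surely summable sequence of conditional expectations, stopping
  the series when the sum \<open>A k\<close> of these expectations exceeds \<open>c\<close> leaves a series with expectation at
  most \<open>c\<close>. As \<open>F k\<close> need not increase with \<open>k\<close>, the stopping rule lives in a larger field \<open>H k\<close>.\<close>

lemma (in prob_space) summable_of_summable_cond_exp:
  fixes Z :: "nat \<Rightarrow> 'a \<Rightarrow> real"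
  assumes F: "\<And>k l. k \<le> l \<Longrightarrow> subalgebra (H l) (F k)" and H: "\<And>k. subalgebra M (H k)"
    and Z: "\<And>k. Z k \<in> borel_measurable M" "\<And>k \<omega>. 0 \<le> Z k \<omega>"
    and cond: "\<And>k B. B \<in> sets (H k) \<Longrightarrow> (\<integral>\<^sup>+\<omega>. indicator B \<omega> * ennreal (Z k \<omega>) \<partial>M)
        = (\<integral>\<^sup>+\<omega>. indicator B \<omega> * nn_cond_exp M (F k) (\<lambda>\<omega>. ennreal (Z k \<omega>)) \<omega> \<partial>M)"
    and sum: "AE \<omega> in M. (\<Sum>k. nn_cond_exp M (F k) (\<lambda>\<omega>. ennreal (Z k \<omega>)) \<omega>) < \<infinity>"
  shows "AE \<omega> in M. summable (\<lambda>k. Z k \<omega>)"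
proof -
  define C where "C k = nn_cond_exp M (F k) (\<lambda>\<omega>. ennreal (Z k \<omega>))" for k
  have C_meas: "C k \<in> borel_measurable (H l)" if "k \<le> l" for k l
    unfolding C_def by (rule measurable_from_subalg[OF F[OF that]]) simp
  have C_M [measurable]: "C k \<in> borel_measurable M" for k
    using measurable_from_subalg[OF H C_meas[OF order_refl]] .
  define A where "A k \<omega> = (\<Sum>l\<le>k. C l \<omega>)" for k \<omega>
  define B where "B c k = {\<omega>\<in>space M. A k \<omega> \<le> ennreal (real c)}" for c :: nat and k
  have B: "B c k \<in> sets (H k)" for c k
  proof -
    have "A k \<in> borel_measurable (H k)" unfolding A_def by (intro borel_measurable_sum C_meas) auto
    then have "{\<omega>\<in>space (H k). A k \<omega> \<le> ennreal (real c)} \<in> sets (H k)" by measurable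
    then show ?thesis unfolding B_def using H[of k] by (simp add: subalgebra_def)
  qed
  then have B_M [measurable]: "B c k \<in> sets M" for c k using H[of k] unfolding subalgebra_def by blast
  have stopped: "(\<Sum>k<n. indicator (B c k) \<omega> * C k \<omega>) \<le> (if n = 0 then 0 else A (n - 1) \<omega>)
      \<and> (\<Sum>k<n. indicator (B c k) \<omega> * C k \<omega>) \<le> ennreal (real c)" for n c \<omega>
  proof (induction n)
    case (Suc n)
    have An: "A n \<omega> = (if n = 0 then 0 else A (n - 1) \<omega>) + C n \<omega>"
      by (cases n) (simp_all add: A_def)
    show ?case
    proof (cases "\<omega> \<in> B c n")
      case True
      then have a: "(\<Sum>k<Suc n. indicator (B c k) \<omega> * C k \<omega>) \<le> A n \<omega>"
        using Suc by (simp add: An add_right_mono)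
      have "A n \<omega> \<le> ennreal (real c)" using True unfolding B_def by simp
      then show ?thesis using a order_trans[OF a] by (simp del: sum.lessThan_Suc)
    next
      case False
      then have e: "(\<Sum>k<Suc n. indicator (B c k) \<omega> * C k \<omega>) = (\<Sum>k<n. indicator (B c k) \<omega> * C k \<omega>)" by simp
      have "(if n = 0 then 0 else A (n - 1) \<omega>) \<le> A n \<omega>" unfolding An by simp
      then show ?thesis
        unfolding e using order_trans[OF conjunct1[OF Suc]] conjunct2[OF Suc] by simp
    qed
  qed simp
  have AE_stopped: "AE \<omega> in M. summable (\<lambda>k. indicator (B c k) \<omega> * Z k \<omega>)" for c
  proof (rule summable_of_nn_integral_finite)
    have "(\<Sum>k. \<integral>\<^sup>+\<omega>. ennreal (indicator (B c k) \<omega> * Z k \<omega>) \<partial>M)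
        = (\<Sum>k. \<integral>\<^sup>+\<omega>. indicator (B c k) \<omega> * C k \<omega> \<partial>M)"
      unfolding C_def using cond[OF B] by (intro suminf_cong) (simp add: ennreal_mult' ennreal_indicator)
    also have "\<dots> = (\<integral>\<^sup>+\<omega>. (\<Sum>k. indicator (B c k) \<omega> * C k \<omega>) \<partial>M)"
      by (rule nn_integral_suminf[symmetric]) measurable
    also have "\<dots> \<le> (\<integral>\<^sup>+\<omega>. ennreal (real c) \<partial>M)"
      by (intro nn_integral_mono ennreal_suminf_le_of_partial_sums) (use stopped in blast)
    also have "\<dots> < \<infinity>" by (simp add: emeasure_space_1)
    finally show "(\<Sum>k. \<integral>\<^sup>+\<omega>. ennreal (indicator (B c k) \<omega> * Z k \<omega>) \<partial>M) < \<infinity>" .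
  qed (use Z in \<open>auto intro!: borel_measurable_times\<close>)
  have "AE \<omega> in M. \<forall>c. summable (\<lambda>k. indicator (B c k) \<omega> * Z k \<omega>)"
    using AE_stopped by (simp add: AE_all_countable)
  moreover note sum AE_space
  ultimately show ?thesis
  proof eventually_elim
    case (elim \<omega>)
    then have "(\<Sum>k. C k \<omega>) < \<infinity>" unfolding C_def by simp
    then obtain c :: nat where c: "(\<Sum>k. C k \<omega>) \<le> ennreal (real c)"
      using ennreal_Ex_less_of_nat[of "\<Sum>k. C k \<omega>"] by (auto simp: ennreal_of_nat_eq_real_of_nat intro: less_imp_le)
    have "A k \<omega> \<le> (\<Sum>k. C k \<omega>)" for k
      unfolding A_def lessThan_Suc_atMost[symmetric] by (rule sum_le_suminf) auto
    then have "\<omega> \<in> B c k" for k unfolding B_def using elim c order_trans by blast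
    then show ?case using elim(1)[rule_format, of c] by simp
  qed
qed

lemma nn_integral_indicator_mult:
  assumes "A \<in> sets M" "B \<in> sets M"
  shows "(\<integral>\<^sup>+\<omega>. indicator A \<omega> * indicator B \<omega> \<partial>M) = emeasure M (A \<inter> B)"
proof -
  have "(\<integral>\<^sup>+\<omega>. indicator A \<omega> * indicator B \<omega> \<partial>M) = (\<integral>\<^sup>+\<omega>. indicator (A \<inter> B) \<omega> \<partial>M)"
    by (intro nn_integral_cong) (simp split: split_indicator)
  also have "\<dots> = emeasure M (A \<inter> B)" using assms by (intro nn_integral_indicator) auto
  finally show ?thesis .
qed

text \<open>Conversely, let a summand be retained at random, with probability \<open>p\<close> and independently of the
  present field. If the thinned series converges, so does the full one: stopped at the level
  \<open>c\<close> of its partial sums, the thinned series has expectation at most \<open>2 c\<close>, which is \<open>p\<close> times the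
  expectation of the stopped full series.\<close>

lemma (in prob_space) nn_integral_thinned:
  assumes F: "subalgebra M F" and S: "S \<in> sets M"
    and indep: "\<And>A. A \<in> sets F \<Longrightarrow> prob (A \<inter> S) = p * prob A" and p: "0 \<le> p"
    and W: "W \<in> borel_measurable F"
  shows "(\<integral>\<^sup>+\<omega>. W \<omega> * indicator S \<omega> \<partial>M) = ennreal p * (\<integral>\<^sup>+\<omega>. W \<omega> \<partial>M)"
proof -
  interpret sigma_finite_subalgebra M F by (rule sigma_finite_subalgebraI[OF F])
  have "AE \<omega> in M. ennreal p = nn_cond_exp M F (indicator S) \<omega>"
  proof (rule nn_cond_exp_charact)
    fix A assume A: "A \<in> sets F"
    then have A_M: "A \<in> sets M" using F unfolding subalgebra_def by blast
    have "(\<integral>\<^sup>+\<omega>\<in>A. indicator S \<omega> \<partial>M) = emeasure M (A \<inter> S)"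
      using nn_integral_indicator_mult[OF A_M S] by (simp add: mult.commute)
    also have "\<dots> = (\<integral>\<^sup>+\<omega>\<in>A. ennreal p \<partial>M)"
      using A_M indep[OF A] p
      by (simp add: emeasure_eq_measure nn_integral_cmult_indicator ennreal_mult')
    finally show "(\<integral>\<^sup>+\<omega>\<in>A. indicator S \<omega> \<partial>M) = (\<integral>\<^sup>+\<omega>\<in>A. ennreal p \<partial>M)" .
  qed (use S in auto)
  then have "(\<integral>\<^sup>+\<omega>. W \<omega> * nn_cond_exp M F (indicator S) \<omega> \<partial>M) = (\<integral>\<^sup>+\<omega>. W \<omega> * ennreal p \<partial>M)"
    by (intro nn_integral_cong_AE) auto
  moreover have "W \<in> borel_measurable M" by (rule measurable_from_subalg[OF F W])
  ultimately show ?thesis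
    using nn_cond_exp_intg[OF W, of "indicator S"] S
    by (simp add: nn_integral_cmult mult.commute)
qed

lemma (in prob_space) summable_of_summable_thinned:
  fixes W :: "nat \<Rightarrow> 'a \<Rightarrow> real"
  assumes F: "\<And>k. subalgebra M (F k)" and S: "\<And>k. S k \<in> sets M"
    and indep: "\<And>k A. A \<in> sets (F k) \<Longrightarrow> prob (A \<inter> S k) = p * prob A" and p: "0 < p"
    and W: "\<And>k. W k \<in> borel_measurable (F k)" "\<And>k \<omega>. 0 \<le> W k \<omega>"
    and past: "\<And>k. (\<lambda>\<omega>. \<Sum>l<k. W l \<omega> * indicator (S l) \<omega>) \<in> borel_measurable (F k)"
    and bdd: "AE \<omega> in M. bdd_above (range (\<lambda>k. W k \<omega>))"
    and sum: "AE \<omega> in M. summable (\<lambda>k. W k \<omega> * indicator (S k) \<omega>)"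
  shows "AE \<omega> in M. summable (\<lambda>k. W k \<omega>)"
proof -
  define A where "A k \<omega> = (\<Sum>l<k. W l \<omega> * indicator (S l) \<omega>)" for k \<omega>
  define B where "B c k = {\<omega>\<in>space M. A k \<omega> \<le> real c \<and> W k \<omega> \<le> real c}" for c :: nat and k
  have B: "B c k \<in> sets (F k)" for c k
  proof -
    have [measurable]: "A k \<in> borel_measurable (F k)" "W k \<in> borel_measurable (F k)"
      unfolding A_def using past W by auto
    have sp: "space M = space (F k)" using F[of k] by (simp add: subalgebra_def)
    show ?thesis unfolding B_def sp by measurable
  qed
  then have B_M [measurable]: "B c k \<in> sets M" for c k using F[of k] unfolding subalgebra_def by blast
  have W_M [measurable]: "W k \<in> borel_measurable M" for k by (rule measurable_from_subalg[OF F W(1)])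
  define Y where "Y c k \<omega> = indicator (B c k) \<omega> * W k \<omega>" for c k \<omega>
  have Y0: "0 \<le> Y c k \<omega>" for c k \<omega> unfolding Y_def using W by simp
  have Y_meas: "(\<lambda>\<omega>. ennreal (Y c k \<omega>)) \<in> borel_measurable (F k)" for c k
    unfolding Y_def using B W(1) by measurable
  have Y_M [measurable]: "Y c k \<in> borel_measurable M" for c k unfolding Y_def by measurable
  have stopped: "(\<Sum>k<n. Y c k \<omega> * indicator (S k) \<omega>) \<le> A n \<omega>
      \<and> (\<Sum>k<n. Y c k \<omega> * indicator (S k) \<omega>) \<le> 2 * real c" for n c \<omega>
  proof (induction n)
    case (Suc n)
    show ?case
    proof (cases "\<omega> \<in> B c n")
      case True
      have "W n \<omega> * indicator (S n) \<omega> \<le> W n \<omega>" using W by (simp add: indicator_def)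
      then have "W n \<omega> * indicator (S n) \<omega> \<le> real c" "A n \<omega> \<le> real c" using True unfolding B_def by auto
      moreover have "Y c n \<omega> = W n \<omega>" using True unfolding Y_def by simp
      ultimately show ?thesis using Suc by (simp add: A_def)
    next
      case False
      then have "Y c n \<omega> = 0" unfolding Y_def by simp
      moreover have "A n \<omega> \<le> A (Suc n) \<omega>" unfolding A_def using W by simp
      ultimately show ?thesis using Suc by simp
    qed
  qed (simp add: A_def)
  have AE_stopped: "AE \<omega> in M. summable (\<lambda>k. Y c k \<omega>)" for c
  proof (rule summable_of_nn_integral_finite[OF Y_M Y0])
    have "ennreal p * (\<Sum>k. \<integral>\<^sup>+\<omega>. ennreal (Y c k \<omega>) \<partial>M)
        = (\<Sum>k. \<integral>\<^sup>+\<omega>. ennreal (Y c k \<omega>) * indicator (S k) \<omega> \<partial>M)"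
      using nn_integral_thinned[OF F S indep _ Y_meas] p by simp
    also have "\<dots> = (\<integral>\<^sup>+\<omega>. (\<Sum>k. ennreal (Y c k \<omega>) * indicator (S k) \<omega>) \<partial>M)"
      using S by (intro nn_integral_suminf[symmetric]) auto
    also have "\<dots> \<le> (\<integral>\<^sup>+\<omega>. ennreal (2 * real c) \<partial>M)"
    proof (intro nn_integral_mono ennreal_suminf_le_of_partial_sums)
      fix \<omega> n
      have "(\<Sum>k<n. ennreal (Y c k \<omega>) * indicator (S k) \<omega>)
          = ennreal (\<Sum>k<n. Y c k \<omega> * indicator (S k) \<omega>)"
        using Y0 by (subst sum_ennreal[symmetric]) (auto simp: ennreal_mult' ennreal_indicator)
      then show "(\<Sum>k<n. ennreal (Y c k \<omega>) * indicator (S k) \<omega>) \<le> ennreal (2 * real c)"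
        using stopped ennreal_leI by metis
    qed
    also have "\<dots> < \<infinity>" by (simp add: emeasure_space_1)
    finally show "(\<Sum>k. \<integral>\<^sup>+\<omega>. ennreal (Y c k \<omega>) \<partial>M) < \<infinity>"
      using p by (auto simp: ennreal_mult_less_top)
  qed
  have "AE \<omega> in M. \<forall>c. summable (\<lambda>k. Y c k \<omega>)"
    using AE_stopped by (simp add: AE_all_countable)
  moreover note sum bdd AE_space
  ultimately show ?thesis
  proof eventually_elim
    case (elim \<omega>)
    obtain b where b: "\<And>k. W k \<omega> \<le> b" using elim(3) unfolding bdd_above_def by auto
    obtain c :: nat where c: "max b (\<Sum>k. W k \<omega> * indicator (S k) \<omega>) \<le> real c"
      using real_arch_simple by blast
    have "A k \<omega> \<le> (\<Sum>k. W k \<omega> * indicator (S k) \<omega>)" for k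
      unfolding A_def using W by (intro sum_le_suminf elim) auto
    then have "\<omega> \<in> B c k" for k
      unfolding B_def using elim(4) c b[of k] by (auto intro: order_trans)
    then show ?case using elim(1)[rule_format, of c] unfolding Y_def by simp
  qed
qed

text \<open>If \<open>K\<close> is independent of \<open>H\<close>, then \<open>H\<close> and \<open>\<sigma>(F, K)\<close> are conditionally independent given the
  subfield \<open>F\<close> of \<open>H\<close>. It suffices to see this on intersections of an event of \<open>F\<close> with one of \<open>K\<close>.\<close>

lemma (in prob_space) cond_exp_given_larger_field:
  assumes F: "subalgebra H F" and H: "subalgebra M H" and K: "subalgebra M K"
    and indep: "\<And>A D. A \<in> sets H \<Longrightarrow> D \<in> sets K \<Longrightarrow> prob (A \<inter> D) = prob A * prob D"
    and Z: "Z \<in> borel_measurable (sigma (space M) (sets F \<union> sets K))" and B: "B \<in> sets H"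
  shows "(\<integral>\<^sup>+\<omega>. indicator B \<omega> * Z \<omega> \<partial>M) = (\<integral>\<^sup>+\<omega>. indicator B \<omega> * nn_cond_exp M F Z \<omega> \<partial>M)"
proof -
  have FM: "subalgebra M F" using F H unfolding subalgebra_def by auto
  interpret sigma_finite_subalgebra M F by (rule sigma_finite_subalgebraI[OF FM])
  have sp: "space F = space M" "space H = space M" "space K = space M"
    using FM H K unfolding subalgebra_def by auto
  define \<G> where "\<G> = sigma (space M) (sets F \<union> sets K)"
  have Pow: "sets F \<union> sets K \<subseteq> Pow (space M)"
    using sets.space_closed[of F] sets.space_closed[of K] sp by auto
  have sets_G: "sets \<G> = sigma_sets (space M) (sets F \<union> sets K)" and space_G: "space \<G> = space M"
    unfolding \<G>_def using Pow by (auto simp: space_measure_of)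
  have G: "subalgebra M \<G>"
  proof -
    have "sets F \<union> sets K \<subseteq> sets M" using FM K unfolding subalgebra_def by auto
    then have "sets \<G> \<subseteq> sets M" unfolding sets_G by (rule sets.sigma_sets_subset)
    then show ?thesis using space_G unfolding subalgebra_def by simp
  qed
  have B_M [measurable]: "B \<in> sets M" using B H unfolding subalgebra_def by blast
  define g where "g = nn_cond_exp M F (indicator B)"
  have g_F: "g \<in> borel_measurable F" and g_M [measurable]: "g \<in> borel_measurable M"
    unfolding g_def using measurable_from_subalg[OF FM] by auto
  define E where "E = {C \<inter> D |C D. C \<in> sets F \<and> D \<in> sets K}"
  define N1 N2 where "N1 = restr_to_subalg (density M (indicator B)) \<G>"
    and "N2 = restr_to_subalg (density M g) \<G>"
  have GD: "subalgebra (density M f) \<G>" for f using G by (simp add: subalgebra_def)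
  have E_sub: "E \<subseteq> Pow (space M)" using Pow unfolding E_def by auto
  have sigma_E: "sigma_sets (space M) E = sets \<G>"
  proof
    have "sets F \<union> sets K \<subseteq> sets \<G>" unfolding sets_G by auto
    then have "E \<subseteq> sets \<G>" unfolding E_def by auto
    then show "sigma_sets (space M) E \<subseteq> sets \<G>"
      using sets.sigma_sets_subset[of E \<G>] space_G by simp
    have "C \<in> E" if "C \<in> sets F" for C
    proof -
      have "C = C \<inter> space M" using sets.sets_into_space[OF that] sp by auto
      then show ?thesis unfolding E_def using that sp(3) sets.top[of K] by auto
    qed
    moreover have "D \<in> E" if "D \<in> sets K" for D
    proof -
      have "D = space M \<inter> D" using sets.sets_into_space[OF that] sp by auto
      then show ?thesis unfolding E_def using that sp(1) sets.top[of F] by auto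
    qed
    ultimately have "sets F \<union> sets K \<subseteq> E" by auto
    then show "sets \<G> \<subseteq> sigma_sets (space M) E" unfolding sets_G by (rule sigma_sets_mono')
  qed
  have emeasure_N: "emeasure N1 A = (\<integral>\<^sup>+\<omega>. indicator A \<omega> * indicator B \<omega> \<partial>M)"
      "emeasure N2 A = (\<integral>\<^sup>+\<omega>. indicator A \<omega> * g \<omega> \<partial>M)" if "A \<in> sets \<G>" for A
  proof -
    have "A \<in> sets M" using that G unfolding subalgebra_def by auto
    then show "emeasure N1 A = (\<integral>\<^sup>+\<omega>. indicator A \<omega> * indicator B \<omega> \<partial>M)"
      "emeasure N2 A = (\<integral>\<^sup>+\<omega>. indicator A \<omega> * g \<omega> \<partial>M)"
      unfolding N1_def N2_def using that
      by (simp_all add: emeasure_restr_to_subalg[OF GD] emeasure_density mult.commute)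
  qed
  have "N1 = N2"
  proof (rule measure_eqI_generator_eq[of E "space M" _ _ "\<lambda>_. space M"])
    show "Int_stable E"
    proof (rule Int_stableI)
      fix a b assume "a \<in> E" "b \<in> E"
      then obtain C D C' D' where "C \<in> sets F" "D \<in> sets K" "C' \<in> sets F" "D' \<in> sets K"
        "a = C \<inter> D" "b = C' \<inter> D'" unfolding E_def by auto
      then have "a \<inter> b = (C \<inter> C') \<inter> (D \<inter> D')" "C \<inter> C' \<in> sets F" "D \<inter> D' \<in> sets K" by auto
      then show "a \<inter> b \<in> E" unfolding E_def by blast
    qed
    show "E \<subseteq> Pow (space M)" by (rule E_sub)
    show "sets N1 = sigma_sets (space M) E" "sets N2 = sigma_sets (space M) E"
      unfolding N1_def N2_def sigma_E by (simp_all add: sets_restr_to_subalg[OF GD])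
    have top: "space M \<in> E"
      unfolding E_def using sets.top[of F] sets.top[of K] sp by auto
    then show "range (\<lambda>_. space M) \<subseteq> E" by auto
    have "space M \<in> sets \<G>" using sets.top[of \<G>] space_G by simp
    then show "emeasure N1 (space M) \<noteq> \<infinity>"
      using emeasure_N(1)[of "space M"] emeasure_finite[of B] sets.Int_space_eq2[OF B_M]
      by (simp add: indicator_inter_arith[symmetric] Int_commute)
    fix A assume "A \<in> E"
    then obtain C D where CD: "C \<in> sets F" "D \<in> sets K" "A = C \<inter> D" unfolding E_def by auto
    have A_G: "A \<in> sets \<G>" using \<open>A \<in> E\<close> sigma_E by (metis sigma_sets.Basic)
    have [measurable]: "C \<in> sets M" "D \<in> sets M" using CD FM K unfolding subalgebra_def by auto
    have CH: "C \<in> sets H" using CD(1) F unfolding subalgebra_def by auto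
    have A_M: "A \<in> sets M" unfolding CD(3) by measurable
    have "A \<inter> B = C \<inter> B \<inter> D" unfolding CD(3) by auto
    then have "emeasure N1 A = emeasure M (C \<inter> B \<inter> D)"
      using emeasure_N(1)[OF A_G] nn_integral_indicator_mult[OF A_M B_M] by simp
    also have "\<dots> = ennreal (prob D) * emeasure M (C \<inter> B)"
      using indep[of "C \<inter> B" D] B CH CD(2) by (auto simp: emeasure_eq_measure ennreal_mult' mult.commute)
    also have "emeasure M (C \<inter> B) = (\<integral>\<^sup>+\<omega>. indicator C \<omega> * indicator B \<omega> \<partial>M)"
      by (rule nn_integral_indicator_mult[symmetric]) measurable
    also have "\<dots> = (\<integral>\<^sup>+\<omega>. indicator C \<omega> * g \<omega> \<partial>M)"
      unfolding g_def using CD(1) by (intro nn_cond_exp_intg[symmetric]) auto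
    also have "ennreal (prob D) * \<dots> = (\<integral>\<^sup>+\<omega>. (indicator C \<omega> * g \<omega>) * indicator D \<omega> \<partial>M)"
    proof (rule nn_integral_thinned[OF FM, symmetric])
      fix A assume "A \<in> sets F"
      then have "A \<in> sets H" using F unfolding subalgebra_def by auto
      then show "prob (A \<inter> D) = prob D * prob A" using indep CD(2) by (simp add: mult.commute)
    qed (use CD(1) g_F in auto)
    also have "\<dots> = emeasure N2 A"
      unfolding emeasure_N(2)[OF A_G] by (auto intro!: nn_integral_cong simp: CD(3) indicator_def)
    finally show "emeasure N1 A = emeasure N2 A" .
  qed auto
  moreover have Z_G: "Z \<in> borel_measurable \<G>" using Z unfolding \<G>_def .
  have Z_M [measurable]: "Z \<in> borel_measurable M" by (rule measurable_from_subalg[OF G Z_G])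
  have "(\<integral>\<^sup>+\<omega>. Z \<omega> \<partial>N1) = (\<integral>\<^sup>+\<omega>. indicator B \<omega> * Z \<omega> \<partial>M)"
    unfolding N1_def by (simp add: nn_integral_subalgebra2[OF GD Z_G] nn_integral_density)
  moreover have "(\<integral>\<^sup>+\<omega>. Z \<omega> \<partial>N2) = (\<integral>\<^sup>+\<omega>. g \<omega> * Z \<omega> \<partial>M)"
    unfolding N2_def by (simp add: nn_integral_subalgebra2[OF GD Z_G] nn_integral_density)
  ultimately have "(\<integral>\<^sup>+\<omega>. indicator B \<omega> * Z \<omega> \<partial>M) = (\<integral>\<^sup>+\<omega>. g \<omega> * Z \<omega> \<partial>M)" by simp
  also have "\<dots> = (\<integral>\<^sup>+\<omega>. g \<omega> * nn_cond_exp M F Z \<omega> \<partial>M)"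
    by (rule nn_cond_exp_intg[symmetric]) (use g_F in auto)
  also have "\<dots> = (\<integral>\<^sup>+\<omega>. nn_cond_exp M F Z \<omega> * g \<omega> \<partial>M)" by (simp add: mult.commute)
  also have "\<dots> = (\<integral>\<^sup>+\<omega>. nn_cond_exp M F Z \<omega> * indicator B \<omega> \<partial>M)"
    unfolding g_def by (rule nn_cond_exp_intg) auto
  finally show ?thesis by (simp add: mult.commute)
qed

section \<open>Averages of fresh samples\<close>

lemma (in prob_space) indep_var_pair:
  assumes "indep_vars (\<lambda>_. N) Y I" "p \<in> I" "q \<in> I" "p \<noteq> q"
  shows "indep_var N (Y p) N (Y q)"
proof -
  have "indep_var (Pi\<^sub>M {p} (\<lambda>_. N)) (\<lambda>\<omega>. restrict (\<lambda>i. Y i \<omega>) {p})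
      (Pi\<^sub>M {q} (\<lambda>_. N)) (\<lambda>\<omega>. restrict (\<lambda>i. Y i \<omega>) {q})"
    using assms by (intro indep_var_restrict[OF assms(1)]) auto
  then have "indep_var N ((\<lambda>f. f p) \<circ> (\<lambda>\<omega>. restrict (\<lambda>i. Y i \<omega>) {p}))
      N ((\<lambda>f. f q) \<circ> (\<lambda>\<omega>. restrict (\<lambda>i. Y i \<omega>) {q}))"
    by (rule indep_var_compose) auto
  then show ?thesis by (simp add: comp_def)
qed

lemma events_ofI: "A \<in> sets N \<Longrightarrow> Z -` A \<inter> space M \<in> events_of M N Z"
  unfolding events_of_def by (rule in_vimage_algebra)

lemma events_of_subset_Pow: "events_of M N Z \<subseteq> Pow (space M)"
  unfolding events_of_def using sets.space_closed[of "vimage_algebra (space M) Z N"] by simp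

lemma events_of_subset:
  assumes "Z \<in> F \<rightarrow>\<^sub>M N" "space F = space M"
  shows "events_of M N Z \<subseteq> sets F"
proof -
  have "{Z -` A \<inter> space M |A. A \<in> sets N} \<subseteq> sets F"
    using measurable_sets[OF assms(1)] assms(2) by auto
  then show ?thesis
    unfolding events_of_def sets_vimage_algebra
    using sets.sigma_sets_subset[of _ F] assms(2) by simp
qed

lemma measurable_of_events_of:
  assumes "events_of M N Z \<subseteq> sets F" "space F = space M" "\<And>\<omega>. \<omega> \<in> space M \<Longrightarrow> Z \<omega> \<in> space N"
  shows "Z \<in> F \<rightarrow>\<^sub>M N"
proof (rule measurableI)
  fix A assume "A \<in> sets N"
  then show "Z -` A \<inter> space F \<in> sets F" using events_ofI[of A N Z M] assms by auto
qed (use assms in auto)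

text \<open>Two fresh samples are independent of each other and of everything that the field \<open>F\<close> knows.
  Conditionally on \<open>F\<close>, the product of two centred terms therefore has mean zero.\<close>

lemma (in prob_space) fresh_cross_term:
  fixes \<eta> :: "nat \<Rightarrow> 'a \<Rightarrow> 'b::second_countable_topology" and \<theta> :: "'a \<Rightarrow> 't::topological_space"
    and g :: "'t \<Rightarrow> 'b \<Rightarrow> 'v::euclidean_space" and N :: "'a \<Rightarrow> nat"
  assumes F: "subalgebra M F" and N: "N \<in> F \<rightarrow>\<^sub>M count_space UNIV"
    and \<theta>: "\<theta> \<in> F \<rightarrow>\<^sub>M restrict_space borel \<Theta>"
    and g: "(\<lambda>(t, e). g t e) \<in> borel_measurable (restrict_space borel \<Theta> \<Otimes>\<^sub>M borel)"
    and centred: "\<And>t. t \<in> \<Theta> \<Longrightarrow> integrable D (g t)" "\<And>t. t \<in> \<Theta> \<Longrightarrow> (\<integral>e. g t e \<partial>D) = 0"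
    and fresh: "fresh_samples M F D \<eta>" and pq: "1 \<le> p" "1 \<le> q" "p \<noteq> q"
    and int: "integrable M (\<lambda>\<omega>. of_bool (N \<omega> = n) * inner (g (\<theta> \<omega>) (\<eta> p \<omega>)) (g (\<theta> \<omega>) (\<eta> q \<omega>)))"
  shows "(\<integral>\<omega>. of_bool (N \<omega> = n) * inner (g (\<theta> \<omega>) (\<eta> p \<omega>)) (g (\<theta> \<omega>) (\<eta> q \<omega>)) \<partial>M) = 0"
proof -
  let ?R = "restrict_space borel \<Theta> :: 't measure"
  let ?S = "count_space UNIV \<Otimes>\<^sub>M ?R :: (nat \<times> 't) measure"
  let ?T = "borel \<Otimes>\<^sub>M borel :: ('b \<times> 'b) measure"
  define V where "V \<omega> = (N \<omega>, \<theta> \<omega>)" for \<omega>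
  define Y where "Y \<omega> = (\<eta> p \<omega>, \<eta> q \<omega>)" for \<omega>
  define f where "f z = of_bool (fst (fst z) = n) * inner (g (snd (fst z)) (fst (snd z))) (g (snd (fst z)) (snd (snd z)))"
    for z :: "(nat \<times> 't) \<times> 'b \<times> 'b"
  have F_sets: "sets F \<subseteq> events" and F_space: "space F = space M" using F unfolding subalgebra_def by auto
  have iv: "indep_vars (\<lambda>_. borel) \<eta> {1..}" and law: "\<And>q. 1 \<le> q \<Longrightarrow> distr M borel (\<eta> q) = D"
    and ind: "indep_set (sets F) (sigma_sets (space M) (\<Union>q\<in>{1..}. events_of M borel (\<eta> q)))"
    using fresh unfolding fresh_samples_def by auto
  have \<eta> [measurable]: "random_variable borel (\<eta> q)" if "1 \<le> q" for q
    using iv that unfolding indep_vars_def by auto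
  note [measurable] = \<eta>[OF pq(1)] \<eta>[OF pq(2)]
  have V_F: "V \<in> F \<rightarrow>\<^sub>M ?S" unfolding V_def using N \<theta> by measurable
  have V [measurable]: "V \<in> M \<rightarrow>\<^sub>M ?S" by (rule measurable_from_subalg[OF F V_F])
  have Y [measurable]: "Y \<in> M \<rightarrow>\<^sub>M ?T" unfolding Y_def by measurable
  have g' [measurable]: "(\<lambda>w. g (fst w) (snd w)) \<in> borel_measurable (?R \<Otimes>\<^sub>M borel)"
    using g by (simp add: case_prod_beta')
  have f [measurable]: "f \<in> borel_measurable (?S \<Otimes>\<^sub>M ?T)"
  proof -
    have "(\<lambda>z :: (nat \<times> 't) \<times> 'b \<times> 'b. g (snd (fst z)) (fst (snd z))) \<in> borel_measurable (?S \<Otimes>\<^sub>M ?T)"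
      "(\<lambda>z :: (nat \<times> 't) \<times> 'b \<times> 'b. g (snd (fst z)) (snd (snd z))) \<in> borel_measurable (?S \<Otimes>\<^sub>M ?T)"
      using measurable_compose[OF _ g', of "\<lambda>z. (snd (fst z), fst (snd z))" "?S \<Otimes>\<^sub>M ?T"]
        measurable_compose[OF _ g', of "\<lambda>z. (snd (fst z), snd (snd z))" "?S \<Otimes>\<^sub>M ?T"] by simp_all
    then show ?thesis unfolding f_def by measurable
  qed
  interpret PV: prob_space "distr M ?S V" by (rule prob_space_distr) simp
  interpret PY: prob_space "distr M ?T Y" by (rule prob_space_distr) simp
  have joint: "distr M ?S V \<Otimes>\<^sub>M distr M ?T Y = distr M (?S \<Otimes>\<^sub>M ?T) (\<lambda>\<omega>. (V \<omega>, Y \<omega>))"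
  proof (rule pair_measure_eqI)
    fix A B assume "A \<in> sets (distr M ?S V)" "B \<in> sets (distr M ?T Y)"
    then have A: "A \<in> sets ?S" and B: "B \<in> sets ?T" by auto
    let ?K = "sigma (space M) (\<Union>q\<in>{1..}. events_of M borel (\<eta> q))"
    have Pow: "(\<Union>q\<in>{1..}. events_of M borel (\<eta> q)) \<subseteq> Pow (space M)" using events_of_subset_Pow by blast
    have "\<eta> q \<in> ?K \<rightarrow>\<^sub>M borel" if "1 \<le> q" for q
    proof (rule measurable_of_events_of[where M = M])
      have "events_of M borel (\<eta> q) \<subseteq> (\<Union>q\<in>{1..}. events_of M borel (\<eta> q))" using that by auto
      then show "events_of M borel (\<eta> q) \<subseteq> sets ?K" using Pow by auto
    qed (use Pow in auto)
    then have "Y \<in> ?K \<rightarrow>\<^sub>M ?T" unfolding Y_def using pq by measurable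
    from measurable_sets[OF this B] have "Y -` B \<inter> space M \<in> sets ?K" by (simp add: space_measure_of_conv)
    moreover have "V -` A \<inter> space M \<in> sets F" using measurable_sets[OF V_F A] F_space by simp
    ultimately have "prob ((V -` A \<inter> space M) \<inter> (Y -` B \<inter> space M))
        = prob (V -` A \<inter> space M) * prob (Y -` B \<inter> space M)"
      using ind Pow unfolding indep_sets2_eq by simp
    moreover have "(\<lambda>\<omega>. (V \<omega>, Y \<omega>)) -` (A \<times> B) \<inter> space M = (V -` A \<inter> space M) \<inter> (Y -` B \<inter> space M)"
      by auto
    ultimately show "emeasure (distr M ?S V) A * emeasure (distr M ?T Y) B
        = emeasure (distr M (?S \<Otimes>\<^sub>M ?T) (\<lambda>\<omega>. (V \<omega>, Y \<omega>))) (A \<times> B)"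
      using A B by (simp add: emeasure_distr emeasure_eq_measure ennreal_mult')
  qed (auto intro: PV.sigma_finite_measure_axioms PY.sigma_finite_measure_axioms)
  have "indep_var borel (\<eta> p) borel (\<eta> q)" using indep_var_pair[OF iv] pq by auto
  then have lawY: "distr M ?T Y = D \<Otimes>\<^sub>M D"
    using indep_var_distribution_eq[of borel "\<eta> p" borel "\<eta> q"] law pq unfolding Y_def by simp
  interpret D: prob_space D using law[OF pq(1)] prob_space_distr[OF \<eta>[OF pq(1)]] by simp
  interpret VY: pair_prob_space "distr M ?S V" "distr M ?T Y" ..
  interpret DD: pair_prob_space D D ..
  have int_f: "integrable (distr M ?S V \<Otimes>\<^sub>M distr M ?T Y) f"
  proof -
    have VY: "(\<lambda>\<omega>. (V \<omega>, Y \<omega>)) \<in> M \<rightarrow>\<^sub>M ?S \<Otimes>\<^sub>M ?T" by measurable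
    show ?thesis
      unfolding joint integrable_distr_eq[OF VY f] using int by (simp add: f_def V_def Y_def)
  qed
  have inner_zero: "(\<integral>y. f (v, y) \<partial>distr M ?T Y) = 0"
    if v: "v \<in> space ?S" and iv: "integrable (distr M ?T Y) (\<lambda>y. f (v, y))" for v
  proof -
    have t: "snd v \<in> \<Theta>" using v by (auto simp: space_pair_measure space_restrict_space)
    have "(\<integral>y. f (v, y) \<partial>distr M ?T Y) = (\<integral>a. (\<integral>b. f (v, (a, b)) \<partial>D) \<partial>D)"
      using DD.integral_fst'[of "\<lambda>y. f (v, y)"] iv unfolding lawY by simp
    also have "\<dots> = (\<integral>a. 0 \<partial>D)"
    proof (rule Bochner_Integration.integral_cong[OF refl])
      fix a
      have "(\<integral>b. f (v, (a, b)) \<partial>D) = of_bool (fst v = n) * inner (g (snd v) a) (\<integral>b. g (snd v) b \<partial>D)"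
        unfolding f_def using centred(1)[OF t] by simp
      then show "(\<integral>b. f (v, (a, b)) \<partial>D) = 0" using centred(2)[OF t] by simp
    qed
    finally show ?thesis by simp
  qed
  have "(\<integral>\<omega>. of_bool (N \<omega> = n) * inner (g (\<theta> \<omega>) (\<eta> p \<omega>)) (g (\<theta> \<omega>) (\<eta> q \<omega>)) \<partial>M)
      = (\<integral>\<omega>. f (V \<omega>, Y \<omega>) \<partial>M)" by (simp add: f_def V_def Y_def)
  also have "\<dots> = integral\<^sup>L (distr M ?S V \<Otimes>\<^sub>M distr M ?T Y) f"
    unfolding joint by (rule integral_distr[symmetric]) measurable
  also have "\<dots> = (\<integral>v. (\<integral>y. f (v, y) \<partial>distr M ?T Y) \<partial>distr M ?S V)"
    by (rule VY.integral_fst'[OF int_f, symmetric])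
  also have "\<dots> = (\<integral>v. 0 \<partial>distr M ?S V)"
  proof (rule integral_cong_AE)
    show "AE v in distr M ?S V. (\<integral>y. f (v, y) \<partial>distr M ?T Y) = 0"
      using VY.AE_integrable_fst'[OF int_f] AE_space by eventually_elim (use inner_zero in auto)
    show "(\<lambda>v. \<integral>y. f (v, y) \<partial>distr M ?T Y) \<in> borel_measurable (distr M ?S V)"
      using VY.integrable_fst'[OF int_f] by (rule borel_measurable_integrable)
  qed simp
  finally show ?thesis by simp
qed

text \<open>On the event \<open>N = n\<close> the variances of the \<open>n\<close> centred terms add up, so that their average has
  second moment at most \<open>m\<^sup>2 / n\<close>. The bound on the first moment then follows from
  \<open>2 a \<le> (sqrt n / m) a\<^sup>2 + m / sqrt n\<close>.\<close>

lemma (in prob_space) fresh_average_bound_on_event: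
  fixes \<eta> :: "nat \<Rightarrow> 'a \<Rightarrow> 'b::second_countable_topology" and \<theta> :: "'a \<Rightarrow> 't::topological_space"
    and g :: "'t \<Rightarrow> 'b \<Rightarrow> 'v::euclidean_space" and N :: "'a \<Rightarrow> nat"
  assumes F: "subalgebra M F" and N: "N \<in> F \<rightarrow>\<^sub>M count_space UNIV"
    and \<theta>: "\<theta> \<in> F \<rightarrow>\<^sub>M restrict_space borel \<Theta>"
    and g: "(\<lambda>(t, e). g t e) \<in> borel_measurable (restrict_space borel \<Theta> \<Otimes>\<^sub>M borel)"
    and centred: "\<And>t. t \<in> \<Theta> \<Longrightarrow> integrable D (g t)" "\<And>t. t \<in> \<Theta> \<Longrightarrow> (\<integral>e. g t e \<partial>D) = 0"
    and fresh: "fresh_samples M F D \<eta>" and m: "0 < m"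
    and var: "AE \<omega> in M. \<forall>q\<in>{1..N \<omega>}.
      nn_cond_exp M F (\<lambda>\<omega>. ennreal ((norm (g (\<theta> \<omega>) (\<eta> q \<omega>)))\<^sup>2)) \<omega> \<le> ennreal (m\<^sup>2)"
    and n: "1 \<le> n"
  shows "(\<integral>\<^sup>+\<omega>. indicator {\<omega>\<in>space M. N \<omega> = n} \<omega>
      * ennreal (norm ((1 / real n) *\<^sub>R (\<Sum>q = 1..n. g (\<theta> \<omega>) (\<eta> q \<omega>)))) \<partial>M)
    \<le> ennreal (m / sqrt (real n)) * emeasure M {\<omega>\<in>space M. N \<omega> = n}"
proof -
  interpret sigma_finite_subalgebra M F by (rule sigma_finite_subalgebraI[OF F])
  let ?B = "{\<omega>\<in>space M. N \<omega> = n}"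
  let ?R = "restrict_space borel \<Theta> :: 't measure"
  have F_space: "space F = space M" using F unfolding subalgebra_def by auto
  have iv: "indep_vars (\<lambda>_. borel) \<eta> {1..}" using fresh unfolding fresh_samples_def by auto
  have \<eta>: "random_variable borel (\<eta> q)" if "1 \<le> q" for q
    using iv that unfolding indep_vars_def by auto
  define e where "e q \<omega> = g (\<theta> \<omega>) (\<eta> q \<omega>)" for q \<omega>
  have e [measurable]: "e q \<in> borel_measurable M" if "1 \<le> q" for q
  proof -
    have [measurable]: "\<theta> \<in> M \<rightarrow>\<^sub>M ?R" by (rule measurable_from_subalg[OF F \<theta>])
    have "(\<lambda>\<omega>. (\<theta> \<omega>, \<eta> q \<omega>)) \<in> M \<rightarrow>\<^sub>M ?R \<Otimes>\<^sub>M borel" using \<eta>[OF that] by measurable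
    from measurable_compose[OF this g] show ?thesis by (simp add: e_def[abs_def])
  qed
  have B_F: "?B \<in> sets F"
  proof -
    have "N -` {n} \<inter> space F \<in> sets F" by (rule measurable_sets[OF N]) simp
    moreover have "N -` {n} \<inter> space F = ?B" using F_space by auto
    ultimately show ?thesis by simp
  qed
  then have B [measurable]: "?B \<in> sets M" using F unfolding subalgebra_def by blast
  have N_M [measurable]: "N \<in> M \<rightarrow>\<^sub>M count_space UNIV" by (rule measurable_from_subalg[OF F N])
  define b :: "'a \<Rightarrow> real" where "b \<omega> = of_bool (N \<omega> = n)" for \<omega>
  have b [measurable]: "b \<in> borel_measurable M" unfolding b_def by measurable
  have b_ind: "indicator ?B \<omega> = ennreal (b \<omega>)" if "\<omega> \<in> space M" for \<omega>
    using that by (simp add: b_def indicator_def)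
  have second: "(\<integral>\<^sup>+\<omega>. ennreal (b \<omega> * (norm (e q \<omega>))\<^sup>2) \<partial>M) \<le> ennreal (m\<^sup>2) * emeasure M ?B"
    if q: "q \<in> {1..n}" for q
  proof -
    have [measurable]: "e q \<in> borel_measurable M" using q by auto
    have "(\<integral>\<^sup>+\<omega>. ennreal (b \<omega> * (norm (e q \<omega>))\<^sup>2) \<partial>M)
        = (\<integral>\<^sup>+\<omega>. indicator ?B \<omega> * ennreal ((norm (e q \<omega>))\<^sup>2) \<partial>M)"
      by (intro nn_integral_cong) (simp add: b_ind ennreal_mult' b_def)
    also have "\<dots> = (\<integral>\<^sup>+\<omega>. indicator ?B \<omega> * nn_cond_exp M F (\<lambda>\<omega>. ennreal ((norm (e q \<omega>))\<^sup>2)) \<omega> \<partial>M)"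
      using B_F by (intro nn_cond_exp_intg[symmetric]) auto
    also have "\<dots> \<le> (\<integral>\<^sup>+\<omega>. ennreal (m\<^sup>2) * indicator ?B \<omega> \<partial>M)"
    proof (rule nn_integral_mono_AE)
      show "AE \<omega> in M. indicator ?B \<omega> * nn_cond_exp M F (\<lambda>\<omega>. ennreal ((norm (e q \<omega>))\<^sup>2)) \<omega>
          \<le> ennreal (m\<^sup>2) * indicator ?B \<omega>"
        using var by eventually_elim (use q in \<open>auto simp: e_def indicator_def\<close>)
    qed
    also have "\<dots> = ennreal (m\<^sup>2) * emeasure M ?B" by (rule nn_integral_cmult_indicator[OF B])
    finally show ?thesis .
  qed
  have int_sq: "integrable M (\<lambda>\<omega>. b \<omega> * (norm (e q \<omega>))\<^sup>2)" if q: "q \<in> {1..n}" for q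
  proof (rule integrableI_nonneg)
    have [measurable]: "e q \<in> borel_measurable M" using q by auto
    show "(\<lambda>\<omega>. b \<omega> * (norm (e q \<omega>))\<^sup>2) \<in> borel_measurable M" by measurable
    show "(\<integral>\<^sup>+\<omega>. ennreal (b \<omega> * (norm (e q \<omega>))\<^sup>2) \<partial>M) < \<infinity>"
      using second[OF q] by (rule le_less_trans) (simp add: emeasure_eq_measure ennreal_mult_less_top)
  qed (simp add: b_def)
  have int_cross: "integrable M (\<lambda>\<omega>. b \<omega> * inner (e p \<omega>) (e q \<omega>))"
    if p: "p \<in> {1..n}" and q: "q \<in> {1..n}" for p q
  proof (rule Bochner_Integration.integrable_bound)
    have [measurable]: "e p \<in> borel_measurable M" "e q \<in> borel_measurable M" using p q by auto
    show "integrable M (\<lambda>\<omega>. b \<omega> * (norm (e p \<omega>))\<^sup>2 + b \<omega> * (norm (e q \<omega>))\<^sup>2)"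
      using int_sq p q by simp
    show "(\<lambda>\<omega>. b \<omega> * inner (e p \<omega>) (e q \<omega>)) \<in> borel_measurable M" by measurable
    have "\<bar>inner x y\<bar> \<le> (norm x)\<^sup>2 + (norm y)\<^sup>2" for x y :: 'v
    proof -
      have "\<bar>inner x y\<bar> \<le> norm x * norm y" by (rule Cauchy_Schwarz_ineq2)
      also have "\<dots> \<le> 2 * (norm x * norm y)" by simp
      also have "\<dots> \<le> (norm x)\<^sup>2 + (norm y)\<^sup>2"
        using zero_le_power2[of "norm x - norm y"] by (simp add: power2_diff)
      finally show ?thesis .
    qed
    then show "AE \<omega> in M. norm (b \<omega> * inner (e p \<omega>) (e q \<omega>))
        \<le> norm (b \<omega> * (norm (e p \<omega>))\<^sup>2 + b \<omega> * (norm (e q \<omega>))\<^sup>2)"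
      by (intro AE_I2) (auto simp: b_def)
  qed
  define s where "s \<omega> = (\<Sum>q = 1..n. e q \<omega>)" for \<omega>
  have s [measurable]: "s \<in> borel_measurable M" unfolding s_def by measurable
  have expand: "b \<omega> * (norm (s \<omega>))\<^sup>2 = (\<Sum>p = 1..n. \<Sum>q = 1..n. b \<omega> * inner (e p \<omega>) (e q \<omega>))" for \<omega>
    unfolding s_def power2_norm_eq_inner by (simp add: inner_sum_left inner_sum_right sum_distrib_left) (rule sum.swap)
  have int_s: "integrable M (\<lambda>\<omega>. b \<omega> * (norm (s \<omega>))\<^sup>2)"
    unfolding expand using int_cross by (intro Bochner_Integration.integrable_sum) auto
  define P where "P = prob ?B"
  have sq_le: "(\<integral>\<omega>. b \<omega> * (norm (e q \<omega>))\<^sup>2 \<partial>M) \<le> m\<^sup>2 * P" if q: "q \<in> {1..n}" for q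
  proof -
    have "ennreal (\<integral>\<omega>. b \<omega> * (norm (e q \<omega>))\<^sup>2 \<partial>M) = (\<integral>\<^sup>+\<omega>. ennreal (b \<omega> * (norm (e q \<omega>))\<^sup>2) \<partial>M)"
      by (rule nn_integral_eq_integral[symmetric, OF int_sq[OF q]]) (simp add: b_def)
    also have "\<dots> \<le> ennreal (m\<^sup>2 * P)"
      using second[OF q] by (simp add: emeasure_eq_measure P_def ennreal_mult')
    finally show ?thesis by (subst (asm) ennreal_le_iff) (auto simp: P_def)
  qed
  have "(\<integral>\<omega>. b \<omega> * (norm (s \<omega>))\<^sup>2 \<partial>M)
      = (\<Sum>p = 1..n. \<Sum>q = 1..n. \<integral>\<omega>. b \<omega> * inner (e p \<omega>) (e q \<omega>) \<partial>M)"
    unfolding expand using int_cross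
    by (subst Bochner_Integration.integral_sum, (intro Bochner_Integration.integrable_sum; simp),
        intro sum.cong refl Bochner_Integration.integral_sum) auto
  also have "\<dots> = (\<Sum>p = 1..n. \<Sum>q = 1..n. if q = p then (\<integral>\<omega>. b \<omega> * (norm (e p \<omega>))\<^sup>2 \<partial>M) else 0)"
  proof (intro sum.cong refl)
    fix p q assume p: "p \<in> {1..n}" and q: "q \<in> {1..n}"
    show "(\<integral>\<omega>. b \<omega> * inner (e p \<omega>) (e q \<omega>) \<partial>M)
        = (if q = p then (\<integral>\<omega>. b \<omega> * (norm (e p \<omega>))\<^sup>2 \<partial>M) else 0)"
    proof (cases "q = p")
      case False
      then show ?thesis
        using fresh_cross_term[OF F N \<theta> g centred fresh _ _ _ int_cross[OF p q, unfolded b_def e_def]] p q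
        unfolding b_def e_def by auto
    qed (simp add: power2_norm_eq_inner)
  qed
  also have "\<dots> = (\<Sum>p = 1..n. \<integral>\<omega>. b \<omega> * (norm (e p \<omega>))\<^sup>2 \<partial>M)" by simp
  also have "\<dots> \<le> (\<Sum>p = 1..n. m\<^sup>2 * P)" by (intro sum_mono sq_le)
  finally have second_s: "(\<integral>\<omega>. b \<omega> * (norm (s \<omega>))\<^sup>2 \<partial>M) \<le> real n * (m\<^sup>2 * P)" by simp
  have pointwise: "norm ((1 / real n) *\<^sub>R x) \<le> (norm x)\<^sup>2 / (2 * m * (real n * sqrt (real n))) + m / (2 * sqrt (real n))"
    for x :: 'v
  proof -
    define r where "r = sqrt (real n)"
    have r: "0 < r" "real n = r\<^sup>2" unfolding r_def using n by auto
    have "2 * norm x * (m * r) \<le> (norm x)\<^sup>2 + (m * r)\<^sup>2"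
      using zero_le_power2[of "norm x - m * r"] by (simp add: power2_diff)
    then have "norm x / r\<^sup>2 \<le> (norm x)\<^sup>2 / (2 * m * (r\<^sup>2 * r)) + m / (2 * r)"
      using m r(1) by (simp add: field_simps power2_eq_square)
    then show ?thesis using r unfolding r_def[symmetric] by simp
  qed
  let ?c = "1 / (2 * m * (real n * sqrt (real n)))" and ?d = "m / (2 * sqrt (real n))"
  have int_b: "integrable M b"
    by (rule integrable_const_bound[of _ 1]) (auto simp: b_def)
  have P_eq: "(\<integral>\<omega>. b \<omega> \<partial>M) = P"
  proof -
    have "(\<integral>\<omega>. b \<omega> \<partial>M) = (\<integral>\<omega>. indicator ?B \<omega> \<partial>M)"
      by (intro Bochner_Integration.integral_cong) (auto simp: b_def)
    then show ?thesis unfolding P_def by simp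
  qed
  have "(\<integral>\<^sup>+\<omega>. indicator ?B \<omega> * ennreal (norm ((1 / real n) *\<^sub>R s \<omega>)) \<partial>M)
      \<le> (\<integral>\<^sup>+\<omega>. ennreal (?c * (b \<omega> * (norm (s \<omega>))\<^sup>2) + ?d * b \<omega>) \<partial>M)"
  proof (rule nn_integral_mono)
    fix \<omega> assume \<omega>: "\<omega> \<in> space M"
    have "b \<omega> * norm ((1 / real n) *\<^sub>R s \<omega>) \<le> b \<omega> * (?c * (norm (s \<omega>))\<^sup>2 + ?d)"
      using pointwise[of "s \<omega>"] by (intro mult_left_mono) (auto simp: b_def)
    then have "b \<omega> * norm ((1 / real n) *\<^sub>R s \<omega>) \<le> ?c * (b \<omega> * (norm (s \<omega>))\<^sup>2) + ?d * b \<omega>"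
      by (simp only: distrib_left ac_simps)
    then have "ennreal (b \<omega> * norm ((1 / real n) *\<^sub>R s \<omega>)) \<le> ennreal (?c * (b \<omega> * (norm (s \<omega>))\<^sup>2) + ?d * b \<omega>)"
      by (rule ennreal_leI)
    moreover have "indicator ?B \<omega> * ennreal (norm ((1 / real n) *\<^sub>R s \<omega>))
        = ennreal (b \<omega> * norm ((1 / real n) *\<^sub>R s \<omega>))"
      using \<omega> by (cases "N \<omega> = n") (simp_all add: b_def)
    ultimately show "indicator ?B \<omega> * ennreal (norm ((1 / real n) *\<^sub>R s \<omega>))
        \<le> ennreal (?c * (b \<omega> * (norm (s \<omega>))\<^sup>2) + ?d * b \<omega>)"
      by simp
  qed
  also have "\<dots> = ennreal (\<integral>\<omega>. ?c * (b \<omega> * (norm (s \<omega>))\<^sup>2) + ?d * b \<omega> \<partial>M)"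
  proof (rule nn_integral_eq_integral)
    show "integrable M (\<lambda>\<omega>. ?c * (b \<omega> * (norm (s \<omega>))\<^sup>2) + ?d * b \<omega>)"
      using int_s int_b by simp
  qed (use m in \<open>simp add: b_def\<close>)
  also have "(\<integral>\<omega>. ?c * (b \<omega> * (norm (s \<omega>))\<^sup>2) + ?d * b \<omega> \<partial>M)
      = ?c * (\<integral>\<omega>. b \<omega> * (norm (s \<omega>))\<^sup>2 \<partial>M) + ?d * P"
    using int_s int_b P_eq by simp
  also have "\<dots> \<le> ?c * (real n * (m\<^sup>2 * P)) + ?d * P"
    using second_s m n by (intro add_right_mono mult_left_mono) auto
  also have "\<dots> = m / sqrt (real n) * P"
    using m n by (simp add: field_simps power2_eq_square)
  also have "ennreal (m / sqrt (real n) * P) = ennreal (m / sqrt (real n)) * emeasure M ?B"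
    using m by (subst ennreal_mult) (auto simp: emeasure_eq_measure P_def)
  finally show ?thesis unfolding s_def e_def by (simp add: ennreal_leI)
qed

text \<open>The batch size is random but known to \<open>F\<close>, so that the bound is summed over its values.\<close>

lemma (in prob_space) fresh_average_bound:
  fixes \<eta> :: "nat \<Rightarrow> 'a \<Rightarrow> 'b::second_countable_topology" and \<theta> :: "'a \<Rightarrow> 't::topological_space"
    and g :: "'t \<Rightarrow> 'b \<Rightarrow> 'v::euclidean_space" and N :: "'a \<Rightarrow> nat"
  assumes F: "subalgebra M F" and N: "N \<in> F \<rightarrow>\<^sub>M count_space UNIV"
    and \<theta>: "\<theta> \<in> F \<rightarrow>\<^sub>M restrict_space borel \<Theta>"
    and g: "(\<lambda>(t, e). g t e) \<in> borel_measurable (restrict_space borel \<Theta> \<Otimes>\<^sub>M borel)"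
    and centred: "\<And>t. t \<in> \<Theta> \<Longrightarrow> integrable D (g t)" "\<And>t. t \<in> \<Theta> \<Longrightarrow> (\<integral>e. g t e \<partial>D) = 0"
    and fresh: "fresh_samples M F D \<eta>" and m: "0 < m"
    and var: "AE \<omega> in M. \<forall>q\<in>{1..N \<omega>}.
      nn_cond_exp M F (\<lambda>\<omega>. ennreal ((norm (g (\<theta> \<omega>) (\<eta> q \<omega>)))\<^sup>2)) \<omega> \<le> ennreal (m\<^sup>2)"
    and N1: "\<And>\<omega>. \<omega> \<in> space M \<Longrightarrow> 1 \<le> N \<omega>"
  defines "z \<equiv> \<lambda>\<omega>. norm ((1 / real (N \<omega>)) *\<^sub>R (\<Sum>q = 1..N \<omega>. g (\<theta> \<omega>) (\<eta> q \<omega>)))"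
  shows "z \<in> borel_measurable M"
    and "(\<integral>\<^sup>+\<omega>. ennreal (z \<omega>) \<partial>M) \<le> (\<integral>\<^sup>+\<omega>. ennreal (m / sqrt (real (N \<omega>))) \<partial>M)"
proof -
  have iv: "indep_vars (\<lambda>_. borel) \<eta> {1..}" using fresh unfolding fresh_samples_def by auto
  have \<eta>: "random_variable borel (\<eta> q)" if "1 \<le> q" for q
    using iv that unfolding indep_vars_def by auto
  have N_M [measurable]: "N \<in> M \<rightarrow>\<^sub>M count_space UNIV" by (rule measurable_from_subalg[OF F N])
  have e: "(\<lambda>\<omega>. g (\<theta> \<omega>) (\<eta> q \<omega>)) \<in> borel_measurable M" if "1 \<le> q" for q
  proof -
    have [measurable]: "\<theta> \<in> M \<rightarrow>\<^sub>M restrict_space borel \<Theta>" by (rule measurable_from_subalg[OF F \<theta>])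
    have "(\<lambda>\<omega>. (\<theta> \<omega>, \<eta> q \<omega>)) \<in> M \<rightarrow>\<^sub>M restrict_space borel \<Theta> \<Otimes>\<^sub>M borel" using \<eta>[OF that] by measurable
    from measurable_compose[OF this g] show ?thesis by simp
  qed
  define zn where "zn n \<omega> = norm ((1 / real n) *\<^sub>R (\<Sum>q = 1..n. g (\<theta> \<omega>) (\<eta> q \<omega>)))" for n \<omega>
  have zn [measurable]: "zn n \<in> borel_measurable M" for n
  proof -
    have [measurable]: "(\<lambda>\<omega>. \<Sum>q = 1..n. g (\<theta> \<omega>) (\<eta> q \<omega>)) \<in> borel_measurable M"
      using e by (intro borel_measurable_sum) auto
    show ?thesis unfolding zn_def by measurable
  qed
  have z_zn: "z \<omega> = zn (N \<omega>) \<omega>" for \<omega> unfolding z_def zn_def by simp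
  show "z \<in> borel_measurable M"
    unfolding z_zn[abs_def] by (rule measurable_compose_countable[OF zn N_M])
  let ?B = "\<lambda>n. {\<omega>\<in>space M. N \<omega> = n}"
  have disj: "disjoint_family ?B" by (auto simp: disjoint_family_on_def)
  have split: "h (N \<omega>) = (\<Sum>n. h n * indicator (?B n) \<omega>)" if "\<omega> \<in> space M" for h :: "nat \<Rightarrow> ennreal" and \<omega>
    using suminf_cmult_indicator[OF disj, of \<omega> "N \<omega>" h] that by simp
  have "(\<integral>\<^sup>+\<omega>. ennreal (z \<omega>) \<partial>M) = (\<integral>\<^sup>+\<omega>. (\<Sum>n. ennreal (zn n \<omega>) * indicator (?B n) \<omega>) \<partial>M)"
    by (intro nn_integral_cong) (metis z_zn split)
  also have "\<dots> = (\<Sum>n. \<integral>\<^sup>+\<omega>. ennreal (zn n \<omega>) * indicator (?B n) \<omega> \<partial>M)"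
    by (intro nn_integral_suminf) measurable
  also have "\<dots> \<le> (\<Sum>n. \<integral>\<^sup>+\<omega>. ennreal (m / sqrt (real n)) * indicator (?B n) \<omega> \<partial>M)"
  proof (rule suminf_le)
    fix n
    show "(\<integral>\<^sup>+\<omega>. ennreal (zn n \<omega>) * indicator (?B n) \<omega> \<partial>M)
        \<le> (\<integral>\<^sup>+\<omega>. ennreal (m / sqrt (real n)) * indicator (?B n) \<omega> \<partial>M)"
    proof (cases "1 \<le> n")
      case True
      have "?B n \<in> sets M" by measurable
      then show ?thesis
        using fresh_average_bound_on_event[OF F N \<theta> g centred fresh m var True]
        unfolding zn_def by (simp add: nn_integral_cmult_indicator mult.commute)
    next
      case False
      then have "?B n = {}" using N1 by fastforce
      then show ?thesis by simp
    qed
  qed auto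
  also have "\<dots> = (\<integral>\<^sup>+\<omega>. (\<Sum>n. ennreal (m / sqrt (real n)) * indicator (?B n) \<omega>) \<partial>M)"
    by (intro nn_integral_suminf[symmetric]) measurable
  also have "\<dots> = (\<integral>\<^sup>+\<omega>. ennreal (m / sqrt (real (N \<omega>))) \<partial>M)"
    by (intro nn_integral_cong) (rule split[of _ "\<lambda>n. ennreal (m / sqrt (real n))", symmetric])
  finally show "(\<integral>\<^sup>+\<omega>. ennreal (z \<omega>) \<partial>M) \<le> (\<integral>\<^sup>+\<omega>. ennreal (m / sqrt (real (N \<omega>))) \<partial>M)" .
qed

section \<open>The fields of information\<close>

lemma space_sigma_eq [simp]: "space (sigma \<Omega> A) = \<Omega>"
  by (rule space_measure_of_conv)

lemma space_Fpre [simp]: "space (Fpre M sc k) = space M"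
  and space_Fk [simp]: "space (Fk M sc k) = space M"
  and space_past [simp]: "space (past M sc k) = space M"
  unfolding Fpre_def Fk_def past_def by simp_all

lemma sets_sigma_superset: "A \<subseteq> B \<Longrightarrow> B \<subseteq> Pow \<Omega> \<Longrightarrow> A \<subseteq> sets (sigma \<Omega> B)"
  by (subst sets_measure_of) (auto intro: sigma_sets.Basic)

lemma sets_sigma_mono:
  assumes "A \<subseteq> B" "B \<subseteq> Pow \<Omega>"
  shows "sets (sigma \<Omega> A) \<subseteq> sets (sigma \<Omega> B)"
  unfolding sets_measure_of[OF assms(2)] sets_measure_of[OF order_trans[OF assms]]
  by (rule sigma_sets_mono'[OF assms(1)])

lemma sets_sigma_le:
  assumes "A \<subseteq> sets F" "space F = \<Omega>"
  shows "sets (sigma \<Omega> A) \<subseteq> sets F"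
proof -
  have "A \<subseteq> Pow \<Omega>" using assms sets.space_closed[of F] by auto
  then show ?thesis using sets.sigma_sets_subset[OF assms(1)] assms(2) by simp
qed

definition Fpre_generators ::
  "'w measure \<Rightarrow> ('w, 'n, 'c::finite, 'm::finite, 'd::finite, 'p::finite) scheme \<Rightarrow> nat \<Rightarrow> 'w set set" where
  "Fpre_generators M sc k = events_of M borel (xs sc 0) \<union>
      (\<Union>l<k. events_of M (count_space UNIV) (sel sc l) \<union>
             (\<Union>q. events_of M borel (\<lambda>\<omega>. xi_vec sc (sel sc l \<omega>) l q \<omega>)) \<union>
             (\<Union>q. events_of M borel (\<lambda>\<omega>. eta_vec sc (sel sc l \<omega>) l q \<omega>)) \<union>
             (\<Union>j. events_of M (count_space UNIV) (\<lambda>\<omega>. delay sc (sel sc l \<omega>) j l \<omega>)))"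

lemma Fpre_eq: "Fpre M sc k = sigma (space M) (Fpre_generators M sc k)"
  unfolding Fpre_def Fpre_generators_def ..

lemma Fpre_generators_Pow: "Fpre_generators M sc k \<subseteq> Pow (space M)"
  unfolding Fpre_generators_def by (intro Un_least UN_least events_of_subset_Pow)

lemma Fk_generators_Pow:
  "sets (Fpre M sc k) \<union> (\<Union>i j. events_of M (count_space UNIV) (delay sc i j k)) \<subseteq> Pow (space M)"
  using sets.space_closed[of "Fpre M sc k"] by (intro Un_least UN_least events_of_subset_Pow) simp

lemma past_generators_Pow: "(\<Union>l\<le>k. sets (Fk M sc l)) \<subseteq> Pow (space M)"
  using sets.space_closed[of "Fk M sc _"] by (intro UN_least) simp

lemma Fpre_mono:
  assumes "k \<le> l"
  shows "sets (Fpre M sc k) \<subseteq> sets (Fpre M sc l)"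
  unfolding Fpre_eq
proof (rule sets_sigma_mono[OF _ Fpre_generators_Pow])
  show "Fpre_generators M sc k \<subseteq> Fpre_generators M sc l"
    unfolding Fpre_generators_def using assms by (intro Un_mono order_refl UN_mono) auto
qed

lemma Fpre_measurable:
  assumes "l < k"
  shows "sel sc l \<in> Fpre M sc k \<rightarrow>\<^sub>M count_space UNIV"
    and "(\<lambda>\<omega>. delay sc (sel sc l \<omega>) j l \<omega>) \<in> Fpre M sc k \<rightarrow>\<^sub>M count_space UNIV"
proof -
  have "events_of M (count_space UNIV) (sel sc l) \<subseteq> Fpre_generators M sc k"
    "events_of M (count_space UNIV) (\<lambda>\<omega>. delay sc (sel sc l \<omega>) j l \<omega>) \<subseteq> Fpre_generators M sc k"
    unfolding Fpre_generators_def using assms by blast+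
  from this[THEN sets_sigma_superset[OF _ Fpre_generators_Pow]]
  show "sel sc l \<in> Fpre M sc k \<rightarrow>\<^sub>M count_space UNIV"
    and "(\<lambda>\<omega>. delay sc (sel sc l \<omega>) j l \<omega>) \<in> Fpre M sc k \<rightarrow>\<^sub>M count_space UNIV"
    unfolding Fpre_eq by (auto intro: measurable_of_events_of[where M = M])
qed

lemma Fpre_le_Fk: "sets (Fpre M sc k) \<subseteq> sets (Fk M sc k)"
  unfolding Fk_def by (rule sets_sigma_superset[OF _ Fk_generators_Pow]) simp

lemma Fk_delay_measurable: "delay sc i j k \<in> Fk M sc k \<rightarrow>\<^sub>M count_space UNIV"
proof (rule measurable_of_events_of[where M = M])
  show "events_of M (count_space UNIV) (delay sc i j k) \<subseteq> sets (Fk M sc k)"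
    unfolding Fk_def by (rule sets_sigma_superset[OF _ Fk_generators_Pow]) blast
qed auto

lemma Fk_le_past: "l \<le> k \<Longrightarrow> sets (Fk M sc l) \<subseteq> sets (past M sc k)"
  unfolding past_def by (rule sets_sigma_superset[OF _ past_generators_Pow]) blast

lemma measurable_mono_sets:
  assumes "f \<in> F \<rightarrow>\<^sub>M N" "sets F \<subseteq> sets G" "space F = space G"
  shows "f \<in> G \<rightarrow>\<^sub>M N"
  using assms unfolding measurable_def by auto

section \<open>The asynchronous scheme\<close>

locale asynchronous_game = misspecified_game gm Lx \<mu>g Lg \<mu> + prob_space M
  for gm :: "('n::finite, 'c::finite, 'm::finite, 'd::finite, 'p::finite) game"
    and Lx \<mu>g Lg \<mu> :: real and M :: "'w measure" +
  fixes sc :: "('w, 'n, 'c, 'm, 'd, 'p) scheme" and prb :: "'n \<Rightarrow> real" and \<delta> :: real and \<tau> :: nat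
  assumes scheme: "async_scheme M gm \<mu> Lg prb sc"
    and B2: "assm_B2 gm" and B3: "assm_B3 M gm sc \<tau>"
    and mu_large: "Lx / 2 + sqrt 3 * Lx * real \<tau> < \<mu>" and delta_pos: "0 < \<delta>"
    and batch: "\<And>i k \<omega>. \<omega> \<in> space M \<Longrightarrow>
      eta_num sc i k \<omega> = nat \<lfloor>real (update_count sc i k \<omega>) powr (2 * (1 + \<delta>))\<rfloor>"
begin

abbreviation "\<F> \<equiv> Fk M sc"

lemma
  shows prb_pos: "0 < prb i"
    and sel_measurable [measurable]: "sel sc k \<in> M \<rightarrow>\<^sub>M count_space UNIV"
    and prob_sel: "prob {\<omega> \<in> space M. sel sc k \<omega> = i} = prb i"
    and xs_0_measurable: "xs sc 0 \<in> borel_measurable M"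
    and delay_measurable [measurable]: "delay sc i j k \<in> M \<rightarrow>\<^sub>M count_space UNIV"
    and xi_num_measurable: "xi_num sc i k \<in> \<F> k \<rightarrow>\<^sub>M count_space UNIV"
    and eta_num_measurable: "eta_num sc i k \<in> \<F> k \<rightarrow>\<^sub>M count_space UNIV"
    and xi_fresh: "fresh_samples M (past M sc k) (xi_law gm) (xi_samp sc i k)"
    and eta_fresh: "fresh_samples M (past M sc k) (eta_law gm) (eta_samp sc i k)"
    and xs_measurable: "xs sc k \<in> borel_measurable (Fpre M sc k)"
    and ths_measurable: "ths sc i k \<in> borel_measurable (Fpre M sc k)"
    and eps_measurable: "eps sc i (Suc k) \<in> borel_measurable
        (sigma (space M) (sets (\<F> k) \<union> (\<Union>q. events_of M borel (xi_vec sc i k q))))"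
  using scheme unfolding async_scheme_def by auto

lemma
  assumes "\<omega> \<in> space M"
  shows delay_self: "delay sc i i k \<omega> = 0"
    and xs_mem: "xs sc k \<omega> \<in> X" and ths_mem: "ths sc i k \<omega> \<in> Theta gm"
    and selected_update: "block own (sel sc k \<omega>) (xs sc (Suc k) \<omega>)
        = T (sel sc k \<omega>) (delayed gm sc (sel sc k \<omega>) k \<omega>) (ths sc (sel sc k \<omega>) k \<omega>)
          + eps sc (sel sc k \<omega>) (Suc k) \<omega>"
    and unselected_xs: "sel sc k \<omega> \<noteq> i \<Longrightarrow> block own i (xs sc (Suc k) \<omega>) = block own i (xs sc k \<omega>)"
    and selected_ths: "sel sc k \<omega> = i \<Longrightarrow> ths sc i (Suc k) \<omega> = closest_point (Theta gm)
        (ths sc i k \<omega> - ((1 / Lg) / real (eta_num sc i k \<omega>)) *\<^sub>R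
           (\<Sum>q = 1..eta_num sc i k \<omega>. sampled_grad gm sc i k q \<omega>))"
    and unselected_ths: "sel sc k \<omega> \<noteq> i \<Longrightarrow> ths sc i (Suc k) \<omega> = ths sc i k \<omega>"
  using scheme assms unfolding async_scheme_def by auto

lemma delay_le: "\<omega> \<in> space M \<Longrightarrow> delay sc i j k \<omega> \<le> \<tau>"
  using B3 unfolding assm_B3_def by blast

lemma xi_samp_measurable: "1 \<le> q \<Longrightarrow> random_variable borel (xi_samp sc i k q)"
  using xi_fresh[of k i] unfolding fresh_samples_def indep_vars_def by auto

lemma eta_samp_measurable: "1 \<le> q \<Longrightarrow> random_variable borel (eta_samp sc i k q)"
  using eta_fresh[of k i] unfolding fresh_samples_def indep_vars_def by auto

lemma padded_sample_measurable:
  fixes N :: "'b \<Rightarrow> nat"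
  assumes "N \<in> F \<rightarrow>\<^sub>M count_space UNIV" "\<And>q. 1 \<le> q \<Longrightarrow> Z q \<in> borel_measurable F"
  shows "(\<lambda>\<omega>. if q \<in> {1..N \<omega>} then Z q \<omega> else 0 :: real^'e) \<in> borel_measurable F"
proof (rule measurable_compose_countable[OF _ assms(1), of "\<lambda>n \<omega>. if q \<in> {1..n} then Z q \<omega> else 0"])
  show "(\<lambda>\<omega>. if q \<in> {1..n} then Z q \<omega> else 0) \<in> borel_measurable F" for n
    using assms(2) by (cases "q \<in> {1..n}") auto
qed

text \<open>The sample vectors of time \<open>l\<close> are padded according to numbers that are measurable with respect to
  \<open>F_l\<close>. That they are random variables is thus known only once \<open>F_l\<close> is a field of events, whence the
  induction over time.\<close>

lemma Fk_subalgebra: "subalgebra M (\<F> k)"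
proof (induction k rule: less_induct)
  case (less k)
  have selected: "(\<lambda>\<omega>. f (sel sc l \<omega>) \<omega>) \<in> M \<rightarrow>\<^sub>M N" if "\<And>i. f i \<in> M \<rightarrow>\<^sub>M N" for f N l
    by (rule measurable_compose_countable[OF that]) auto
  have vec: "xi_vec sc i l q \<in> borel_measurable M" "eta_vec sc i l q \<in> borel_measurable M" if "l < k" for i l q
    unfolding xi_vec_def[abs_def] eta_vec_def[abs_def]
    by (intro padded_sample_measurable measurable_from_subalg[OF less[OF that]] xi_num_measurable
        eta_num_measurable xi_samp_measurable eta_samp_measurable; assumption)+
  have "Fpre_generators M sc k \<subseteq> sets M"
    unfolding Fpre_generators_def
    by (intro Un_least UN_least events_of_subset xs_0_measurable sel_measurable
        selected[of "\<lambda>i. xi_vec sc i _ _"] selected[of "\<lambda>i. eta_vec sc i _ _"]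
        selected[of "\<lambda>i. delay sc i _ _"] vec delay_measurable) auto
  then have "sets (Fpre M sc k) \<subseteq> sets M" unfolding Fpre_eq by (rule sets_sigma_le) simp
  then have "sets (Fpre M sc k) \<union> (\<Union>i j. events_of M (count_space UNIV) (delay sc i j k)) \<subseteq> sets M"
    by (intro Un_least UN_least events_of_subset) auto
  then have "sets (\<F> k) \<subseteq> sets M"
    unfolding Fk_def by (rule sets_sigma_le) simp
  then show ?case by (simp add: subalgebra_def)
qed

lemma past_subalgebra: "subalgebra M (past M sc k)"
proof -
  have "(\<Union>l\<le>k. sets (\<F> l)) \<subseteq> sets M" using Fk_subalgebra unfolding subalgebra_def by blast
  then have "sets (past M sc k) \<subseteq> sets M"
    unfolding past_def by (rule sets_sigma_le) simp
  then show ?thesis by (simp add: subalgebra_def)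
qed

lemma Fpre_to_Fk:
  assumes "f \<in> Fpre M sc l \<rightarrow>\<^sub>M N" "l \<le> k"
  shows "f \<in> \<F> k \<rightarrow>\<^sub>M N"
  by (rule measurable_mono_sets[OF assms(1)]) (use Fpre_mono[OF assms(2)] Fpre_le_Fk in fastforce)+

lemma Fpre_Suc:
  assumes "f \<in> Fpre M sc l \<rightarrow>\<^sub>M N" "l \<le> k"
  shows "f \<in> Fpre M sc k \<rightarrow>\<^sub>M N"
  by (rule measurable_mono_sets[OF assms(1) Fpre_mono[OF assms(2)]]) simp

section \<open>Thinning by the selection of the players\<close>

lemma selected_set: "{\<omega>\<in>space M. sel sc k \<omega> = i} \<in> sets M"
  by measurable

lemma selection_independent:
  assumes "A \<in> sets (\<F> (Suc k))"
  shows "prob (A \<inter> {\<omega>\<in>space M. sel sc (Suc k) \<omega> = i}) = prb i * prob A"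
proof -
  let ?S = "{\<omega>\<in>space M. sel sc (Suc k) \<omega> = i}"
  have "indep_set (events_of M (count_space UNIV) (sel sc (Suc k))) (sets (\<F> (Suc k)))"
    using B3 unfolding assm_B3_def by simp
  moreover have "?S = sel sc (Suc k) -` {i} \<inter> space M" by auto
  then have "?S \<in> events_of M (count_space UNIV) (sel sc (Suc k))"
    using events_ofI[of "{i}" "count_space UNIV" "sel sc (Suc k)" M] by simp
  ultimately have "prob (?S \<inter> A) = prob ?S * prob A"
    using assms unfolding indep_sets2_eq by blast
  then show ?thesis using prob_sel by (simp add: Int_commute)
qed

text \<open>Independence of the selection is available from time one on, whence the shift by one. The sums
  over the past only involve terms at times when player \<open>i\<close> was selected; they are known to
  \<open>F'\<close> although \<open>W\<close> itself may involve delays that \<open>F'\<close> does not record.\<close>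

lemma summable_of_summable_selected:
  fixes W :: "nat \<Rightarrow> 'w \<Rightarrow> real"
  assumes W: "\<And>k. W k \<in> borel_measurable (\<F> k)" "\<And>k \<omega>. 0 \<le> W k \<omega>"
    and past: "\<And>k. (\<lambda>\<omega>. W k \<omega> * of_bool (sel sc k \<omega> = i)) \<in> borel_measurable (Fpre M sc (Suc k))"
    and bdd: "AE \<omega> in M. bdd_above (range (\<lambda>k. W k \<omega>))"
    and sum: "AE \<omega> in M. summable (\<lambda>k. W k \<omega> * of_bool (sel sc k \<omega> = i))"
  shows "AE \<omega> in M. summable (\<lambda>k. W k \<omega>)"
proof -
  let ?S = "\<lambda>k. {\<omega>\<in>space M. sel sc (Suc k) \<omega> = i}"
  have "AE \<omega> in M. summable (\<lambda>k. W (Suc k) \<omega>)"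
  proof (rule summable_of_summable_thinned[of "\<lambda>k. \<F> (Suc k)" ?S "prb i"])
    show "(\<lambda>\<omega>. \<Sum>l<k. W (Suc l) \<omega> * indicator (?S l) \<omega>) \<in> borel_measurable (\<F> (Suc k))" for k
    proof (rule borel_measurable_sum)
      fix l assume "l \<in> {..<k}"
      then have "(\<lambda>\<omega>. W (Suc l) \<omega> * of_bool (sel sc (Suc l) \<omega> = i)) \<in> borel_measurable (\<F> (Suc k))"
        by (intro Fpre_to_Fk[OF past]) auto
      then show "(\<lambda>\<omega>. W (Suc l) \<omega> * indicator (?S l) \<omega>) \<in> borel_measurable (\<F> (Suc k))"
        by (subst measurable_cong[where g = "\<lambda>\<omega>. W (Suc l) \<omega> * of_bool (sel sc (Suc l) \<omega> = i)"])
          (auto simp: indicator_def)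
    qed
    show "AE \<omega> in M. bdd_above (range (\<lambda>k. W (Suc k) \<omega>))"
      using bdd by eventually_elim (auto simp: bdd_above_def)
    show "AE \<omega> in M. summable (\<lambda>k. W (Suc k) \<omega> * indicator (?S k) \<omega>)"
      using sum AE_space
    proof eventually_elim
      case (elim \<omega>)
      then have "summable (\<lambda>k. W (Suc k) \<omega> * of_bool (sel sc (Suc k) \<omega> = i))"
        using summable_Suc_iff[of "\<lambda>k. W k \<omega> * of_bool (sel sc k \<omega> = i)"] by simp
      moreover have "indicator (?S k) \<omega> = (of_bool (sel sc (Suc k) \<omega> = i) :: real)" for k
        using elim by (simp add: indicator_def)
      ultimately show ?case by simp
    qed
  qed (use Fk_subalgebra selected_set selection_independent prb_pos W in auto)
  then show ?thesis by eventually_elim (rule summable_Suc_iff[THEN iffD1])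
qed

section \<open>Learning the parameter\<close>

definition gnoise :: "real^'m \<Rightarrow> real^'p \<Rightarrow> real^'m" where
  "gnoise t e = grad (\<lambda>t. gsample gm t e) t - grad (gmean gm) t"

definition avg_noise :: "'n \<Rightarrow> nat \<Rightarrow> 'w \<Rightarrow> real" where
  "avg_noise i k \<omega> = norm ((1 / real (eta_num sc i k \<omega>)) *\<^sub>R
     (\<Sum>q = 1..eta_num sc i k \<omega>. gnoise (ths sc i k \<omega>) (eta_samp sc i k q \<omega>)))"

lemma Lg_pos: "0 < Lg" and mug_pos: "0 < \<mu>g"
  and gmean_strongly_convex: "strongly_convex_on \<mu>g (Theta gm) (gmean gm)"
  and gmean_gradient_lipschitz: "Lg-lipschitz_on (Theta gm) (grad (gmean gm))"
  using B1 unfolding assm_B1_def by blast+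

lemma gmean_GDERIV: "\<theta> \<in> Theta gm \<Longrightarrow> GDERIV (gmean gm) \<theta> :> grad (gmean gm) \<theta>"
  using B1 differentiable_imp_GDERIV_grad unfolding assm_B1_def C1_on_def by blast

text \<open>The factor \<open>2\<close> absorbs the rounding of the batch size to an integer.\<close>

lemma batch_size:
  assumes "\<omega> \<in> space M"
  shows "1 \<le> eta_num sc i k \<omega>"
    and "1 / sqrt (real (eta_num sc i k \<omega>)) \<le> 2 * real (update_count sc i k \<omega>) powr - (1 + \<delta>)"
proof -
  define r where "r = real (update_count sc i k \<omega>) powr (1 + \<delta>)"
  have c1: "1 \<le> real (update_count sc i k \<omega>)" unfolding update_count_def by simp
  then have r: "1 \<le> r" unfolding r_def using delta_pos by (intro ge_one_powr_ge_zero) auto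
  have "real (update_count sc i k \<omega>) powr (2 * (1 + \<delta>)) = r\<^sup>2"
    unfolding r_def power2_eq_square powr_add[symmetric] by simp
  then have N: "eta_num sc i k \<omega> = nat \<lfloor>r\<^sup>2\<rfloor>" using batch[OF assms] by simp
  have "1 \<le> r\<^sup>2" using r by simp
  then show "1 \<le> eta_num sc i k \<omega>" unfolding N by (simp add: le_nat_iff)
  have "real (nat \<lfloor>r\<^sup>2\<rfloor>) = of_int \<lfloor>r\<^sup>2\<rfloor>" using \<open>1 \<le> r\<^sup>2\<close> by simp
  then have "r\<^sup>2 - 1 \<le> real (eta_num sc i k \<omega>)" unfolding N by linarith
  moreover have "1 \<le> real (eta_num sc i k \<omega>)" using \<open>1 \<le> eta_num sc i k \<omega>\<close> by simp
  ultimately have "(r / 2)\<^sup>2 \<le> real (eta_num sc i k \<omega>)" by (simp add: power_divide)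
  then have "r / 2 \<le> sqrt (real (eta_num sc i k \<omega>))" by (rule real_le_rsqrt)
  then have "1 / sqrt (real (eta_num sc i k \<omega>)) \<le> 1 / (r / 2)" using r by (intro frac_le) auto
  also have "\<dots> = 2 * real (update_count sc i k \<omega>) powr - (1 + \<delta>)"
    unfolding r_def powr_minus by (simp add: field_simps)
  finally show "1 / sqrt (real (eta_num sc i k \<omega>)) \<le> 2 * real (update_count sc i k \<omega>) powr - (1 + \<delta>)" .
qed

text \<open>Over the times when player \<open>i\<close> is selected the counter takes no value twice, so that the terms at
  these times are dominated by a convergent \<open>p\<close>-series. The expectation of their sum is \<open>p\<^sub>i\<close> times that of
  the full series.\<close>

lemma update_count_series_finite:
  "(\<Sum>k. \<integral>\<^sup>+\<omega>. ennreal (real (update_count sc i (Suc k) \<omega>) powr - (1 + \<delta>)) \<partial>M) < \<infinity>"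
proof -
  define W where "W k \<omega> = real (update_count sc i (Suc k) \<omega>) powr - (1 + \<delta>)" for k \<omega>
  let ?S = "\<lambda>k. {\<omega>\<in>space M. sel sc (Suc k) \<omega> = i}"
  define \<zeta> where "\<zeta> = (\<Sum>j. real j powr - (1 + \<delta>))"
  have zeta: "summable (\<lambda>j. real j powr - (1 + \<delta>))" using delta_pos by (simp add: summable_real_powr_iff)
  have W: "W k \<in> borel_measurable (\<F> (Suc k))" for k
  proof -
    have [measurable]: "sel sc l \<in> \<F> (Suc k) \<rightarrow>\<^sub>M count_space UNIV" if "l < Suc k" for l
      using Fpre_to_Fk[OF Fpre_measurable(1)[OF that]] by simp
    have "(\<lambda>\<omega>. real (update_count sc i (Suc k) \<omega>))
        = (\<lambda>\<omega>. 1 + (\<Sum>l<Suc k. of_bool (sel sc l \<omega> = i)))"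
      by (simp add: update_count_def fun_eq_iff)
    also have "\<dots> \<in> borel_measurable (\<F> (Suc k))"
      by (intro borel_measurable_add borel_measurable_sum) measurable
    finally have [measurable]: "(\<lambda>\<omega>. real (update_count sc i (Suc k) \<omega>)) \<in> borel_measurable (\<F> (Suc k))" .
    show ?thesis unfolding W_def by measurable
  qed
  have W_M [measurable]: "W k \<in> borel_measurable M" for k
    by (rule measurable_from_subalg[OF Fk_subalgebra W])
  have path: "(\<Sum>k<n. W k \<omega> * of_bool (sel sc (Suc k) \<omega> = i)) \<le> \<zeta>" for n \<omega>
  proof -
    have "(\<Sum>k<n. W k \<omega> * of_bool (sel sc (Suc k) \<omega> = i))
        \<le> (\<Sum>j<update_count sc i (Suc n) \<omega>. real j powr - (1 + \<delta>))"
    proof (induction n)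
      case (Suc n)
      have "update_count sc i (Suc (Suc n)) \<omega> = update_count sc i (Suc n) \<omega> + of_bool (sel sc (Suc n) \<omega> = i)"
        by (simp add: update_count_def)
      then show ?case using Suc by (cases "sel sc (Suc n) \<omega> = i") (auto simp: W_def)
    qed (simp add: sum_nonneg)
    also have "\<dots> \<le> \<zeta>" unfolding \<zeta>_def using zeta by (intro sum_le_suminf) auto
    finally show ?thesis .
  qed
  have "ennreal (prb i) * (\<Sum>k. \<integral>\<^sup>+\<omega>. ennreal (W k \<omega>) \<partial>M)
      = (\<Sum>k. \<integral>\<^sup>+\<omega>. ennreal (W k \<omega>) * indicator (?S k) \<omega> \<partial>M)"
    using nn_integral_thinned[OF Fk_subalgebra selected_set selection_independent] prb_pos[of i] W
    by (simp add: less_imp_le)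
  also have "\<dots> = (\<integral>\<^sup>+\<omega>. (\<Sum>k. ennreal (W k \<omega>) * indicator (?S k) \<omega>) \<partial>M)"
    by (intro nn_integral_suminf[symmetric]) measurable
  also have "\<dots> \<le> (\<integral>\<^sup>+\<omega>. ennreal \<zeta> \<partial>M)"
  proof (intro nn_integral_mono ennreal_suminf_le_of_partial_sums)
    fix \<omega> n assume "\<omega> \<in> space M"
    then have "(\<Sum>k<n. ennreal (W k \<omega>) * indicator (?S k) \<omega>)
        = ennreal (\<Sum>k<n. W k \<omega> * of_bool (sel sc (Suc k) \<omega> = i))"
      by (subst sum_ennreal[symmetric]) (auto simp: W_def indicator_def intro!: sum.cong)
    then show "(\<Sum>k<n. ennreal (W k \<omega>) * indicator (?S k) \<omega>) \<le> ennreal \<zeta>"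
      using path by (simp add: ennreal_leI)
  qed
  also have "\<dots> < \<infinity>" by (simp add: emeasure_space_1)
  finally show ?thesis
    unfolding W_def using prb_pos[of i] by (auto simp: ennreal_mult_less_top)
qed

text \<open>The selection at time \<open>k\<close> may depend on the samples of time \<open>k\<close>. The noise is therefore summed over
  all times, including those when it does not enter the iteration.\<close>

lemma avg_noise_summable: "AE \<omega> in M. summable (\<lambda>k. avg_noise i k \<omega>)"
proof -
  obtain m where m: "0 < m" and var: "\<And>k. AE \<omega> in M. \<forall>q\<in>{1..eta_num sc i k \<omega>}.
      nn_cond_exp M (\<F> k) (\<lambda>\<omega>. ennreal ((norm (sampled_grad gm sc i k q \<omega> - grad (gmean gm) (ths sc i k \<omega>)))\<^sup>2)) \<omega>
      \<le> ennreal (m\<^sup>2)"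
    using B3 unfolding assm_B3_def by blast
  have ths_R: "ths sc i k \<in> \<F> k \<rightarrow>\<^sub>M restrict_space borel (Theta gm)" for k
    using Fpre_to_Fk[OF ths_measurable order_refl] ths_mem by (intro measurable_restrict_space2) auto
  have "continuous_on (Theta gm) (grad (gmean gm))"
    using gmean_gradient_lipschitz by (rule lipschitz_on_continuous_on)
  then have mean_meas [measurable]: "grad (gmean gm) \<in> borel_measurable (restrict_space borel (Theta gm))"
    by (rule borel_measurable_continuous_on_restrict)
  have gnoise_meas: "(\<lambda>(t, e). gnoise t e) \<in> borel_measurable (restrict_space borel (Theta gm) \<Otimes>\<^sub>M borel)"
  proof -
    have "(\<lambda>(t, e). grad (\<lambda>t. gsample gm t e) t)
        \<in> borel_measurable (restrict_space borel (Theta gm) \<Otimes>\<^sub>M borel)"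
      using wf unfolding wf_game_def by blast
    then show ?thesis
      unfolding gnoise_def case_prod_beta'
      by (intro borel_measurable_diff) (simp_all add: case_prod_beta' measurable_compose[OF measurable_fst mean_meas])
  qed
  have law: "prob_space (eta_law gm)" using wf unfolding wf_game_def by blast
  have B2_g: "integrable (eta_law gm) (\<lambda>e. grad (\<lambda>t. gsample gm t e) t)"
      "grad (gmean gm) t = (\<integral>e. grad (\<lambda>t. gsample gm t e) t \<partial>eta_law gm)" if "t \<in> Theta gm" for t
    using B2 that unfolding assm_B2_def by blast+
  have centred: "integrable (eta_law gm) (gnoise t)" "(\<integral>e. gnoise t e \<partial>eta_law gm) = 0" if "t \<in> Theta gm" for t
  proof -
    interpret D: prob_space "eta_law gm" by (rule law)
    show "integrable (eta_law gm) (gnoise t)" "(\<integral>e. gnoise t e \<partial>eta_law gm) = 0"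
      unfolding gnoise_def using B2_g[OF that] by (simp_all add: D.prob_space)
  qed
  have fresh: "fresh_samples M (\<F> k) (eta_law gm) (eta_samp sc i k)" for k
    using eta_fresh[of k i] Fk_le_past[of k k M sc] unfolding fresh_samples_def indep_sets2_eq by blast
  have var': "AE \<omega> in M. \<forall>q\<in>{1..eta_num sc i k \<omega>}.
      nn_cond_exp M (\<F> k) (\<lambda>\<omega>. ennreal ((norm (gnoise (ths sc i k \<omega>) (eta_samp sc i k q \<omega>)))\<^sup>2)) \<omega> \<le> ennreal (m\<^sup>2)" for k
    using var[of k] unfolding gnoise_def sampled_grad_def .
  note bound = fresh_average_bound[OF Fk_subalgebra eta_num_measurable ths_R gnoise_meas centred fresh m var' batch_size(1)]
  have "AE \<omega> in M. summable (\<lambda>k. avg_noise i (Suc k) \<omega>)"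
  proof (rule summable_of_nn_integral_finite)
    show "avg_noise i (Suc k) \<in> borel_measurable M" for k
      unfolding avg_noise_def[abs_def] by (rule bound(1))
    have "(\<integral>\<^sup>+\<omega>. ennreal (avg_noise i (Suc k) \<omega>) \<partial>M)
        \<le> ennreal (2 * m) * (\<integral>\<^sup>+\<omega>. ennreal (real (update_count sc i (Suc k) \<omega>) powr - (1 + \<delta>)) \<partial>M)" for k
    proof -
      have "(\<integral>\<^sup>+\<omega>. ennreal (avg_noise i (Suc k) \<omega>) \<partial>M)
          \<le> (\<integral>\<^sup>+\<omega>. ennreal (m / sqrt (real (eta_num sc i (Suc k) \<omega>))) \<partial>M)"
        unfolding avg_noise_def by (rule bound(2))
      also have "\<dots> \<le> (\<integral>\<^sup>+\<omega>. ennreal (2 * m) * ennreal (real (update_count sc i (Suc k) \<omega>) powr - (1 + \<delta>)) \<partial>M)"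
      proof (rule nn_integral_mono)
        fix \<omega> assume "\<omega> \<in> space M"
        from mult_left_mono[OF batch_size(2)[OF this, of i "Suc k"], of m] m
        have "m / sqrt (real (eta_num sc i (Suc k) \<omega>)) \<le> 2 * m * real (update_count sc i (Suc k) \<omega>) powr - (1 + \<delta>)"
          by simp
        then show "ennreal (m / sqrt (real (eta_num sc i (Suc k) \<omega>)))
            \<le> ennreal (2 * m) * ennreal (real (update_count sc i (Suc k) \<omega>) powr - (1 + \<delta>))"
          using m by (simp add: ennreal_mult[symmetric] ennreal_leI)
      qed
      also have "\<dots> = ennreal (2 * m) * (\<integral>\<^sup>+\<omega>. ennreal (real (update_count sc i (Suc k) \<omega>) powr - (1 + \<delta>)) \<partial>M)"
        unfolding update_count_def by (intro nn_integral_cmult) measurable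
      finally show ?thesis .
    qed
    then have "(\<Sum>k. \<integral>\<^sup>+\<omega>. ennreal (avg_noise i (Suc k) \<omega>) \<partial>M)
        \<le> (\<Sum>k. ennreal (2 * m) * (\<integral>\<^sup>+\<omega>. ennreal (real (update_count sc i (Suc k) \<omega>) powr - (1 + \<delta>)) \<partial>M))"
      by (intro suminf_le) auto
    also have "\<dots> < \<infinity>"
      using update_count_series_finite[of i] by (simp add: ennreal_mult_less_top)
    finally show "(\<Sum>k. \<integral>\<^sup>+\<omega>. ennreal (avg_noise i (Suc k) \<omega>) \<partial>M) < \<infinity>" .
  qed (simp add: avg_noise_def)
  then show ?thesis by eventually_elim (rule summable_Suc_iff[THEN iffD1])
qed

end

text \<open>Each selection removes the share \<open>1 - q\<close> of the current error and adds \<open>b k\<close>, so that what has been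
  removed in total is bounded by the initial error and the sum of \<open>b\<close>.\<close>

lemma selected_contraction:
  fixes u b :: "nat \<Rightarrow> real"
  assumes u: "\<And>k. 0 \<le> u k" and b: "\<And>k. 0 \<le> b k" "summable b" and q: "0 \<le> q" "q < 1"
    and sel: "\<And>k. S k \<Longrightarrow> u (Suc k) \<le> q * u k + b k" and keep: "\<And>k. \<not> S k \<Longrightarrow> u (Suc k) = u k"
  shows "summable (\<lambda>k. u k * of_bool (S k))" and "bdd_above (range u)"
proof -
  have main: "u n + (1 - q) * (\<Sum>k<n. u k * of_bool (S k)) \<le> u 0 + suminf b" for n
  proof -
    have "u n + (1 - q) * (\<Sum>k<n. u k * of_bool (S k)) \<le> u 0 + (\<Sum>k<n. b k)"
    proof (induction n)
      case (Suc n)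
      show ?case
      proof (cases "S n")
        case True
        then show ?thesis using Suc sel[OF True] by (simp add: algebra_simps)
      next
        case False
        then show ?thesis using Suc keep[OF False] b(1)[of n] by simp
      qed
    qed simp
    moreover have "(\<Sum>k<n. b k) \<le> suminf b" using b by (intro sum_le_suminf) auto
    ultimately show ?thesis by simp
  qed
  have "(\<Sum>k<n. u k * of_bool (S k)) \<le> (u 0 + suminf b) / (1 - q)" for n
    using main[of n] u[of n] q by (simp add: field_simps)
  then show "summable (\<lambda>k. u k * of_bool (S k))"
    by (intro summableI_nonneg_bounded) (use u in auto)
  have nonneg: "0 \<le> (1 - q) * (\<Sum>k<n. u k * of_bool (S k))" for n
    using u q by (intro mult_nonneg_nonneg sum_nonneg) auto
  have "u n \<le> u 0 + suminf b" for n using main[of n] nonneg[of n] by linarith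
  then show "bdd_above (range u)" by (auto simp: bdd_above_def)
qed

lemma summable_power2:
  fixes f :: "nat \<Rightarrow> real"
  assumes "summable f" "\<And>k. 0 \<le> f k"
  shows "summable (\<lambda>k. (f k)\<^sup>2)"
proof (rule summable_comparison_test_ev[OF _ assms(1)])
  have "f \<longlonglongrightarrow> 0" by (rule summable_LIMSEQ_zero[OF assms(1)])
  then have "eventually (\<lambda>k. f k < 1) sequentially" by (rule order_tendstoD) simp
  then show "eventually (\<lambda>k. norm ((f k)\<^sup>2) \<le> f k) sequentially"
    by eventually_elim (use assms(2) in \<open>auto simp: power2_eq_square intro: mult_left_le\<close>)
qed

context asynchronous_game
begin

lemma ths_selected_step:
  assumes \<omega>: "\<omega> \<in> space M" and sel: "sel sc k \<omega> = i"
  shows "norm (ths sc i (Suc k) \<omega> - \<theta>')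
    \<le> sqrt (max 0 (1 - \<mu>g / Lg)) * norm (ths sc i k \<omega> - \<theta>') + avg_noise i k \<omega> / Lg"
proof -
  define t where "t = ths sc i k \<omega>"
  define N where "N = eta_num sc i k \<omega>"
  define s where "s = (\<Sum>q = 1..N. gnoise t (eta_samp sc i k q \<omega>))"
  define p where "p = t - (1 / Lg) *\<^sub>R grad (gmean gm) t"
  let ?cp = "closest_point (Theta gm)"
  have t: "t \<in> Theta gm" unfolding t_def by (rule ths_mem[OF \<omega>])
  have Th: "closed (Theta gm)" "convex (Theta gm)" using wf unfolding wf_game_def by blast+
  have N: "1 \<le> N" unfolding N_def by (rule batch_size(1)[OF \<omega>])
  have "(\<Sum>q = 1..N. sampled_grad gm sc i k q \<omega>) = real N *\<^sub>R grad (gmean gm) t + s"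
  proof -
    have "sampled_grad gm sc i k q \<omega> = grad (gmean gm) t + gnoise t (eta_samp sc i k q \<omega>)" for q
      unfolding sampled_grad_def gnoise_def t_def by simp
    then show ?thesis unfolding s_def by (simp add: sum.distrib sum_constant_scaleR del: sum_constant)
  qed
  then have "ths sc i (Suc k) \<omega> = ?cp (t - ((1 / Lg) / real N) *\<^sub>R (real N *\<^sub>R grad (gmean gm) t + s))"
    using selected_ths[OF \<omega> sel] unfolding t_def N_def by simp
  also have "t - ((1 / Lg) / real N) *\<^sub>R (real N *\<^sub>R grad (gmean gm) t + s)
      = p - (1 / Lg) *\<^sub>R ((1 / real N) *\<^sub>R s)"
    using N unfolding p_def by (simp add: scaleR_add_right)
  finally have step: "ths sc i (Suc k) \<omega> = ?cp (p - (1 / Lg) *\<^sub>R ((1 / real N) *\<^sub>R s))" .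
  have "dist (?cp (p - (1 / Lg) *\<^sub>R ((1 / real N) *\<^sub>R s))) (?cp p)
      \<le> dist (p - (1 / Lg) *\<^sub>R ((1 / real N) *\<^sub>R s)) p"
    using Th t by (intro closest_point_lipschitz) auto
  also have "\<dots> = avg_noise i k \<omega> / Lg"
    using Lg_pos unfolding avg_noise_def s_def t_def N_def by (simp add: dist_norm)
  finally have noise: "norm (ths sc i (Suc k) \<omega> - ?cp p) \<le> avg_noise i k \<omega> / Lg"
    unfolding step dist_norm .
  have "(norm (?cp p - \<theta>'))\<^sup>2 \<le> (1 - \<mu>g / Lg) * (norm (t - \<theta>'))\<^sup>2"
    unfolding p_def
  proof (rule projected_gradient_contraction[OF Th(1) gmean_strongly_convex Lg_pos gmean_GDERIV _ t theta_star_mem])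
    show "norm (grad (gmean gm) u - grad (gmean gm) v) \<le> Lg * norm (u - v)"
      if "u \<in> Theta gm" "v \<in> Theta gm" for u v
      using lipschitz_onD[OF gmean_gradient_lipschitz that] by (simp add: dist_norm)
    show "gmean gm \<theta>' \<le> gmean gm u" if "u \<in> Theta gm" for u
      using wf that unfolding wf_game_def by blast
  qed
  also have "\<dots> \<le> max 0 (1 - \<mu>g / Lg) * (norm (t - \<theta>'))\<^sup>2" by (intro mult_right_mono) auto
  also have "\<dots> = (sqrt (max 0 (1 - \<mu>g / Lg)) * norm (t - \<theta>'))\<^sup>2" by (simp add: power_mult_distrib)
  finally have "norm (?cp p - \<theta>') \<le> sqrt (max 0 (1 - \<mu>g / Lg)) * norm (t - \<theta>')"
    by (rule power2_le_imp_le) simp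
  then show ?thesis
    using noise norm_triangle_ineq[of "ths sc i (Suc k) \<omega> - ?cp p" "?cp p - \<theta>'"] unfolding t_def by simp
qed

lemma ths_error_summable: "AE \<omega> in M. summable (\<lambda>k. norm (ths sc i k \<omega> - \<theta>'))"
proof -
  let ?q = "sqrt (max 0 (1 - \<mu>g / Lg))"
  have q: "0 \<le> ?q" "?q < 1" using Lg_pos mug_pos by (auto simp: max_def)
  have contraction: "AE \<omega> in M. summable (\<lambda>k. norm (ths sc i k \<omega> - \<theta>') * of_bool (sel sc k \<omega> = i))
      \<and> bdd_above (range (\<lambda>k. norm (ths sc i k \<omega> - \<theta>')))"
    using avg_noise_summable[of i] AE_space
  proof eventually_elim
    case (elim \<omega>)
    have b: "0 \<le> avg_noise i k \<omega> / Lg" for k using Lg_pos by (simp add: avg_noise_def)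
    show ?case
      using selected_contraction[of "\<lambda>k. norm (ths sc i k \<omega> - \<theta>')" "\<lambda>k. avg_noise i k \<omega> / Lg" ?q
          "\<lambda>k. sel sc k \<omega> = i"] b q summable_divide[OF elim(1), of Lg] ths_selected_step[OF elim(2)]
        unselected_ths[OF elim(2)] by simp
  qed
  show ?thesis
  proof (rule summable_of_summable_selected)
    have meas: "(\<lambda>\<omega>. norm (ths sc i k \<omega> - \<theta>')) \<in> borel_measurable (Fpre M sc k)" for k
      using ths_measurable[of i k] by measurable
    then show "(\<lambda>\<omega>. norm (ths sc i k \<omega> - \<theta>')) \<in> borel_measurable (\<F> k)" for k
      by (rule Fpre_to_Fk) simp
    show "(\<lambda>\<omega>. norm (ths sc i k \<omega> - \<theta>') * of_bool (sel sc k \<omega> = i)) \<in> borel_measurable (Fpre M sc (Suc k))" for k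
    proof -
      note [measurable] = Fpre_Suc[OF meas, of k "Suc k"] Fpre_measurable(1)[of k "Suc k"]
      show ?thesis by measurable
    qed
  qed (use contraction in \<open>auto elim!: eventually_mono\<close>)
qed

section \<open>Inexactness of the best responses\<close>

text \<open>The error \<open>\<epsilon>_i(k + 1)\<close> is computed from \<open>F_k\<close> and from samples that are independent of the whole past,
  so that the assumed conditional expectations given \<open>F_k\<close> are also those given the past.\<close>

lemma eps_summable: "AE \<omega> in M. summable (\<lambda>k. norm (eps sc i (Suc k) \<omega>))"
proof -
  define Gen where "Gen k = (\<Union>q\<in>{1..}. events_of M borel (xi_samp sc i k q))" for k
  define K where "K k = sigma (space M) (Gen k)" for k
  have Gen_Pow: "Gen k \<subseteq> Pow (space M)" for k unfolding Gen_def by (intro UN_least events_of_subset_Pow)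
  have sets_K: "sets (K k) = sigma_sets (space M) (Gen k)" and space_K: "space (K k) = space M" for k
    unfolding K_def using Gen_Pow by simp_all
  have indep: "indep_set (sets (past M sc k)) (sets (K k))" for k
    using xi_fresh[of k i] unfolding fresh_samples_def sets_K Gen_def by blast
  have K: "subalgebra M (K k)" for k
    using indep[of k] space_K unfolding indep_sets2_eq subalgebra_def by simp
  have eps_K: "eps sc i (Suc k) \<in> borel_measurable (sigma (space M) (sets (\<F> k) \<union> sets (K k)))" for k
  proof -
    let ?G = "sigma (space M) (sets (\<F> k) \<union> sets (K k))"
    have Pow: "sets (\<F> k) \<union> sets (K k) \<subseteq> Pow (space M)"
      using sets.space_closed[of "\<F> k"] sets.space_closed[of "K k"] space_K by simp
    have F_G: "sets (\<F> k) \<subseteq> sets ?G" by (rule sets_sigma_superset[OF _ Pow]) simp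
    have "Gen k \<subseteq> sets (K k)" unfolding K_def by (rule sets_sigma_superset[OF order_refl Gen_Pow])
    then have Gen_G: "Gen k \<subseteq> sets ?G" by (intro sets_sigma_superset[OF _ Pow]) auto
    have "xi_vec sc i k q \<in> borel_measurable ?G" for q
      unfolding xi_vec_def[abs_def]
    proof (rule padded_sample_measurable)
      show "xi_num sc i k \<in> ?G \<rightarrow>\<^sub>M count_space UNIV"
        by (rule measurable_mono_sets[OF xi_num_measurable F_G]) simp
      fix q :: nat assume "1 \<le> q"
      then have "events_of M borel (xi_samp sc i k q) \<subseteq> sets ?G"
        using Gen_G unfolding Gen_def by auto
      then show "xi_samp sc i k q \<in> borel_measurable ?G" by (rule measurable_of_events_of) auto
    qed
    then have "events_of M borel (xi_vec sc i k q) \<subseteq> sets ?G" for q by (rule events_of_subset) simp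
    then have "sets (\<F> k) \<union> (\<Union>q. events_of M borel (xi_vec sc i k q)) \<subseteq> sets ?G" using F_G by blast
    then have "sets (sigma (space M) (sets (\<F> k) \<union> (\<Union>q. events_of M borel (xi_vec sc i k q)))) \<subseteq> sets ?G"
      by (rule sets_sigma_le) simp
    then show ?thesis by (rule measurable_mono_sets[OF eps_measurable]) simp
  qed
  have "AE \<omega> in M. summable (\<lambda>k. norm (eps sc i (Suc (Suc k)) \<omega>))"
  proof (rule summable_of_summable_cond_exp[where F = "\<lambda>k. \<F> (Suc k)" and H = "\<lambda>k. past M sc (Suc k)"])
    show "subalgebra (past M sc (Suc l)) (\<F> (Suc k))" if "k \<le> l" for k l
      using Fk_le_past[of "Suc k" "Suc l" M sc] that by (simp add: subalgebra_def)
    show "subalgebra M (past M sc (Suc k))" for k by (rule past_subalgebra)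
    show "AE \<omega> in M. (\<Sum>k. nn_cond_exp M (\<F> (Suc k)) (\<lambda>\<omega>. ennreal (norm (eps sc i (Suc (Suc k)) \<omega>))) \<omega>) < \<infinity>"
      using B3 unfolding assm_B3_def by simp
    fix k
    let ?G = "sigma (space M) (sets (\<F> (Suc k)) \<union> sets (K (Suc k)))"
    have "sets ?G \<subseteq> sets M"
      using Fk_subalgebra[of "Suc k"] K[of "Suc k"] by (intro sets_sigma_le) (auto simp: subalgebra_def)
    from measurable_mono_sets[OF eps_K this]
    have eps_M: "eps sc i (Suc (Suc k)) \<in> borel_measurable M" by simp
    then show "(\<lambda>\<omega>. norm (eps sc i (Suc (Suc k)) \<omega>)) \<in> borel_measurable M" by measurable
    fix B assume B: "B \<in> sets (past M sc (Suc k))"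
    show "(\<integral>\<^sup>+\<omega>. indicator B \<omega> * ennreal (norm (eps sc i (Suc (Suc k)) \<omega>)) \<partial>M)
        = (\<integral>\<^sup>+\<omega>. indicator B \<omega> * nn_cond_exp M (\<F> (Suc k)) (\<lambda>\<omega>. ennreal (norm (eps sc i (Suc (Suc k)) \<omega>))) \<omega> \<partial>M)"
    proof (rule cond_exp_given_larger_field[OF _ past_subalgebra K _ _ B])
      show "subalgebra (past M sc (Suc k)) (\<F> (Suc k))"
        using Fk_le_past[of "Suc k" "Suc k" M sc] by (simp add: subalgebra_def)
      show "prob (A \<inter> D) = prob A * prob D" if "A \<in> sets (past M sc (Suc k))" "D \<in> sets (K (Suc k))" for A D
        using indep that unfolding indep_sets2_eq by blast
      show "(\<lambda>\<omega>. ennreal (norm (eps sc i (Suc (Suc k)) \<omega>))) \<in> borel_measurable ?G"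
        using eps_K by measurable
    qed
  qed simp
  then show ?thesis by eventually_elim (rule summable_Suc_iff[THEN iffD1])
qed

section \<open>Residuals and limit points\<close>

lemma delayed_eq:
  "delayed gm sc i k \<omega> = delay_profile own (\<lambda>l. xs sc l \<omega>) (\<lambda>j. delay sc i j k \<omega>) k"
  unfolding delayed_def delay_profile_def ..

text \<open>The delays \<open>d\<close> and the field \<open>F\<close> are kept general because the residual is needed in two
  situations: with the delays of player \<open>i\<close>, known to \<open>F_k\<close>, and with those of the selected player,
  known to \<open>F'_{k+1}\<close>.\<close>

lemma residual_measurable:
  assumes F: "space F = space M" and xs: "\<And>l. l \<le> k \<Longrightarrow> xs sc l \<in> borel_measurable F"
    and d: "\<And>j. d j \<in> F \<rightarrow>\<^sub>M count_space UNIV"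
  shows "(\<lambda>\<omega>. (norm (T i (delay_profile own (\<lambda>l. xs sc l \<omega>) (\<lambda>j. d j \<omega>) k) \<theta>' - block own i (xs sc k \<omega>)))\<^sup>2)
    \<in> borel_measurable F"
proof -
  let ?y = "\<lambda>\<omega>. delay_profile own (\<lambda>l. xs sc l \<omega>) (\<lambda>j. d j \<omega>) k"
  have comp: "(\<lambda>\<omega>. ?y \<omega> $ c) \<in> borel_measurable F" for c
  proof -
    have "(\<lambda>\<omega>. xs sc (k - m) \<omega> $ c) \<in> borel_measurable F" for m
      by (rule measurable_compose[OF xs]) (auto intro!: borel_measurable_continuous_onI continuous_intros)
    from measurable_compose_countable[OF this d] show ?thesis by (simp add: delay_profile_def)
  qed
  have y: "?y \<in> borel_measurable F"
  proof (rule borel_measurable_euclidean_space[THEN iffD2], rule ballI)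
    fix b :: "real^'c" assume "b \<in> Basis"
    then obtain c where "b = axis c 1" by (auto simp: Basis_vec_def)
    then show "(\<lambda>\<omega>. inner (?y \<omega>) b) \<in> borel_measurable F" using comp[of c] by (simp add: inner_axis)
  qed
  have yX: "?y \<in> F \<rightarrow>\<^sub>M restrict_space borel X"
    using y F delay_profile_mem xs_mem by (intro measurable_restrict_space2) auto
  have "((Lx + \<mu>) / \<mu>)-lipschitz_on X (\<lambda>x. T i x \<theta>')"
    using prox_lipschitz Lx_nonneg mu_pos by (intro lipschitz_onI) (auto simp: dist_norm)
  then have "(\<lambda>x. T i x \<theta>') \<in> borel_measurable (restrict_space borel X)"
    by (intro borel_measurable_continuous_on_restrict lipschitz_on_continuous_on)
  from measurable_compose[OF yX this] have [measurable]: "(\<lambda>\<omega>. T i (?y \<omega>) \<theta>') \<in> borel_measurable F" .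
  have [measurable]: "(\<lambda>\<omega>. block own i (xs sc k \<omega>)) \<in> borel_measurable F"
    by (rule measurable_compose[OF xs[OF order_refl]]) (intro borel_measurable_continuous_onI continuous_on_block)
  show ?thesis by measurable
qed

lemma residuals_bounded:
  obtains R where "\<And>i x y. x \<in> X \<Longrightarrow> y \<in> X \<Longrightarrow> (norm (T i y \<theta>' - block own i x))\<^sup>2 \<le> R"
proof -
  have "\<exists>B. \<forall>y\<in>strat gm i. norm y \<le> B" for i
    using strat_compact[of i, THEN compact_imp_bounded] unfolding bounded_iff .
  then obtain B where B: "\<And>i y. y \<in> strat gm i \<Longrightarrow> norm y \<le> B i" by metis
  show ?thesis
  proof (rule that[of "\<Sum>i\<in>UNIV. (2 * B i)\<^sup>2"])
    fix i x y assume xy: "x \<in> X" "y \<in> X"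
    have "norm (T i y \<theta>' - block own i x) \<le> norm (T i y \<theta>') + norm (block own i x)"
      by (rule norm_triangle_ineq4)
    also have "\<dots> \<le> B i + B i"
      using xy prox_mem theta_star_mem profile_block by (intro add_mono B) auto
    finally have "(norm (T i y \<theta>' - block own i x))\<^sup>2 \<le> (2 * B i)\<^sup>2" by (intro power_mono) auto
    also have "\<dots> \<le> (\<Sum>i\<in>UNIV. (2 * B i)\<^sup>2)" by (rule member_le_sum) auto
    finally show "(norm (T i y \<theta>' - block own i x))\<^sup>2 \<le> (\<Sum>i\<in>UNIV. (2 * B i)\<^sup>2)" .
  qed
qed

lemma selected_residuals_summable:
  "AE \<omega> in M.
     summable (\<lambda>k. (norm (T (sel sc k \<omega>) (delayed gm sc (sel sc k \<omega>) k \<omega>) \<theta>'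
       - block own (sel sc k \<omega>) (xs sc k \<omega>)))\<^sup>2) \<and>
     summable (\<lambda>k. (norm (xs sc (Suc k) \<omega> - xs sc k \<omega>))\<^sup>2)"
proof -
  have \<mu>: "Lx / 2 + Lx * real \<tau> < \<mu>"
  proof -
    have "1 \<le> sqrt 3" by (rule real_le_rsqrt) simp
    then have "1 * (Lx * real \<tau>) \<le> sqrt 3 * (Lx * real \<tau>)"
      using Lx_nonneg by (intro mult_right_mono) auto
    then show ?thesis using mu_large by simp
  qed
  have "AE \<omega> in M. \<forall>i. summable (\<lambda>k. norm (ths sc i k \<omega> - \<theta>'))"
    using ths_error_summable by (simp add: AE_all_countable)
  moreover have "AE \<omega> in M. \<forall>i. summable (\<lambda>k. norm (eps sc i (Suc k) \<omega>))"
    using eps_summable by (simp add: AE_all_countable)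
  ultimately show ?thesis using AE_space
  proof eventually_elim
    case (elim \<omega>)
    have selected: "summable (\<lambda>k. norm (f (sel sc k \<omega>) k))"
      if "\<And>i. summable (\<lambda>k. norm (f i k))" for f :: "'n \<Rightarrow> nat \<Rightarrow> 'v::real_normed_vector"
    proof (rule summable_comparison_test'[of "\<lambda>k. \<Sum>i\<in>UNIV. norm (f i k)" 0])
      show "summable (\<lambda>k. \<Sum>i\<in>UNIV. norm (f i k))" by (intro summable_sum that)
      show "norm (norm (f (sel sc k \<omega>) k)) \<le> (\<Sum>i\<in>UNIV. norm (f i k))" for k
        by simp (rule member_le_sum, auto)
    qed
    note path = inexact_delayed_responses_summable[of "\<lambda>k. xs sc k \<omega>" "\<lambda>k. ths sc (sel sc k \<omega>) k \<omega>"
        "\<lambda>k j. delay sc (sel sc k \<omega>) j k \<omega>" "\<lambda>k. sel sc k \<omega>" \<tau> "\<lambda>k. eps sc (sel sc k \<omega>) (Suc k) \<omega>",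
        folded delayed_eq, OF xs_mem[OF elim(3)] ths_mem[OF elim(3)] delay_self[OF elim(3)] delay_le[OF elim(3)]
        selected_update[OF elim(3)] unselected_xs[OF elim(3)]
        selected[of "\<lambda>i k. eps sc i (Suc k) \<omega>"] selected[of "\<lambda>i k. ths sc i k \<omega> - \<theta>'"] \<mu>]
    show ?case using path elim(1,2) by blast
  qed
qed

text \<open>The residuals of player \<open>i\<close> at the times of its own updates are among those already summed. Only the
  delays of the selected player enter \<open>F'\<close>; at these times they coincide with those of player \<open>i\<close>.\<close>

lemma residuals_summable:
  "AE \<omega> in M. summable (\<lambda>k. (norm (T i (delayed gm sc i k \<omega>) \<theta>' - block own i (xs sc k \<omega>)))\<^sup>2)"
proof (rule summable_of_summable_selected)
  let ?W = "\<lambda>k \<omega>. (norm (T i (delayed gm sc i k \<omega>) \<theta>' - block own i (xs sc k \<omega>)))\<^sup>2"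
  show "?W k \<in> borel_measurable (\<F> k)" for k
    unfolding delayed_eq
    by (rule residual_measurable) (auto intro: Fpre_to_Fk[OF xs_measurable] Fk_delay_measurable)
  show "(\<lambda>\<omega>. ?W k \<omega> * of_bool (sel sc k \<omega> = i)) \<in> borel_measurable (Fpre M sc (Suc k))" for k
  proof -
    let ?V = "\<lambda>\<omega>. (norm (T i (delay_profile own (\<lambda>l. xs sc l \<omega>) (\<lambda>j. delay sc (sel sc k \<omega>) j k \<omega>) k) \<theta>'
      - block own i (xs sc k \<omega>)))\<^sup>2"
    have [measurable]: "?V \<in> borel_measurable (Fpre M sc (Suc k))"
      by (rule residual_measurable) (auto intro: Fpre_Suc[OF xs_measurable] Fpre_measurable(2))
    note [measurable] = Fpre_measurable(1)[of k "Suc k"]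
    have "(\<lambda>\<omega>. ?V \<omega> * of_bool (sel sc k \<omega> = i)) \<in> borel_measurable (Fpre M sc (Suc k))" by measurable
    moreover have "(\<lambda>\<omega>. ?W k \<omega> * of_bool (sel sc k \<omega> = i)) = (\<lambda>\<omega>. ?V \<omega> * of_bool (sel sc k \<omega> = i))"
      by (auto simp: delayed_eq fun_eq_iff)
    ultimately show ?thesis by simp
  qed
  obtain R where R: "\<And>i x y. x \<in> X \<Longrightarrow> y \<in> X \<Longrightarrow> (norm (T i y \<theta>' - block own i x))\<^sup>2 \<le> R"
    using residuals_bounded by blast
  show "AE \<omega> in M. bdd_above (range (\<lambda>k. ?W k \<omega>))"
    using AE_space
  proof eventually_elim
    case (elim \<omega>)
    then have "?W k \<omega> \<le> R" for k
      unfolding delayed_eq using xs_mem delay_profile_mem by (intro R) auto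
    then show ?case by (auto simp: bdd_above_def)
  qed
  show "AE \<omega> in M. summable (\<lambda>k. ?W k \<omega> * of_bool (sel sc k \<omega> = i))"
    using selected_residuals_summable
  proof eventually_elim
    case (elim \<omega>)
    show ?case
      by (rule summable_comparison_test'[OF conjunct1[OF elim], of 0]) auto
  qed
qed simp

lemma cluster_points:
  "AE \<omega> in M. cluster_set (\<lambda>k. xs sc k \<omega>) \<subseteq> nash gm \<and> connected (cluster_set (\<lambda>k. xs sc k \<omega>)) \<and>
    cluster_set (\<lambda>k. xs sc k \<omega>) \<noteq> {} \<and> (\<lambda>k. infdist (xs sc k \<omega>) (cluster_set (\<lambda>k. xs sc k \<omega>))) \<longlonglongrightarrow> 0"
proof -
  have "AE \<omega> in M. \<forall>i. summable (\<lambda>k. (norm (T i (delayed gm sc i k \<omega>) \<theta>' - block own i (xs sc k \<omega>)))\<^sup>2)"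
    using residuals_summable by (simp add: AE_all_countable)
  then show ?thesis using selected_residuals_summable AE_space
  proof eventually_elim
    case (elim \<omega>)
    let ?x = "\<lambda>k. xs sc k \<omega>"
    have sq: "f \<longlonglongrightarrow> 0" if "summable (\<lambda>k. (f k)\<^sup>2)" "\<And>k. 0 \<le> f k" for f :: "nat \<Rightarrow> real"
      using tendsto_real_sqrt[OF summable_LIMSEQ_zero[OF that(1)]] that(2) by simp
    have step: "(\<lambda>k. norm (?x (Suc k) - ?x k)) \<longlonglongrightarrow> 0" by (rule sq) (use elim(2) in auto)
    have x: "?x k \<in> X" for k by (rule xs_mem[OF elim(3)])
    have "cluster_set ?x \<subseteq> nash gm"
    proof (rule cluster_points_nash[of ?x "\<lambda>i j k. delay sc i j k \<omega>" \<tau>, OF x delay_le[OF elim(3)] step])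
      show "(\<lambda>k. norm (T i (delay_profile own ?x (\<lambda>j. delay sc i j k \<omega>) k) \<theta>' - block own i (?x k))) \<longlonglongrightarrow> 0" for i
        using elim(1) unfolding delayed_eq by (intro sq) auto
    qed
    moreover have "range ?x \<subseteq> X" using x by blast
    then have "connected (cluster_set ?x)"
      by (rule connected_cluster_set[OF bounded_subset[OF compact_imp_bounded[OF compact_profiles]] step])
    ultimately show ?case
      using cluster_set_nonempty[of X ?x, OF compact_profiles x]
        infdist_cluster_set_tendsto_0[of X ?x, OF compact_profiles x] by blast
  qed
qed

end

theorem theorem4:
  fixes M :: "'w measure"
    and gm :: "('n::finite, 'c::finite, 'm::finite, 'd::finite, 'p::finite) game"
    and sc :: "('w, 'n, 'c, 'm, 'd, 'p) scheme"
    and prb :: "'n \<Rightarrow> real"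
    and Lx \<mu>g Lg \<mu> \<delta> :: real
    and \<tau> :: nat
  assumes "prob_space M"
    and "wf_game gm"
    and "async_scheme M gm \<mu> Lg prb sc"
    and "assm_B1 gm Lx \<mu>g Lg"
    and "assm_B2 gm"
    and "assm_B3 M gm sc \<tau>"
    and "\<mu> > 0"
    and "\<mu> > Lx / 2 + sqrt 3 * Lx * real \<tau>"
    and "\<delta> > 0"
    and "\<And>i k \<omega>. \<omega> \<in> space M \<Longrightarrow>
           eta_num sc i k \<omega> = nat \<lfloor>real (update_count sc i k \<omega>) powr (2 * (1 + \<delta>))\<rfloor>"
  shows "(\<forall>i. (AE \<omega> in M. summable (\<lambda>k. (norm (ths sc i (Suc k) \<omega> - theta_star gm))\<^sup>2)) \<and>
              (AE \<omega> in M. summable (\<lambda>k. norm (ths sc i (Suc k) \<omega> - theta_star gm)))) \<and>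
         (\<forall>i. AE \<omega> in M. summable (\<lambda>k.
            (norm (prox_response gm \<mu> i (delayed gm sc i k \<omega>) (theta_star gm)
                   - block (owner gm) i (xs sc k \<omega>)))\<^sup>2)) \<and>
         (AE \<omega> in M. \<forall>z. (\<exists>r. strict_mono r \<and> (\<lambda>k. xs sc (r k) \<omega>) \<longlonglongrightarrow> z) \<longrightarrow> z \<in> nash gm) \<and>
         (AE \<omega> in M. \<exists>Xc. connected Xc \<and> Xc \<noteq> {} \<and> Xc \<subseteq> nash gm \<and>
            (\<lambda>k. infdist (xs sc k \<omega>) Xc) \<longlonglongrightarrow> 0)"
proof -
  interpret prob_space M by fact
  interpret asynchronous_game gm Lx \<mu>g Lg \<mu> M sc prb \<delta> \<tau>
    by unfold_locales (use assms in auto)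
  have \<theta>: "AE \<omega> in M. summable (\<lambda>k. norm (ths sc i (Suc k) \<omega> - theta_star gm))" for i
    using ths_error_summable[of i] by eventually_elim (rule summable_Suc_iff[THEN iffD2])
  have "AE \<omega> in M. summable (\<lambda>k. (norm (ths sc i (Suc k) \<omega> - theta_star gm))\<^sup>2)" for i
    using \<theta>[of i] by eventually_elim (rule summable_power2, auto)
  moreover have "AE \<omega> in M. \<forall>z. (\<exists>r. strict_mono r \<and> (\<lambda>k. xs sc (r k) \<omega>) \<longlonglongrightarrow> z) \<longrightarrow> z \<in> nash gm"
    using cluster_points
  proof eventually_elim
    case (elim \<omega>)
    then show ?case using subsequence_limit_in_cluster_set[of _ "\<lambda>k. xs sc k \<omega>"] by blast
  qed
  moreover have "AE \<omega> in M. \<exists>Xc. connected Xc \<and> Xc \<noteq> {} \<and> Xc \<subseteq> nash gm \<and>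
      (\<lambda>k. infdist (xs sc k \<omega>) Xc) \<longlonglongrightarrow> 0"
    using cluster_points by eventually_elim blast
  ultimately show ?thesis using \<theta> residuals_summable by simp
qed

end
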